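(* Let $M$ be a partial multiplication matrix whose row-column graph $G_M$ is a cycle, and let $\mathcal{C}\subseteq\mathsf{Grid}(M)$ be a permutation class. Then $\mathcal{C}$ is well quasi-ordered (under containment) if and only if $\mathcal{C}$ contains only finitely many end-inflated $M$-coils.
   Context: Permutations are identified with their plots; $\sigma\le\pi$ if $\pi$ has a subsequence order-isomorphic to $\sigma$. A permutation class is a containment-closed set. A set of permutations is well quasi-ordered if every infinite sequence $x_1,x_2,\dots$ in it has $i<j$ with $x_i\le x_j$. A gridding matrix has entries in $\{0,1,-1\}$; an $m\times n$ one has $m$ columns, $n$ rows, $M_{ij}$ in column $i$ from the left and row $j$ from the bottom. An $M$-gridding of a permutation $\pi$ of length $L$ is a choice of vertical lines $\tfrac12=v_0\le\dots\le v_m=L+\tfrac12$ and horizontal lines $\tfrac12=h_0\le\dots\le h_n=L+\tfrac12$, not through points of $\pi$, such that in each cell $C_{ij}=\{v_{i-1}<x<v_i,\ h_{j-1}<y<h_j\}$ the points of $\pi$ are absent if $M_{ij}=0$, increasing if $M_{ij}=1$, decreasing if $M_{ij}=-1$; $\pi$ with such a gridding is an $M$-gridded permutation $\pi^\#$, and $\mathsf{Grid}(M)$ is the class of permutations having an $M$-gridding. The row-column graph $G_M$ is the bipartite graph on $\{1,\dots,m\}\cup\{1',\dots,n'\}$ with edge $ij'$ iff $M_{ij}\neq 0$. $M$ is a partial multiplication matrix if there are fixed $c_1,\dots,c_m,r_1,\dots,r_n\in\{\pm1\}$ with $M_{ij}=c_ir_j$ for each non-zero entry. Column $i$ is oriented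 left-to-right if $c_i=1$, right-to-left otherwise; row $j$ bottom-to-top if $r_j=1$, top-to-bottom otherwise. The orientation digraph $D_{\pi^\#}$ has the points of $\pi^\#$ as vertices and $x\to y$ whenever $x,y$ lie in a common column of cells and $x$ precedes $y$ in that column's orientation, or in a common row of cells and $x$ precedes $y$ in that row's orientation. Let $\ell$ be the length of the cycle $G_M$. A gridded $M$-coil is an $M$-gridded permutation of length $n>\ell$ with an ordering $v_1,\dots,v_n$ of its points and a labelling of the $\ell$ non-zero cells by $1,\dots,\ell$ such that (C1) $v_i$ lies in cell $i\bmod\ell$ (residues in $\{1,\dots,\ell\}$); (C2) $v_{i-1}\to v_i$ for $1<i\le n$; (C3) $v_i\to v_{i-\ell-1}$ for $\ell+1<i\le n$; (C4) $v_{\ell+1}\to v_1$. Given a gridded $M$-coil $\mathcal{O}$ with points $v_1,\dots,v_n$, let $\alpha^\#_{\mathcal{O}}$ be obtained by replacing $v_1$ by two points, consecutive in both position and value and in the same cell as $v_1$, forming an increasing pair if that cell's entry is $1$ and a decreasing pair if it is $-1$, and likewise replacing $v_n$. The underlying (ungridded) permutation $\alpha_{\mathcal{O}}$ is called an end-inflated $M$-coil. *)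

theory Defs
  imports Main
begin

section \<open>Permutations and containment\<close>

text \<open>A permutation of length L is a list of the values 0..L-1 (each once);
  the point of the plot at position x (0-based) has value p!x.\<close>

definition is_perm :: "nat list \<Rightarrow> bool" where
  "is_perm p \<longleftrightarrow> distinct p \<and> set p = {0..<length p}"

text \<open>sigma \<le> pi: pi has a subsequence order-isomorphic to sigma.\<close>
definition perm_le :: "nat list \<Rightarrow> nat list \<Rightarrow> bool" where
  "perm_le s p \<longleftrightarrow> (\<exists>f. (\<forall>i j. i < j \<and> j < length s \<longrightarrow> f i < f j)
      \<and> (\<forall>i < length s. f i < length p)
      \<and> (\<forall>i < length s. \<forall>j < length s. s!i < s!j \<longleftrightarrow> p!(f i) < p!(f j)))"

definition perm_class :: "nat list set \<Rightarrow> bool" where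
  "perm_class C \<longleftrightarrow> (\<forall>p\<in>C. is_perm p) \<and>
     (\<forall>p\<in>C. \<forall>s. is_perm s \<and> perm_le s p \<longrightarrow> s \<in> C)"

definition wqo_perms :: "nat list set \<Rightarrow> bool" where
  "wqo_perms C \<longleftrightarrow> (\<forall>x :: nat \<Rightarrow> nat list. (\<forall>k. x k \<in> C) \<longrightarrow>
      (\<exists>i j. i < j \<and> perm_le (x i) (x j)))"

section \<open>Gridding matrices and griddings\<close>

text \<open>A gridding matrix with m columns and n rows is M :: nat => nat => int, where
  M i j is the entry in column i (1..m, from the left) and row j (1..n, from the bottom).\<close>

definition gridding_matrix :: "(nat \<Rightarrow> nat \<Rightarrow> int) \<Rightarrow> nat \<Rightarrow> nat \<Rightarrow> bool" where
  "gridding_matrix M m n \<longleftrightarrow> (\<forall>i\<in>{1..m}. \<forall>j\<in>{1..n}. M i j \<in> {-1, 0, 1})"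

text \<open>Grid lines are encoded by integers: the vertical line v k lies between
  positions v k - 1 and v k (0-based), i.e. at the half-integer v k + 1/2 in the
  1-based convention; similarly for horizontal lines and values.
  Thus v 0 = 0, v m = L, h 0 = 0, h n = L.\<close>

definition in_col :: "(nat \<Rightarrow> nat) \<Rightarrow> nat \<Rightarrow> nat \<Rightarrow> bool" where
  "in_col v i x \<longleftrightarrow> v (i - 1) \<le> x \<and> x < v i"

definition in_row :: "nat list \<Rightarrow> (nat \<Rightarrow> nat) \<Rightarrow> nat \<Rightarrow> nat \<Rightarrow> bool" where
  "in_row p h j x \<longleftrightarrow> h (j - 1) \<le> p!x \<and> p!x < h j"

definition in_cell :: "nat list \<Rightarrow> (nat \<Rightarrow> nat) \<Rightarrow> (nat \<Rightarrow> nat) \<Rightarrow> nat \<times> nat \<Rightarrow> nat \<Rightarrow> bool" where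
  "in_cell p v h ij x \<longleftrightarrow> x < length p \<and> in_col v (fst ij) x \<and> in_row p h (snd ij) x"

definition is_gridding ::
  "(nat \<Rightarrow> nat \<Rightarrow> int) \<Rightarrow> nat \<Rightarrow> nat \<Rightarrow> nat list \<Rightarrow> (nat \<Rightarrow> nat) \<Rightarrow> (nat \<Rightarrow> nat) \<Rightarrow> bool" where
  "is_gridding M m n p v h \<longleftrightarrow>
     is_perm p \<and>
     v 0 = 0 \<and> v m = length p \<and> (\<forall>i<m. v i \<le> v (Suc i)) \<and>
     h 0 = 0 \<and> h n = length p \<and> (\<forall>j<n. h j \<le> h (Suc j)) \<and>
     (\<forall>i\<in>{1..m}. \<forall>j\<in>{1..n}.
        (M i j = 0 \<longrightarrow> (\<forall>x. \<not> in_cell p v h (i, j) x)) \<and>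
        (M i j = 1 \<longrightarrow> (\<forall>x y. in_cell p v h (i, j) x \<and> in_cell p v h (i, j) y \<and> x < y
                            \<longrightarrow> p!x < p!y)) \<and>
        (M i j = -1 \<longrightarrow> (\<forall>x y. in_cell p v h (i, j) x \<and> in_cell p v h (i, j) y \<and> x < y
                            \<longrightarrow> p!y < p!x)))"

definition Grid :: "(nat \<Rightarrow> nat \<Rightarrow> int) \<Rightarrow> nat \<Rightarrow> nat \<Rightarrow> nat list set" where
  "Grid M m n = {p. \<exists>v h. is_gridding M m n p v h}"

section \<open>Partial multiplication matrices and the row-column graph\<close>

definition partial_mult_matrix_wrt ::
  "(nat \<Rightarrow> nat \<Rightarrow> int) \<Rightarrow> nat \<Rightarrow> nat \<Rightarrow> (nat \<Rightarrow> int) \<Rightarrow> (nat \<Rightarrow> int) \<Rightarrow> bool" where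
  "partial_mult_matrix_wrt M m n c r \<longleftrightarrow>
     (\<forall>i\<in>{1..m}. c i \<in> {-1, 1}) \<and> (\<forall>j\<in>{1..n}. r j \<in> {-1, 1}) \<and>
     (\<forall>i\<in>{1..m}. \<forall>j\<in>{1..n}. M i j \<noteq> 0 \<longrightarrow> M i j = c i * r j)"

definition nonzero_cells :: "(nat \<Rightarrow> nat \<Rightarrow> int) \<Rightarrow> nat \<Rightarrow> nat \<Rightarrow> (nat \<times> nat) set" where
  "nonzero_cells M m n = {(i, j). i \<in> {1..m} \<and> j \<in> {1..n} \<and> M i j \<noteq> 0}"

text \<open>Row-column graph: vertices Inl i (columns 1..m) and Inr j (rows 1..n).\<close>
definition rc_vertices :: "nat \<Rightarrow> nat \<Rightarrow> (nat + nat) set" where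
  "rc_vertices m n = Inl ` {1..m} \<union> Inr ` {1..n}"

fun rc_adj :: "(nat \<Rightarrow> nat \<Rightarrow> int) \<Rightarrow> nat \<Rightarrow> nat \<Rightarrow> nat + nat \<Rightarrow> nat + nat \<Rightarrow> bool" where
  "rc_adj M m n (Inl i) (Inr j) = (i \<in> {1..m} \<and> j \<in> {1..n} \<and> M i j \<noteq> 0)"
| "rc_adj M m n (Inr j) (Inl i) = (i \<in> {1..m} \<and> j \<in> {1..n} \<and> M i j \<noteq> 0)"
| "rc_adj M m n _ _ = False"

text \<open>A finite simple graph is a cycle iff it is connected and every vertex has degree 2.\<close>
definition rc_graph_is_cycle :: "(nat \<Rightarrow> nat \<Rightarrow> int) \<Rightarrow> nat \<Rightarrow> nat \<Rightarrow> bool" where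
  "rc_graph_is_cycle M m n \<longleftrightarrow>
     (\<forall>u\<in>rc_vertices m n. card {w\<in>rc_vertices m n. rc_adj M m n u w} = 2) \<and>
     (\<forall>u\<in>rc_vertices m n. \<forall>w\<in>rc_vertices m n. (u, w) \<in> {(a, b). rc_adj M m n a b}\<^sup>*)"

section \<open>Orientation digraph and coils\<close>

text \<open>x \<rightarrow> y in the orientation digraph of the gridded permutation (p, v, h),
  points being identified with their (0-based) positions.\<close>
definition orient_arrow ::
  "nat \<Rightarrow> nat \<Rightarrow> (nat \<Rightarrow> int) \<Rightarrow> (nat \<Rightarrow> int) \<Rightarrow> nat list \<Rightarrow> (nat \<Rightarrow> nat) \<Rightarrow> (nat \<Rightarrow> nat)
     \<Rightarrow> nat \<Rightarrow> nat \<Rightarrow> bool" where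
  "orient_arrow m n c r p v h x y \<longleftrightarrow> x < length p \<and> y < length p \<and>
     ((\<exists>i\<in>{1..m}. in_col v i x \<and> in_col v i y \<and> (if c i = 1 then x < y else y < x)) \<or>
      (\<exists>j\<in>{1..n}. in_row p h j x \<and> in_row p h j y \<and> (if r j = 1 then p!x < p!y else p!y < p!x)))"

text \<open>Gridded M-coil: gridded permutation (p, v, h) with ordering w 1, ..., w N of its
  points and labelling lab of the nonzero cells by 1..l, where l is the cycle length.\<close>
definition gridded_coil ::
  "(nat \<Rightarrow> nat \<Rightarrow> int) \<Rightarrow> nat \<Rightarrow> nat \<Rightarrow> (nat \<Rightarrow> int) \<Rightarrow> (nat \<Rightarrow> int) \<Rightarrow>
     nat list \<Rightarrow> (nat \<Rightarrow> nat) \<Rightarrow> (nat \<Rightarrow> nat) \<Rightarrow> (nat \<Rightarrow> nat) \<Rightarrow> (nat \<Rightarrow> nat \<times> nat) \<Rightarrow> bool" where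
  "gridded_coil M m n c r p v h w lab \<longleftrightarrow>
     (let l = card (nonzero_cells M m n); N = length p;
          arr = orient_arrow m n c r p v h in
      is_gridding M m n p v h \<and> N > l \<and>
      bij_betw w {1..N} {0..<N} \<and>
      bij_betw lab {1..l} (nonzero_cells M m n) \<and>
      (\<forall>i\<in>{1..N}. in_cell p v h (lab ((i - 1) mod l + 1)) (w i)) \<and>
      (\<forall>i. 1 < i \<and> i \<le> N \<longrightarrow> arr (w (i - 1)) (w i)) \<and>
      (\<forall>i. l + 1 < i \<and> i \<le> N \<longrightarrow> arr (w i) (w (i - l - 1))) \<and>
      arr (w (l + 1)) (w 1))"

text \<open>Replace the point at position x by two points adjacent in position and value,
  forming an increasing pair if inc, a decreasing pair otherwise.\<close>
definition inflate :: "nat list \<Rightarrow> nat \<Rightarrow> bool \<Rightarrow> nat list" where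
  "inflate p x inc =
     (let a = p!x; sh = (\<lambda>y. if a < y then y + 1 else y) in
      map sh (take x p) @ (if inc then [a, a + 1] else [a + 1, a]) @ map sh (drop (Suc x) p))"

text \<open>Inflate both end points w 1 and w N (the larger position first, so that the
  smaller position index is unaffected).  The cell of w 1 is lab 1 and that of w N is
  lab ((N-1) mod l + 1), by (C1).\<close>
definition end_inflate ::
  "(nat \<Rightarrow> nat \<Rightarrow> int) \<Rightarrow> nat \<Rightarrow> nat \<Rightarrow> nat list \<Rightarrow> (nat \<Rightarrow> nat) \<Rightarrow> (nat \<Rightarrow> nat \<times> nat) \<Rightarrow> nat list" where
  "end_inflate M m n p w lab =
     (let l = card (nonzero_cells M m n); N = length p;
          x1 = w 1; xN = w N;
          s1 = (M (fst (lab 1)) (snd (lab 1)) = 1);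
          sN = (M (fst (lab ((N - 1) mod l + 1))) (snd (lab ((N - 1) mod l + 1))) = 1) in
      if x1 < xN then inflate (inflate p xN sN) x1 s1
      else inflate (inflate p x1 s1) xN sN)"

definition end_inflated_coils ::
  "(nat \<Rightarrow> nat \<Rightarrow> int) \<Rightarrow> nat \<Rightarrow> nat \<Rightarrow> (nat \<Rightarrow> int) \<Rightarrow> (nat \<Rightarrow> int) \<Rightarrow> nat list set" where
  "end_inflated_coils M m n c r =
     {end_inflate M m n p w lab | p v h w lab. gridded_coil M m n c r p v h w lab}"

end

(* If the orientation digraph of a gridded permutation is not strongly connected, its points split into two
   parts with all arrows between them going from the first to the second, so by the minimal bad sequence
   argument of Nash-Williams it suffices to treat strongly connected gridded permutations. In these, the
   last points of the cells form a directed cycle. Fix a last point q whose largest distance to another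
   point is maximal. The distances from q cut the digraph into classes of which only consecutive ones
   interleave, and a shortest path from q to a most distant point is a coil. Each point outside this coil
   gives rise to a twin of a coil point near it, both to a twin at which a subcoil can start and to one at
   which it can end. If there are no long end-inflated coils, all points outside the coil therefore lie in a
   bounded window of classes, and the gridded permutation is determined by the two lengths of the coil
   outside the window and a finite word describing the window.

   Conversely, a long coil has only one gridding: the cells of w i, w (i + l), ... under any gridding move
   monotonically, hence some long block is gridded periodically, and neighbouring cells on a cycle determine
   each other. So an embedding between long end-inflated coils shifts the indices of the coils rigidly and
   maps the twins at the ends to twins at the ends, and the two coils have equal length. *)

theory Submission
  imports Defs "HOL-Library.Ramsey"
begin

section \<open>Well-quasi-orders\<close>

text \<open>Only points in a common row or column are compared, so the orientation digraph is in
  general neither transitive nor acyclic, and a gridded permutation is not a word over its cells to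
  which Higman's lemma would apply. Distances from \<open>q\<close> repair this: no arc raises the
  distance by more than one, so boundedly many classes do form a word from which a first point can
  be peeled off. That direction works with labelled digraphs, because an embedding that keeps cells
  and arcs determines the order of positions and values; one arbitrary gridding per permutation is
  enough. The converse starts from bare containment, which ignores griddings, and therefore needs
  uniqueness of the gridding of a long coil. The choice of \<open>q\<close> is maximal over all last
  points: this bounds the distance of every point to the far end of the coil, and so forces twins
  near its start. The twins are what makes embeddings rigid: a bare coil could be shifted into a
  longer one, but two copies of one point must go to two copies of one point.\<close>

definition wqo_on :: "('a \<Rightarrow> 'a \<Rightarrow> bool) \<Rightarrow> 'a set \<Rightarrow> bool" where
  "wqo_on P A \<longleftrightarrow> (\<forall>x :: nat \<Rightarrow> 'a. (\<forall>k. x k \<in> A) \<longrightarrow> (\<exists>i j. i < j \<and> P (x i) (x j)))"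

lemma wqo_onD:
  fixes x :: "nat \<Rightarrow> 'a"
  assumes "wqo_on P A" "\<And>k. x k \<in> A"
  obtains i j where "i < j" "P (x i) (x j)"
proof -
  have "\<exists>i j. i < j \<and> P (x i) (x j)"
    using assms(1)[unfolded wqo_on_def, rule_format, of x] assms(2) by simp
  then show thesis using that by blast
qed

lemma wqo_on_subset: "wqo_on P B \<Longrightarrow> A \<subseteq> B \<Longrightarrow> wqo_on P A"
  unfolding wqo_on_def by blast

lemma wqo_on_infinite:
  fixes I :: "nat set"
  assumes "wqo_on P A" "infinite I" "\<And>k. k \<in> I \<Longrightarrow> x k \<in> A"
  obtains i j where "i \<in> I" "j \<in> I" "i < j" "P (x i) (x j)"
proof -
  have "x (enumerate I k) \<in> A" for k by (simp add: assms(3) enumerate_in_set[OF assms(2)])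
  then obtain i j where ij: "i < j" "P (x (enumerate I i)) (x (enumerate I j))"
    by (rule wqo_onD[OF assms(1), of "\<lambda>k. x (enumerate I k)"])
  show thesis
  proof (rule that)
    show "enumerate I i \<in> I" "enumerate I j \<in> I" using enumerate_in_set[OF assms(2)] by blast+
    show "enumerate I i < enumerate I j" using enumerate_mono[OF ij(1) assms(2)] .
    show "P (x (enumerate I i)) (x (enumerate I j))" using ij(2) .
  qed
qed

text \<open>Ramsey's theorem for pairs of indices, coloured by whether they are good. An infinite
  homogeneous set without good pairs would be a bad sequence.\<close>

lemma wqo_on_mono_subseq:
  assumes "wqo_on P A" "infinite I" "\<And>k. k \<in> I \<Longrightarrow> x k \<in> A"
  obtains J :: "nat set" where "J \<subseteq> I" "infinite J" "\<And>i j. i \<in> J \<Longrightarrow> j \<in> J \<Longrightarrow> i < j \<Longrightarrow> P (x i) (x j)"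
proof -
  define f where "f S = (if P (x (Min S)) (x (Max S)) then 0 else 1::nat)" for S :: "nat set"
  have f2: "\<forall>a\<in>I. \<forall>b\<in>I. a \<noteq> b \<longrightarrow> f {a, b} < 2" unfolding f_def by simp
  obtain Y t where Y: "Y \<subseteq> I" "infinite Y" "t < 2" "\<forall>a\<in>Y. \<forall>b\<in>Y. a \<noteq> b \<longrightarrow> f {a, b} = t"
    using Ramsey2[OF assms(2) f2] by blast
  obtain i j where ij: "i \<in> Y" "j \<in> Y" "i < j" "P (x i) (x j)"
    using wqo_on_infinite[OF assms(1) Y(2), of x] assms(3) Y(1) by blast
  then have "t = 0" using Y(4)[rule_format, of i j] unfolding f_def by (auto simp: max_def min_def)
  then have "P (x i) (x j)" if "i \<in> Y" "j \<in> Y" "i < j" for i j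
    using Y(4)[rule_format, of i j] that unfolding f_def by (auto simp: max_def min_def split: if_splits)
  then show thesis using that Y by blast
qed

lemma wqo_on_pairs:
  fixes I :: "nat set"
  assumes "wqo_on P A" "wqo_on Q B" "infinite I"
    and "\<And>k. k \<in> I \<Longrightarrow> x k \<in> A" "\<And>k. k \<in> I \<Longrightarrow> y k \<in> B"
  obtains i j where "i \<in> I" "j \<in> I" "i < j" "P (x i) (x j)" "Q (y i) (y j)"
proof -
  obtain J where J: "J \<subseteq> I" "infinite J" "\<And>i j. i \<in> J \<Longrightarrow> j \<in> J \<Longrightarrow> i < j \<Longrightarrow> P (x i) (x j)"
    using wqo_on_mono_subseq[of P A I x] assms by blast
  obtain i j where "i \<in> J" "j \<in> J" "i < j" "Q (y i) (y j)"
    using wqo_on_infinite[OF assms(2) J(2), of y] assms(5) J(1) by blast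
  then show thesis using that J by blast
qed

lemma wqo_on_prod:
  assumes "wqo_on P A" "wqo_on Q B"
  shows "wqo_on (\<lambda>p q. P (fst p) (fst q) \<and> Q (snd p) (snd q)) (A \<times> B)"
proof -
  have "\<exists>i j. i < j \<and> P (fst (x i)) (fst (x j)) \<and> Q (snd (x i)) (snd (x j))"
    if x: "\<And>k. x k \<in> A \<times> B" for x :: "nat \<Rightarrow> _"
  proof -
    have "fst (x k) \<in> A" "snd (x k) \<in> B" for k using x[of k] by auto
    then show ?thesis
      using wqo_on_pairs[OF assms infinite_UNIV_nat, of "\<lambda>k. fst (x k)" "\<lambda>k. snd (x k)"] by metis
  qed
  then show ?thesis unfolding wqo_on_def by simp
qed

lemma wqo_on_finite_eq: "finite A \<Longrightarrow> wqo_on (=) A"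
proof -
  assume "finite A"
  have "\<exists>i j. i < j \<and> x i = x j" if "\<forall>k. x k \<in> A" for x :: "nat \<Rightarrow> 'a"
  proof -
    have "finite (range x)" using that \<open>finite A\<close> by (meson finite_subset image_subsetI)
    then have "\<not> inj x" using finite_imageD[of x UNIV] infinite_UNIV_nat by blast
    then show ?thesis unfolding inj_def by (metis nat_neq_iff)
  qed
  then show ?thesis unfolding wqo_on_def by blast
qed

lemma wqo_on_nat_le: "wqo_on (\<le>) (UNIV :: nat set)"
proof -
  have "\<exists>i j. i < j \<and> x i \<le> x j" for x :: "nat \<Rightarrow> nat"
  proof (rule ccontr)
    assume "\<nexists>i j. i < j \<and> x i \<le> x j"
    then have "x (Suc i) < x i" for i by (meson lessI not_le)
    then show False using wf_less wf_iff_no_infinite_down_chain[of "{(a, b). a < (b::nat)}"] by blast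
  qed
  then show ?thesis unfolding wqo_on_def by blast
qed

lemma wqo_on_Un:
  assumes "wqo_on P A" "wqo_on P B"
  shows "wqo_on P (A \<union> B)"
proof -
  have "\<exists>i j. i < j \<and> P (x i) (x j)" if x: "\<forall>k. x k \<in> A \<union> B" for x :: "nat \<Rightarrow> 'a"
  proof (cases "infinite {k. x k \<in> A}")
    case True
    then show ?thesis using wqo_on_infinite[OF assms(1) True, of x] by blast
  next
    case False
    have "UNIV = {k. x k \<in> A} \<union> {k. x k \<in> B}" using x by blast
    then have "infinite {k. x k \<in> B}" using False by (metis finite_Un infinite_UNIV_nat)
    then show ?thesis using wqo_on_infinite[OF assms(2), of "{k. x k \<in> B}" x] by blast
  qed
  then show ?thesis unfolding wqo_on_def by blast
qed

lemma wqo_on_map: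
  fixes f :: "'a \<Rightarrow> 'b"
  assumes "wqo_on Q B" "\<And>a. a \<in> A \<Longrightarrow> f a \<in> B"
    and "\<And>a b. a \<in> A \<Longrightarrow> b \<in> A \<Longrightarrow> Q (f a) (f b) \<Longrightarrow> P a b"
  shows "wqo_on P A"
proof -
  have "\<exists>i j. i < j \<and> P (x i) (x j)" if x: "\<forall>k. x k \<in> A" for x :: "nat \<Rightarrow> 'a"
  proof -
    obtain i j where "i < j" "Q (f (x i)) (f (x j))"
      using wqo_onD[OF assms(1), of "\<lambda>k. f (x k)"] assms(2) x by blast
    then show ?thesis using assms(3) x by blast
  qed
  then show ?thesis unfolding wqo_on_def by blast
qed

definition bad_seq :: "('a \<Rightarrow> 'a \<Rightarrow> bool) \<Rightarrow> 'a set \<Rightarrow> (nat \<Rightarrow> 'a) \<Rightarrow> bool" where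
  "bad_seq P A x \<longleftrightarrow> (\<forall>k. x k \<in> A) \<and> (\<forall>i j. i < j \<longrightarrow> \<not> P (x i) (x j))"

text \<open>Bad sequences are chosen one after another, each agreeing with the previous one on a
  longer initial segment and having a next term of least size. Their diagonal is the sequence
  sought.\<close>

lemma minimal_bad_seq:
  fixes sz :: "'a \<Rightarrow> nat"
  assumes "bad_seq P A x"
  obtains f where "bad_seq P A f"
    and "\<And>n y. bad_seq P A y \<Longrightarrow> (\<And>i. i < n \<Longrightarrow> y i = f i) \<Longrightarrow> sz (f n) \<le> sz (y n)"
proof -
  define G where "G n z \<longleftrightarrow> bad_seq P A z \<and>
    (\<forall>y. bad_seq P A y \<and> (\<forall>i<n. y i = z i) \<longrightarrow> sz (z n) \<le> sz (y n))" for n z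
  have ext: "\<exists>y. G k y \<and> (\<forall>i<k. y i = z i)" if "bad_seq P A z" for z k
  proof -
    define S where "S = {y. bad_seq P A y \<and> (\<forall>i<k. y i = z i)}"
    have "z \<in> S" using that unfolding S_def by blast
    then obtain y where y: "y \<in> S" "\<And>y'. y' \<in> S \<Longrightarrow> sz (y k) \<le> sz (y' k)"
      using ex_has_least_nat[of "\<lambda>y. y \<in> S" z "\<lambda>y. sz (y k)"] by blast
    then have "G k y" unfolding G_def S_def by auto
    then show ?thesis using y(1) unfolding S_def by blast
  qed
  have "\<exists>f. \<forall>n. G n (f n) \<and> (\<forall>i<Suc n. f (Suc n) i = f n i)"
  proof (rule dependent_nat_choice)
    show "\<exists>z. G 0 z" using ext[OF assms, of 0] by blast
  next
    fix z n assume "G n z"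
    then show "\<exists>y. G (Suc n) y \<and> (\<forall>i<Suc n. y i = z i)"
      using ext[of z "Suc n"] unfolding G_def by blast
  qed
  then obtain f where f: "\<And>n. G n (f n)" "\<And>n i. i < Suc n \<Longrightarrow> f (Suc n) i = f n i" by blast
  define h where "h n = f n n" for n
  have agree: "f n i = h i" if "i \<le> n" for n i
    using that
  proof (induction n)
    case (Suc n)
    then show ?case using f(2)[of i n] by (cases "i = Suc n") (auto simp: h_def)
  qed (simp add: h_def)
  have "bad_seq P A h"
  proof -
    have "h k \<in> A" for k using f(1)[of k] unfolding G_def bad_seq_def h_def by blast
    moreover have "\<not> P (h i) (h j)" if "i < j" for i j
      using f(1)[of j] agree[of i j] agree[of j j] that unfolding G_def bad_seq_def by (metis less_imp_le order_refl)
    ultimately show ?thesis unfolding bad_seq_def by blast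
  qed
  moreover have "sz (h n) \<le> sz (y n)" if "bad_seq P A y" "\<And>i. i < n \<Longrightarrow> y i = h i" for n y
    using f(1)[of n] that agree[of _ n] unfolding G_def h_def[of n] by (metis less_imp_le)
  ultimately show thesis using that by blast
qed

text \<open>Nash-Williams' minimal bad sequence argument, for elements that are either atomic or
  composed of two smaller ones; Higman's lemma is the case of words.\<close>

lemma wqo_on_decompose:
  fixes sz :: "'a \<Rightarrow> nat"
  assumes tr: "\<And>x y z. P x y \<Longrightarrow> P y z \<Longrightarrow> P x z"
    and atoms: "wqo_on P {a \<in> A. atom a}"
    and ex: "\<And>a. a \<in> A \<Longrightarrow> \<not> atom a \<Longrightarrow> \<exists>x y. D x y a"
    and D: "\<And>x y a. D x y a \<Longrightarrow> a \<in> A \<Longrightarrow> x \<in> A \<and> y \<in> A \<and> sz x < sz a \<and> sz y < sz a \<and> P x a \<and> P y a"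
    and comp: "\<And>x y a x' y' a'. a \<in> A \<Longrightarrow> a' \<in> A \<Longrightarrow> D x y a \<Longrightarrow> D x' y' a' \<Longrightarrow> P x x' \<Longrightarrow> P y y' \<Longrightarrow> P a a'"
  shows "wqo_on P A"
proof (rule ccontr)
  assume "\<not> wqo_on P A"
  then obtain x0 where "bad_seq P A x0" unfolding wqo_on_def bad_seq_def by blast
  then obtain h where h: "bad_seq P A h"
    and hmin: "\<And>n y. bad_seq P A y \<Longrightarrow> (\<And>i. i < n \<Longrightarrow> y i = h i) \<Longrightarrow> sz (h n) \<le> sz (y n)"
    using minimal_bad_seq[of P A x0 sz] by blast
  have hA: "h k \<in> A" and hbad: "i < j \<Longrightarrow> \<not> P (h i) (h j)" for i j k
    using h unfolding bad_seq_def by auto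
  define I where "I = {n. \<not> atom (h n)}"
  have "finite (- I)"
  proof (rule ccontr)
    assume "infinite (- I)"
    then obtain i j where "i < j" "P (h i) (h j)"
      using wqo_on_infinite[OF atoms, of "- I" h thesis] hA unfolding I_def by simp
    then show False using hbad by blast
  qed
  then have inf: "infinite I" using finite_UnI[of "- I" I] infinite_UNIV_nat by auto
  have "\<exists>p. n \<in> I \<longrightarrow> D (fst p) (snd p) (h n)" for n
    using ex[OF hA, of n] unfolding I_def by auto
  then obtain p where p: "\<And>n. n \<in> I \<Longrightarrow> D (fst (p n)) (snd (p n)) (h n)" by metis
  define X where "X = (\<lambda>n. fst (p n)) ` I \<union> (\<lambda>n. snd (p n)) ` I"
  have "wqo_on P X"
  proof (rule ccontr)
    assume "\<not> wqo_on P X"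
    then obtain t :: "nat \<Rightarrow> 'a" where t: "\<And>k. t k \<in> X" and tbad: "\<And>i j. i < j \<Longrightarrow> \<not> P (t i) (t j)"
      unfolding wqo_on_def by blast
    have "\<forall>k. \<exists>n. t k \<in> A \<and> sz (t k) < sz (h n) \<and> P (t k) (h n)"
    proof
      fix k
      obtain n where "n \<in> I" "t k = fst (p n) \<or> t k = snd (p n)" using t[of k] unfolding X_def by blast
      then show "\<exists>n. t k \<in> A \<and> sz (t k) < sz (h n) \<and> P (t k) (h n)" using D[OF p hA] by metis
    qed
    then obtain N where N: "\<And>k. t k \<in> A" "\<And>k. sz (t k) < sz (h (N k))" "\<And>k. P (t k) (h (N k))" by metis
    \<comment> \<open>The tail of \<open>t\<close> starts where \<open>N\<close> is least. Then each
      of its terms lies below some \<open>h (N k)\<close> with \<open>N k0 \<le> N k\<close>, so a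
      good pair between the first \<open>N k0\<close> terms of \<open>h\<close> and this tail would
      be a good pair of \<open>h\<close>.\<close>
    obtain k0 where k0: "\<And>k. N k0 \<le> N k" using ex_has_least_nat[of "\<lambda>_. True" _ N] by blast
    define y where "y i = (if i < N k0 then h i else t (k0 + (i - N k0)))" for i
    have "bad_seq P A y"
    proof -
      have "y k \<in> A" for k unfolding y_def using N(1) hA by auto
      moreover have "\<not> P (y i) (y j)" if ij: "i < j" for i j
      proof
        assume P: "P (y i) (y j)"
        consider "j < N k0" | "i < N k0" "N k0 \<le> j" | "N k0 \<le> i" by linarith
        then show False
        proof cases
          case 1 then show False using P ij hbad unfolding y_def by auto
        next
          case 2
          let ?k = "k0 + (j - N k0)"
          have "P (h i) (h (N ?k))" using P 2 N(3)[of ?k] tr unfolding y_def by auto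
          then show False using hbad 2 k0[of ?k] by (meson less_le_trans)
        next
          case 3
          then have "k0 + (i - N k0) < k0 + (j - N k0)" using ij by linarith
          moreover have "y i = t (k0 + (i - N k0))" "y j = t (k0 + (j - N k0))"
            using 3 ij unfolding y_def by simp_all
          ultimately show False using P tbad by metis
        qed
      qed
      ultimately show ?thesis unfolding bad_seq_def by blast
    qed
    moreover have "y i = h i" if "i < N k0" for i using that unfolding y_def by simp
    ultimately have "sz (h (N k0)) \<le> sz (y (N k0))" using hmin by blast
    then show False using N(2)[of k0] unfolding y_def by auto
  qed
  note X = this
  have fs: "\<And>n. n \<in> I \<Longrightarrow> fst (p n) \<in> X" "\<And>n. n \<in> I \<Longrightarrow> snd (p n) \<in> X" unfolding X_def by auto
  obtain i j where ij: "i \<in> I" "j \<in> I" "i < j" "P (fst (p i)) (fst (p j))" "P (snd (p i)) (snd (p j))"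
    using wqo_on_pairs[OF X X inf fs] .
  then have "P (h i) (h j)" using comp[OF hA hA p p] by blast
  then show False using hbad ij by blast
qed

section \<open>Orientation digraphs of cyclically gridded permutations\<close>

text \<open>Labelled digraphs: the set of points, their labels, and the arcs.\<close>

type_synonym ldg = "nat set \<times> (nat \<Rightarrow> nat) \<times> (nat \<Rightarrow> nat \<Rightarrow> bool)"

definition emb_via :: "(nat \<Rightarrow> nat) \<Rightarrow> ldg \<Rightarrow> ldg \<Rightarrow> bool" where
  "emb_via f S S' \<longleftrightarrow> (\<forall>x\<in>fst S. f x \<in> fst S' \<and> fst (snd S') (f x) = fst (snd S) x) \<and> inj_on f (fst S) \<and>
     (\<forall>x\<in>fst S. \<forall>y\<in>fst S. snd (snd S') (f x) (f y) \<longleftrightarrow> snd (snd S) x y)"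

definition emb :: "ldg \<Rightarrow> ldg \<Rightarrow> bool" where
  "emb S S' \<longleftrightarrow> (\<exists>f. emb_via f S S')"

lemma emb_viaI:
  assumes "\<And>x. x \<in> V \<Longrightarrow> f x \<in> V'" "\<And>x. x \<in> V \<Longrightarrow> g' (f x) = g x" "inj_on f V"
    "\<And>x y. x \<in> V \<Longrightarrow> y \<in> V \<Longrightarrow> R' (f x) (f y) \<longleftrightarrow> R x y"
  shows "emb_via f (V, g, R) (V', g', R')"
  using assms unfolding emb_via_def by simp

lemma emb_viaD:
  assumes "emb_via f (V, g, R) (V', g', R')"
  shows "x \<in> V \<Longrightarrow> f x \<in> V'" "x \<in> V \<Longrightarrow> g' (f x) = g x" "inj_on f V"
    "x \<in> V \<Longrightarrow> y \<in> V \<Longrightarrow> R' (f x) (f y) \<longleftrightarrow> R x y"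
  using assms unfolding emb_via_def by auto

lemma emb_trans:
  assumes "emb S T" "emb T U"
  shows "emb S U"
proof -
  obtain f h where f: "emb_via f S T" and h: "emb_via h T U" using assms unfolding emb_def by auto
  have "inj_on (h \<circ> f) (fst S)"
    using f h unfolding emb_via_def by (auto intro!: comp_inj_on elim: inj_on_subset)
  then have "emb_via (h \<circ> f) S U" using f h unfolding emb_via_def by simp
  then show ?thesis unfolding emb_def by blast
qed

lemma emb_subset: "A \<subseteq> V \<Longrightarrow> emb (A, g, R) (V, g, R)"
  unfolding emb_def by (intro exI[of _ "\<lambda>x. x"] emb_viaI) auto

lemma emb_glue:
  assumes f: "emb_via f (A, g, R) (A', g', R')" and h: "emb_via h (B, g, R) (B', g', R')"
    and dis: "A' \<inter> B' = {}" "A \<inter> B = {}"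
    and AB: "\<And>x y. x \<in> A \<Longrightarrow> y \<in> B \<Longrightarrow> (R' (f x) (h y) \<longleftrightarrow> R x y) \<and> (R' (h y) (f x) \<longleftrightarrow> R y x)"
  shows "emb (A \<union> B, g, R) (A' \<union> B', g', R')"
proof -
  note fD = emb_viaD[OF f] and hD = emb_viaD[OF h]
  have "inj_on (\<lambda>x. if x \<in> A then f x else h x) (A \<union> B)"
  proof (rule inj_onI)
    fix x y assume "x \<in> A \<union> B" "y \<in> A \<union> B" "(if x \<in> A then f x else h x) = (if y \<in> A then f y else h y)"
    then show "x = y" using fD(1)[of x] fD(1)[of y] hD(1)[of x] hD(1)[of y] dis inj_onD[OF fD(3), of x y] inj_onD[OF hD(3), of x y]
      by (auto split: if_splits)
  qed
  then have "emb_via (\<lambda>x. if x \<in> A then f x else h x) (A \<union> B, g, R) (A' \<union> B', g', R')"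
    by (intro emb_viaI) (use fD(1,2,4) hD(1,2,4) dis AB in auto)
  then show ?thesis unfolding emb_def by blast
qed

text \<open>For cells numbered along a cycle of length l, this says that a and b share a row or a column.\<close>

definition near :: "nat \<Rightarrow> nat \<Rightarrow> nat \<Rightarrow> bool" where
  "near l a b \<longleftrightarrow> a mod l = b mod l \<or> Suc a mod l = b mod l \<or> Suc b mod l = a mod l"

lemma near_sym: "near l a b \<longleftrightarrow> near l b a"
  unfolding near_def by auto

lemma near_mod: "near l (a mod l) (b mod l) \<longleftrightarrow> near l a b"
  unfolding near_def by (simp add: mod_Suc_eq)

lemma mod_add_left_eq_iff: "(k + a) mod l = (k + b) mod l \<longleftrightarrow> a mod l = (b::nat) mod l"
proof -
  have "(k + a) mod l = (k + b) mod l \<longleftrightarrow> int l dvd int (k + a) - int (k + b)"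
    by (metis (no_types) of_nat_eq_iff zmod_int mod_eq_dvd_iff)
  also have "\<dots> \<longleftrightarrow> int l dvd int a - int b" by simp
  also have "\<dots> \<longleftrightarrow> a mod l = b mod l" by (metis (no_types) of_nat_eq_iff zmod_int mod_eq_dvd_iff)
  finally show ?thesis .
qed

lemma near_add: "near l (k + a) (k + b) \<longleftrightarrow> near l a b"
  unfolding near_def by (metis mod_add_left_eq_iff add_Suc_right)

text \<open>The points of a gridded permutation, with the cells numbered cyclically by g and the orientation
  digraph R. Two consecutive cells make up a row or a column, on which R is a linear order.\<close>

locale cyc =
  fixes l :: nat and V :: "nat set" and g :: "nat \<Rightarrow> nat" and R :: "nat \<Rightarrow> nat \<Rightarrow> bool"
  assumes l3: "3 \<le> l" and fin: "finite V"
    and g_less: "x \<in> V \<Longrightarrow> g x < l"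
    and R_near: "x \<in> V \<Longrightarrow> y \<in> V \<Longrightarrow> R x y \<Longrightarrow> near l (g x) (g y)"
    and irr: "x \<in> V \<Longrightarrow> \<not> R x x"
    and tot: "x \<in> V \<Longrightarrow> y \<in> V \<Longrightarrow> x \<noteq> y \<Longrightarrow> near l (g x) (g y) \<Longrightarrow> R x y \<or> R y x"
    and tr: "x \<in> V \<Longrightarrow> y \<in> V \<Longrightarrow> z \<in> V \<Longrightarrow> g x \<in> {a, Suc a mod l} \<Longrightarrow> g y \<in> {a, Suc a mod l} \<Longrightarrow>
      g z \<in> {a, Suc a mod l} \<Longrightarrow> R x y \<Longrightarrow> R y z \<Longrightarrow> R x z"
begin

lemma near_cases:
  assumes "x \<in> V" "y \<in> V" "near l (g x) (g y)"
  obtains "g x = g y" | "g y = Suc (g x) mod l" | "g x = Suc (g y) mod l"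
  using assms g_less[of x] g_less[of y] unfolding near_def by auto

lemma asym: "x \<in> V \<Longrightarrow> y \<in> V \<Longrightarrow> R x y \<Longrightarrow> \<not> R y x"
proof
  assume *: "x \<in> V" "y \<in> V" "R x y" "R y x"
  from R_near[OF *(1-3)] show False
  proof (rule near_cases[OF *(1,2)])
    show "g x = g y \<Longrightarrow> False" using tr[of x y x "g x"] * irr by auto
    show "g y = Suc (g x) mod l \<Longrightarrow> False" using tr[of x y x "g x"] * irr by auto
    show "g x = Suc (g y) mod l \<Longrightarrow> False" using tr[of x y x "g y"] * irr by auto
  qed
qed

lemma not_R: "x \<in> V \<Longrightarrow> y \<in> V \<Longrightarrow> near l (g x) (g y) \<Longrightarrow> x \<noteq> y \<Longrightarrow> \<not> R x y \<longleftrightarrow> R y x"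
  using asym tot by blast

lemma cyc_subset: "A \<subseteq> V \<Longrightarrow> cyc l A g R"
proof -
  assume A: "A \<subseteq> V"
  have V: "x \<in> V" if "x \<in> A" for x using that A by blast
  show ?thesis
  proof
    show "finite A" using A fin finite_subset by blast
  qed (fact l3 g_less[OF V] R_near[OF V V] irr[OF V] tot[OF V V] tr[OF V V V])+
qed

end

section \<open>Reduction to strongly connected digraphs\<close>

definition strong :: "ldg \<Rightarrow> bool" where
  "strong S \<longleftrightarrow> (\<forall>x\<in>fst S. \<forall>y\<in>fst S. (x, y) \<in> {(a, b). a \<in> fst S \<and> b \<in> fst S \<and> snd (snd S) a b}\<^sup>*)"

definition cyc_ldg :: "nat \<Rightarrow> ldg \<Rightarrow> bool" where
  "cyc_ldg l S \<longleftrightarrow> cyc l (fst S) (fst (snd S)) (snd (snd S))"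

text \<open>The second part consists of all points reachable from a point that does not reach
  everything.\<close>

lemma not_strong_split:
  assumes "\<not> strong (V, g, R)"
  shows "\<exists>A B. A \<union> B = V \<and> A \<inter> B = {} \<and> A \<noteq> {} \<and> B \<noteq> {} \<and> (\<forall>a\<in>A. \<forall>b\<in>B. \<not> R b a)"
proof -
  let ?E = "{(a, b). a \<in> V \<and> b \<in> V \<and> R a b}"
  obtain x y where xy: "x \<in> V" "y \<in> V" "(x, y) \<notin> ?E\<^sup>*" using assms unfolding strong_def by auto
  define B where "B = {z \<in> V. (x, z) \<in> ?E\<^sup>*}"
  have "\<not> R b a" if "a \<in> V - B" "b \<in> B" for a b
  proof
    assume "R b a"
    then have "(b, a) \<in> ?E" using that unfolding B_def by auto
    then have "a \<in> B" using that unfolding B_def by (auto intro: rtrancl_into_rtrancl)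
    then show False using that by blast
  qed
  note nR = this
  have "x \<in> B" "y \<in> V - B" using xy unfolding B_def by auto
  then show ?thesis
    by (intro exI[of _ "V - B"] exI[of _ B] conjI ballI nR) (auto simp: B_def)
qed

text \<open>When all arcs between two parts go from the first to the second, totality on near cells
  lets the labels alone decide which of these arcs exist. So embeddings of the parts can be glued,
  as the decomposition argument requires.\<close>

lemma wqo_cyc_from_strong:
  assumes cy: "\<And>S. S \<in> \<S> \<Longrightarrow> cyc_ldg l S"
    and sub: "\<And>V g R A. (V, g, R) \<in> \<S> \<Longrightarrow> A \<subseteq> V \<Longrightarrow> (A, g, R) \<in> \<S>"
    and str: "wqo_on emb {S \<in> \<S>. strong S}"
  shows "wqo_on emb \<S>"
proof -
  define D :: "ldg \<Rightarrow> ldg \<Rightarrow> ldg \<Rightarrow> bool" where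
    "D X Y P \<longleftrightarrow> snd X = snd P \<and> snd Y = snd P \<and> fst X \<union> fst Y = fst P \<and> fst X \<inter> fst Y = {} \<and>
       fst X \<noteq> {} \<and> fst Y \<noteq> {} \<and> (\<forall>a\<in>fst X. \<forall>b\<in>fst Y. \<not> snd (snd P) b a)" for X Y P
  have DE: "\<exists>V g R A B. P = (V, g, R) \<and> X = (A, g, R) \<and> Y = (B, g, R) \<and> A \<union> B = V \<and> A \<inter> B = {} \<and>
    A \<noteq> {} \<and> B \<noteq> {} \<and> (\<forall>a\<in>A. \<forall>b\<in>B. \<not> R b a)" if "D X Y P" for X Y P
    using that unfolding D_def by (cases X; cases Y; cases P) simp
  show ?thesis
  proof (rule wqo_on_decompose[where atom = strong and D = D and sz = "\<lambda>S. card (fst S)"])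
    show "emb x y \<Longrightarrow> emb y z \<Longrightarrow> emb x z" for x y z by (rule emb_trans)
    show "wqo_on emb {a \<in> \<S>. strong a}" by (rule str)
    show "\<exists>x y. D x y a" if a: "a \<in> \<S>" "\<not> strong a" for a
    proof -
      obtain V g R where V: "a = (V, g, R)" by (cases a)
      obtain A B where "A \<union> B = V" "A \<inter> B = {}" "A \<noteq> {}" "B \<noteq> {}" "\<forall>a\<in>A. \<forall>b\<in>B. \<not> R b a"
        using not_strong_split[of V g R] a(2) unfolding V by metis
      then have "D (A, g, R) (B, g, R) a" unfolding D_def V by auto
      then show ?thesis by blast
    qed
    show "x \<in> \<S> \<and> y \<in> \<S> \<and> card (fst x) < card (fst a) \<and> card (fst y) < card (fst a) \<and> emb x a \<and> emb y a"
      if D: "D x y a" and a: "a \<in> \<S>" for x y a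
    proof -
      obtain V g R A B where V: "a = (V, g, R)" "x = (A, g, R)" "y = (B, g, R)" "A \<union> B = V" "A \<inter> B = {}" "A \<noteq> {}" "B \<noteq> {}"
        using DE[OF D] by (elim exE conjE) (rule that)
      have "finite V" using cyc.fin[of l V g R] cy[OF a] unfolding cyc_ldg_def V by simp
      moreover have "A \<subset> V" "B \<subset> V" using V by auto
      ultimately have "card A < card V" "card B < card V" by (auto intro: psubset_card_mono)
      moreover have "emb x a" "emb y a" using V emb_subset by auto
      moreover have "x \<in> \<S>" "y \<in> \<S>" using sub a V by blast+
      ultimately show ?thesis using V by simp
    qed
    show "emb a a'" if a: "a \<in> \<S>" "a' \<in> \<S>" and D: "D x y a" "D x' y' a'" and e: "emb x x'" "emb y y'"
      for x y a x' y' a'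
    proof -
      obtain V g R A B where V: "a = (V, g, R)" "x = (A, g, R)" "y = (B, g, R)" "A \<union> B = V" "A \<inter> B = {}"
        "A \<noteq> {}" "B \<noteq> {}" "\<forall>a\<in>A. \<forall>b\<in>B. \<not> R b a"
        using DE[OF D(1)] by (elim exE conjE) (rule that)
      obtain V' g' R' A' B' where V': "a' = (V', g', R')" "x' = (A', g', R')" "y' = (B', g', R')" "A' \<union> B' = V'" "A' \<inter> B' = {}"
        "A' \<noteq> {}" "B' \<noteq> {}" "\<forall>a\<in>A'. \<forall>b\<in>B'. \<not> R' b a"
        using DE[OF D(2)] by (elim exE conjE) (rule that)
      interpret c: cyc l V g R using cy[OF a(1)] unfolding V cyc_ldg_def by simp
      interpret c': cyc l V' g' R' using cy[OF a(2)] unfolding V' cyc_ldg_def by simp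
      obtain f where f: "emb_via f x x'" using e(1) unfolding emb_def by blast
      obtain h where h: "emb_via h y y'" using e(2) unfolding emb_def by blast
      note fD = emb_viaD[OF f[unfolded V V']] and hD = emb_viaD[OF h[unfolded V V']]
      have 1: "R x y \<longleftrightarrow> near l (g x) (g y)" if "x \<in> A" "y \<in> B" for x y
        using c.tot[of x y] c.R_near[of x y] V(4,5,8) that by blast
      have 2: "R' x y \<longleftrightarrow> near l (g' x) (g' y)" if "x \<in> A'" "y \<in> B'" for x y
        using c'.tot[of x y] c'.R_near[of x y] V'(4,5,8) that by blast
      have "emb (A \<union> B, g, R) (A' \<union> B', g', R')"
        by (rule emb_glue[OF f[unfolded V V'] h[unfolded V V'] V'(5) V(5)]) (use 1 2 fD hD V(8) V'(8) in auto)
      then show ?thesis unfolding V V' using V(4) V'(4) by simp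
    qed
  qed
qed

lemma finite_linear_least:
  assumes "finite A" "A \<noteq> {}" "\<And>x y. x \<in> A \<Longrightarrow> y \<in> A \<Longrightarrow> x \<noteq> y \<Longrightarrow> R x y \<or> R y x"
    "\<And>x y z. x \<in> A \<Longrightarrow> y \<in> A \<Longrightarrow> z \<in> A \<Longrightarrow> R x y \<Longrightarrow> R y z \<Longrightarrow> R x z"
  shows "\<exists>x\<in>A. \<forall>y\<in>A. y \<noteq> x \<longrightarrow> R x y"
proof -
  show ?thesis
    using assms
  proof (induction A rule: finite_ne_induct)
    case (singleton x)
    show ?case by blast
  next
    case (insert a A)
    have "\<exists>x\<in>A. \<forall>y\<in>A. y \<noteq> x \<longrightarrow> R x y"
      by (rule insert.IH) (use insert.prems in blast)+
    then obtain x where x: "x \<in> A" "\<forall>y\<in>A. y \<noteq> x \<longrightarrow> R x y" by blast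
    show ?case
    proof (cases "R a x")
      case True
      have "R a y" if "y \<in> A" for y
        using insert.prems(2)[of a x y] x that True by (cases "y = x") auto
      then show ?thesis by auto
    next
      case False
      then have "R x a" using insert.prems(1)[of a x] insert.hyps x by auto
      then show ?thesis using x by blast
    qed
  qed
qed

section \<open>Interleaved words\<close>

text \<open>A finite word over the classes of c, cyclically shifted: classes at distance at most 1 are interleaved
  linearly, and of two points in classes further apart the one with the larger class comes first.\<close>

locale stair =
  fixes l :: nat and V :: "nat set" and c :: "nat \<Rightarrow> nat" and R :: "nat \<Rightarrow> nat \<Rightarrow> bool"
  assumes stair_finite: "finite V"
    and stair_irr: "x \<in> V \<Longrightarrow> \<not> R x x"
    and stair_far: "x \<in> V \<Longrightarrow> y \<in> V \<Longrightarrow> c x + 2 \<le> c y \<Longrightarrow> R y x \<longleftrightarrow> near l (c x) (c y)"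
    and stair_far': "x \<in> V \<Longrightarrow> y \<in> V \<Longrightarrow> c x + 2 \<le> c y \<Longrightarrow> \<not> R x y"
    and stair_tot: "x \<in> V \<Longrightarrow> y \<in> V \<Longrightarrow> c x \<le> Suc (c y) \<Longrightarrow> c y \<le> Suc (c x) \<Longrightarrow> x \<noteq> y \<Longrightarrow> R x y \<longleftrightarrow> \<not> R y x"
    and stair_trans: "x \<in> V \<Longrightarrow> y \<in> V \<Longrightarrow> z \<in> V \<Longrightarrow> {c x, c y, c z} \<subseteq> {k, Suc k} \<Longrightarrow> R x y \<Longrightarrow> R y z \<Longrightarrow> R x z"

lemmas stairD = stair.stair_finite stair.stair_irr stair.stair_far stair.stair_far' stair.stair_tot stair.stair_trans

lemma stair_subset:
  assumes "stair l V c R" "A \<subseteq> V"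
  shows "stair l A c R"
proof -
  interpret stair l V c R by fact
  have V: "x \<in> V" if "x \<in> A" for x using that assms(2) by blast
  show ?thesis
  proof
    show "finite A" using assms(2) stair_finite finite_subset by blast
  qed (fact stair_irr[OF V] stair_far[OF V V] stair_far'[OF V V] stair_tot[OF V V] stair_trans[OF V V V])+
qed

text \<open>The relation is not linear over three classes, so the point is built class by class: the
  point \<open>x\<close> found below class \<open>k\<close> is kept unless points of class
  \<open>k\<close> precede it, in which case the first of these takes over.\<close>

lemma stair_least:
  assumes st: "stair l V c R" and "A \<subseteq> V" "A \<noteq> {}"
  shows "\<exists>x\<in>A. \<forall>y\<in>A. y \<noteq> x \<longrightarrow> c x \<le> Suc (c y) \<longrightarrow> c y \<le> Suc (c x) \<longrightarrow> R x y"
proof -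
  note s = stairD[OF st]
  have "\<exists>x\<in>A. \<forall>y\<in>A. y \<noteq> x \<longrightarrow> c x \<le> Suc (c y) \<longrightarrow> c y \<le> Suc (c x) \<longrightarrow> R x y"
    if "\<forall>x\<in>A. c x < k" "A \<subseteq> V" "A \<noteq> {}" for k A
    using that
  proof (induction k arbitrary: A)
    case 0
    then show ?case by auto
  next
    case (Suc k)
    define A0 where "A0 = {x \<in> A. c x < k}"
    define B where "B = {x \<in> A. c x = k}"
    have A: "A = A0 \<union> B" "A0 \<inter> B = {}" using Suc.prems unfolding A0_def B_def by auto
    have lin: "\<exists>b\<in>B'. \<forall>y\<in>B'. y \<noteq> b \<longrightarrow> R b y" if B': "B' \<subseteq> B" "B' \<noteq> {}" for B'
    proof -
      have B'V: "x \<in> V" "c x = k" if "x \<in> B'" for x using that Suc.prems(2) B'(1) unfolding B_def by auto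
      have f: "finite B'" using B'V(1) s(1) by (meson finite_subset subsetI)
      have t: "R x y \<or> R y x" if "x \<in> B'" "y \<in> B'" "x \<noteq> y" for x y
        using s(5)[of x y] B'V that by simp
      have tr: "R x z" if "x \<in> B'" "y \<in> B'" "z \<in> B'" "R x y" "R y z" for x y z
        using s(6)[of x y z k] B'V that by simp
      show ?thesis by (rule finite_linear_least[of B' R, OF f B'(2) t tr])
    qed
    show ?case
    proof (cases "A0 = {}")
      case True
      then have "B \<noteq> {}" using A Suc.prems by auto
      then show ?thesis using lin[of B] A True by auto
    next
      case False
      then obtain x where x: "x \<in> A0" "\<forall>y\<in>A0. y \<noteq> x \<longrightarrow> c x \<le> Suc (c y) \<longrightarrow> c y \<le> Suc (c x) \<longrightarrow> R x y"
        using Suc.IH[of A0] Suc.prems unfolding A0_def by blast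
      define B' where "B' = {b \<in> B. R b x \<and> k \<le> Suc (c x)}"
      have B'B: "B' \<subseteq> B" unfolding B'_def by blast
      show ?thesis
      proof (cases "B' = {}")
        case True
        have "R x y" if y: "y \<in> A" "y \<noteq> x" "c x \<le> Suc (c y)" "c y \<le> Suc (c x)" for y
        proof (cases "y \<in> A0")
          case False
          then have "y \<in> B" using A y by blast
          then have "\<not> R y x" using True y unfolding B'_def B_def by auto
          then show ?thesis using s(5)[of x y] y x(1) Suc.prems(2) A by blast
        qed (use x y in blast)
        then show ?thesis using x(1) A by blast
      next
        case False
        then obtain b where b: "b \<in> B'" "\<forall>y\<in>B'. y \<noteq> b \<longrightarrow> R b y" using lin[OF B'B] by blast
        have bV: "b \<in> V" "c b = k" "R b x" "k \<le> Suc (c x)" using b(1) Suc.prems(2) unfolding B'_def B_def by auto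
        have xV: "x \<in> V" "c x < k" using x(1) Suc.prems(2) unfolding A0_def by auto
        have "R b y" if y: "y \<in> A" "y \<noteq> b" "c b \<le> Suc (c y)" "c y \<le> Suc (c b)" for y
        proof (rule ccontr)
          assume n: "\<not> R b y"
          have yV: "y \<in> V" using y(1) Suc.prems(2) by blast
          then have yb: "R y b" using s(5)[of b y] bV y n by blast
          \<comment> \<open>A point that precedes \<open>b\<close> also precedes \<open>x\<close>,
            because all three lie in the two classes \<open>c x\<close> and
            \<open>Suc (c x)\<close>, where transitivity holds. This contradicts the choice of
            \<open>x\<close> or of \<open>b\<close>.\<close>
          have "c b = Suc (c x)" "c x \<le> c y" "c y \<le> Suc (c x)"
            using y(3) bV(2,4) xV(2) Suc.prems(1)[rule_format, OF y(1)] by linarith+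
          then have cs: "{c y, c b, c x} \<subseteq> {c x, Suc (c x)}" by (auto simp: le_Suc_eq)
          then have yx: "R y x" using s(6)[OF yV bV(1) xV(1) cs yb bV(3)] by blast
          show False
          proof (cases "y \<in> A0")
            case True
            have "y \<noteq> x" using yx s(2) xV by blast
            moreover have "c x \<le> Suc (c y)" "c y \<le> Suc (c x)" using cs by auto
            ultimately have "R x y" using x(2) True by blast
            then show False using yx s(5)[of x y] xV yV \<open>y \<noteq> x\<close> \<open>c x \<le> Suc (c y)\<close> \<open>c y \<le> Suc (c x)\<close> by blast
          next
            case False
            then have "y \<in> B'" using A y(1) yx bV(4) unfolding B'_def by blast
            then show False using b(2) y(2) n by blast
          qed
        qed
        then show ?thesis using b(1) A B'B by blast
      qed
    qed
  qed
  moreover have "\<exists>k. \<forall>x\<in>A. c x < k"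
  proof -
    have "finite A" using assms(2) s(1) finite_subset by blast
    then show ?thesis by (intro exI[of _ "Suc (Max (c ` A))"]) (auto simp: less_Suc_eq_le)
  qed
  ultimately show ?thesis using assms(2,3) by meson
qed

text \<open>A version of Higman's lemma. Once a least point \<open>z\<close> is peeled off, its arcs
  are determined by the classes: by \<open>near\<close> for distant classes, and for neighbouring
  ones because \<open>z\<close> comes first.\<close>

lemma wqo_stair: "wqo_on emb {(V, c, R). stair l V c R \<and> (\<forall>x\<in>V. c x \<le> W)}" (is "wqo_on emb ?\<S>")
proof -
  define D :: "ldg \<Rightarrow> ldg \<Rightarrow> ldg \<Rightarrow> bool" where
    "D X Y P \<longleftrightarrow> snd X = snd P \<and> snd Y = snd P \<and> (\<exists>x. fst X = {x} \<and> fst Y = fst P - {x} \<and> x \<in> fst P \<and> fst P \<noteq> {x} \<and>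
      (\<forall>y\<in>fst P. y \<noteq> x \<longrightarrow> fst (snd P) x \<le> Suc (fst (snd P) y) \<longrightarrow> fst (snd P) y \<le> Suc (fst (snd P) x) \<longrightarrow>
        snd (snd P) x y))" for X Y P
  have DE: "\<exists>V c R z. P = (V, c, R) \<and> X = ({z}, c, R) \<and> Y = (V - {z}, c, R) \<and> z \<in> V \<and> V \<noteq> {z} \<and>
    (\<forall>y\<in>V. y \<noteq> z \<longrightarrow> c z \<le> Suc (c y) \<longrightarrow> c y \<le> Suc (c z) \<longrightarrow> R z y)" if D: "D X Y P" for X Y P
  proof -
    obtain z where z: "fst X = {z}" "fst Y = fst P - {z}" "z \<in> fst P" "fst P \<noteq> {z}"
      "\<forall>y\<in>fst P. y \<noteq> z \<longrightarrow> fst (snd P) z \<le> Suc (fst (snd P) y) \<longrightarrow> fst (snd P) y \<le> Suc (fst (snd P) z) \<longrightarrow>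
        snd (snd P) z y" using D unfolding D_def by (elim exE conjE) (rule that)
    have "P = (fst P, fst (snd P), snd (snd P))" by simp
    moreover have "X = ({z}, fst (snd P), snd (snd P))" "Y = (fst P - {z}, fst (snd P), snd (snd P))"
      using D z(1,2) unfolding D_def by (simp_all add: prod_eq_iff)
    ultimately show ?thesis using z(3-5) by metis
  qed
  define atom :: "ldg \<Rightarrow> bool" where "atom S \<longleftrightarrow> fst S = {} \<or> (\<exists>x. fst S = {x})" for S
  show ?thesis
  proof (rule wqo_on_decompose[where atom = atom and D = D and sz = "\<lambda>S. card (fst S)"])
    show "emb x y \<Longrightarrow> emb y z \<Longrightarrow> emb x z" for x y z by (rule emb_trans)
    show "wqo_on emb {a \<in> ?\<S>. atom a}"
    proof (rule wqo_on_map[where Q = "(=)" and B = "insert None (Some ` {..W})"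
          and f = "\<lambda>(V, c, R). if V = {} then None else Some (c (SOME x. x \<in> V))"])
      show "wqo_on (=) (insert None (Some ` {..W}))" by (rule wqo_on_finite_eq) simp
      show "(\<lambda>(V, c, R). if V = {} then None else Some (c (SOME x. x \<in> V))) a \<in> insert None (Some ` {..W})"
        if "a \<in> {a \<in> ?\<S>. atom a}" for a
        using that unfolding atom_def by (auto simp: some_in_eq)
      show "emb a b" if a: "a \<in> {a \<in> ?\<S>. atom a}" and b: "b \<in> {a \<in> ?\<S>. atom a}"
        and e: "(\<lambda>(V, c, R). if V = {} then None else Some (c (SOME x. x \<in> V))) a =
          (\<lambda>(V, c, R). if V = {} then None else Some (c (SOME x. x \<in> V))) b" for a b
      proof -
        obtain V c R where V: "a = (V, c, R)" by (cases a)
        obtain V' c' R' where V': "b = (V', c', R')" by (cases b)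
        have st: "stair l V c R" "stair l V' c' R'" using a b V V' by auto
        show ?thesis
        proof (cases "V = {}")
          case True
          then show ?thesis unfolding V V' emb_def emb_via_def by simp
        next
          case False
          then have "V' \<noteq> {}" using e unfolding V V' by (auto split: if_splits)
          then obtain x x' where x: "V = {x}" "V' = {x'}" using False a b unfolding V V' atom_def by auto
          then have "c' x' = c x" using e unfolding V V' by auto
          then have "emb (V, c, R) (V', c', R')" unfolding x emb_def
            by (intro exI[of _ "\<lambda>_. x'"] emb_viaI) (use stairD(2)[OF st(1)] stairD(2)[OF st(2)] x in auto)
          then show ?thesis unfolding V V' .
        qed
      qed
    qed
    show "\<exists>x y. D x y a" if a: "a \<in> ?\<S>" "\<not> atom a" for a
    proof -
      obtain V c R where V: "a = (V, c, R)" by (cases a)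
      have st: "stair l V c R" "V \<noteq> {}" using a V unfolding atom_def by auto
      obtain x where "x \<in> V" "\<forall>y\<in>V. y \<noteq> x \<longrightarrow> c x \<le> Suc (c y) \<longrightarrow> c y \<le> Suc (c x) \<longrightarrow> R x y"
        using stair_least[OF st(1) subset_refl st(2)] by blast
      moreover have "V \<noteq> {x}" using a V unfolding atom_def by auto
      ultimately have "D ({x}, c, R) (V - {x}, c, R) a" unfolding D_def V by auto
      then show ?thesis by blast
    qed
    show "x \<in> ?\<S> \<and> y \<in> ?\<S> \<and> card (fst x) < card (fst a) \<and> card (fst y) < card (fst a) \<and> emb x a \<and> emb y a"
      if D: "D x y a" and a: "a \<in> ?\<S>" for x y a
    proof -
      obtain V c R z where V: "a = (V, c, R)" "x = ({z}, c, R)" "y = (V - {z}, c, R)" "z \<in> V" "V \<noteq> {z}"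
        using DE[OF D] by (elim exE conjE) (rule that)
      have st: "stair l V c R" "\<forall>x\<in>V. c x \<le> W" using a V by auto
      have "{z} \<subset> V" "V - {z} \<subset> V" using V by auto
      then have "card {z} < card V" "card (V - {z}) < card V" using stairD(1)[OF st(1)] by (metis psubset_card_mono)+
      moreover have "emb x a" "emb y a" using V emb_subset by auto
      moreover have "x \<in> ?\<S>" "y \<in> ?\<S>" using V st stair_subset[OF st(1)] by auto
      ultimately show ?thesis using V by simp
    qed
    show "emb a a'" if a: "a \<in> ?\<S>" "a' \<in> ?\<S>" and D: "D x y a" "D x' y' a'" and e: "emb x x'" "emb y y'"
      for x y a x' y' a'
    proof -
      obtain V c R z where V: "a = (V, c, R)" "x = ({z}, c, R)" "y = (V - {z}, c, R)" "z \<in> V" "V \<noteq> {z}"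
        "\<forall>y\<in>V. y \<noteq> z \<longrightarrow> c z \<le> Suc (c y) \<longrightarrow> c y \<le> Suc (c z) \<longrightarrow> R z y"
        using DE[OF D(1)] by (elim exE conjE) (rule that)
      obtain V' c' R' z' where V': "a' = (V', c', R')" "x' = ({z'}, c', R')" "y' = (V' - {z'}, c', R')" "z' \<in> V'" "V' \<noteq> {z'}"
        "\<forall>y\<in>V'. y \<noteq> z' \<longrightarrow> c' z' \<le> Suc (c' y) \<longrightarrow> c' y \<le> Suc (c' z') \<longrightarrow> R' z' y"
        using DE[OF D(2)] by (elim exE conjE) (rule that)
      have st: "stair l V c R" "stair l V' c' R'" using a V V' by auto
      obtain f where f: "emb_via f x x'" using e(1) unfolding emb_def by blast
      obtain h where h: "emb_via h y y'" using e(2) unfolding emb_def by blast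
      note fD = emb_viaD[OF f[unfolded V V']] and hD = emb_viaD[OF h[unfolded V V']]
      have fz: "f z = z'" "c' z' = c z" using fD(1,2)[of z] by auto
      have rel: "R' z' (h y) = R z y \<and> R' (h y) z' = R y z" if y: "y \<in> V - {z}" for y
      proof -
        have y': "h y \<in> V'" "h y \<noteq> z'" "c' (h y) = c y" "y \<in> V" "y \<noteq> z" using hD(1,2)[OF y] y by auto
        consider "c z + 2 \<le> c y" | "c y + 2 \<le> c z" | "c z \<le> Suc (c y)" "c y \<le> Suc (c z)" by linarith
        then show ?thesis
        proof cases
          case 1
          then show ?thesis using stairD(3,4)[OF st(1), of z y] stairD(3,4)[OF st(2), of z' "h y"] y' V(4) V'(4) fz by auto
        next
          case 2
          then show ?thesis using stairD(3,4)[OF st(1), of y z] stairD(3,4)[OF st(2), of "h y" z'] y' V(4) V'(4) fz by auto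
        next
          case 3
          then have "R z y" "R' z' (h y)" using V(6) V'(6) y' fz by auto
          then show ?thesis using stairD(5)[OF st(1), of z y] stairD(5)[OF st(2), of z' "h y"] y' V(4) V'(4) fz 3 by auto
        qed
      qed
      have "emb ({z} \<union> (V - {z}), c, R) ({z'} \<union> (V' - {z'}), c', R')"
        by (rule emb_glue[OF f[unfolded V V'] h[unfolded V V']]) (use rel fz in auto)
      moreover have "{z} \<union> (V - {z}) = V" "{z'} \<union> (V' - {z'}) = V'" using V(4) V'(4) by auto
      ultimately show ?thesis unfolding V V' by simp
    qed
  qed
qed

section \<open>Distances along the cycle\<close>

context cyc
begin

text \<open>Distances count these arcs only, so that a path of length k advances exactly k cells and
  the distance from \<open>q\<close> determines the cell.\<close>

definition F :: "(nat \<times> nat) set" where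
  "F = {(x, y). x \<in> V \<and> y \<in> V \<and> R x y \<and> g y = Suc (g x) mod l}"

definition is_last :: "nat \<Rightarrow> bool" where
  "is_last x \<longleftrightarrow> x \<in> V \<and> (\<forall>y\<in>V. g y = g x \<longrightarrow> \<not> R x y)"

lemma is_lastV: "is_last x \<Longrightarrow> x \<in> V"
  unfolding is_last_def by blast

lemma F_V: "(x, y) \<in> F \<Longrightarrow> x \<in> V" "(x, y) \<in> F \<Longrightarrow> y \<in> V"
  unfolding F_def by auto

lemma F_R: "(x, y) \<in> F \<Longrightarrow> R x y"
  unfolding F_def by auto

lemma F_g: "(x, y) \<in> F \<Longrightarrow> g y = Suc (g x) mod l"
  unfolding F_def by auto

lemma FI: "x \<in> V \<Longrightarrow> y \<in> V \<Longrightarrow> R x y \<Longrightarrow> g y = Suc (g x) mod l \<Longrightarrow> (x, y) \<in> F"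
  unfolding F_def by auto

lemma ex_last:
  assumes "z \<in> V"
  shows "\<exists>e. is_last e \<and> g e = g z \<and> (z = e \<or> R z e)"
proof -
  let ?A = "{x \<in> V. g x = g z}"
  have n: "near l (g x) (g y)" if "x \<in> ?A" "y \<in> ?A" for x y using that unfolding near_def by simp
  have "\<exists>x\<in>?A. \<forall>y\<in>?A. y \<noteq> x \<longrightarrow> R y x"
  proof (rule finite_linear_least)
    show "finite ?A" using fin by simp
    show "?A \<noteq> {}" using assms by blast
    show "R y x \<or> R x y" if "x \<in> ?A" "y \<in> ?A" "x \<noteq> y" for x y using tot[of x y] n that by blast
    show "R z' x" if "x \<in> ?A" "y \<in> ?A" "z' \<in> ?A" "R y x" "R z' y" for x y z'
      using tr[of z' y x "g z"] that by simp
  qed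
  then obtain e where e: "e \<in> V" "g e = g z" "\<forall>y\<in>?A. y \<noteq> e \<longrightarrow> R y e" by blast
  have "\<not> R e y" if y: "y \<in> V" "g y = g e" for y
  proof (cases "y = e")
    case True then show ?thesis using irr e by simp
  next
    case False
    then have "R y e" using e y by simp
    then show ?thesis using asym y e by blast
  qed
  then have "is_last e" unfolding is_last_def using e by blast
  then show ?thesis using e assms by (intro exI[of _ e]) auto
qed

lemma last_unique: "is_last x \<Longrightarrow> is_last y \<Longrightarrow> g x = g y \<Longrightarrow> x = y"
  using tot[of x y] unfolding is_last_def near_def by metis

lemma F_cell: "(x, y) \<in> F \<Longrightarrow> z \<in> V \<Longrightarrow> g z = g y \<Longrightarrow> R y z \<Longrightarrow> (x, z) \<in> F"
  using tr[of x y z "g x"] unfolding F_def by simp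

lemma cell_F: "(x, y) \<in> F \<Longrightarrow> z \<in> V \<Longrightarrow> g z = g x \<Longrightarrow> R z x \<Longrightarrow> (z, y) \<in> F"
  using tr[of z x y "g x"] unfolding F_def by simp

lemma Suc_mod_inj: "a < l \<Longrightarrow> b < l \<Longrightarrow> Suc a mod l = Suc b mod l \<Longrightarrow> a = b"
  using mod_add_left_eq_iff[of 1 a l b] by simp

text \<open>A forward arc followed by a backward one amounts to an arc inside a cell. This is how
  backward arcs are removed from walks.\<close>

lemma F_ret:
  assumes "(x', x) \<in> F" "y \<in> V" "R x y" "g x = Suc (g y) mod l"
  shows "g x' = g y" "R x' y"
proof -
  have v: "x' \<in> V" "x \<in> V" "R x' x" "g x = Suc (g x') mod l" using assms(1) unfolding F_def by auto
  show *: "g x' = g y" using Suc_mod_inj[of "g x'" "g y"] g_less v assms by simp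
  show "R x' y" using tr[of x' x y "g y"] v assms * by simp
qed

text \<open>The value is unspecified for pairs not joined by a path; in the locale \<open>cw\<close>
  there are no such pairs, by \<open>reach\<close>.\<close>

definition dist :: "nat \<Rightarrow> nat \<Rightarrow> nat" where
  "dist x y = (LEAST n. (x, y) \<in> F ^^ n)"

lemma dist_le: "(x, y) \<in> F ^^ n \<Longrightarrow> dist x y \<le> n"
  unfolding dist_def by (rule Least_le)

lemma F_pow_g: "(x, y) \<in> F ^^ n \<Longrightarrow> x \<in> V \<Longrightarrow> g y = (g x + n) mod l"
proof (induction n arbitrary: y)
  case 0
  then show ?case using g_less by simp
next
  case (Suc n)
  then obtain z where "(x, z) \<in> F ^^ n" "(z, y) \<in> F" by auto
  then show ?case using Suc.IH[of z] Suc.prems F_g[of z y] by (simp add: mod_Suc_eq)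
qed

end

text \<open>In a strongly connected digraph the arrows leaving the last points of the cells all advance along the
  cycle in the same sense, which is made the increasing one by reversing the numbering if necessary.\<close>

locale cw = cyc +
  assumes str: "x \<in> V \<Longrightarrow> y \<in> V \<Longrightarrow> (x, y) \<in> {(a, b). a \<in> V \<and> b \<in> V \<and> R a b}\<^sup>*"
    and cell_ne: "a < l \<Longrightarrow> \<exists>x\<in>V. g x = a"
    and last_F: "is_last x \<Longrightarrow> \<exists>y. (x, y) \<in> F"
begin

lemma last_in_cell: "a < l \<Longrightarrow> \<exists>e. is_last e \<and> g e = a"
  using cell_ne ex_last by metis

lemma last_last:
  assumes "is_last x" "is_last y" "g y = Suc (g x) mod l"
  shows "(x, y) \<in> F"
proof -
  obtain y' where y': "(x, y') \<in> F" using last_F assms(1) by blast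
  show ?thesis
  proof (cases "y' = y")
    case False
    have g: "g y = g y'" using F_g[OF y'] assms(3) by simp
    have "R y' y" using tot[of y' y] assms(2) F_V(2)[OF y'] g False unfolding is_last_def near_def by auto
    then show ?thesis using F_cell[OF y' is_lastV[OF assms(2)] g] by blast
  qed (use y' in simp)
qed

lemma to_last:
  assumes "is_last x" "y \<in> V" "g x = Suc (g y) mod l"
  shows "(y, x) \<in> F"
proof -
  obtain e where e: "is_last e" "g e = g y" "y = e \<or> R y e" using ex_last assms(2) by blast
  have "(e, x) \<in> F" using last_last[OF e(1) assms(1)] e(2) assms(3) by simp
  then show ?thesis using e cell_F[of e x y] assms(2) by auto
qed

text \<open>A walk along arbitrary arcs is replaced step by step by one along \<open>F\<close>: an
  arc inside a cell is absorbed by \<open>F_cell\<close>, a backward arc by \<open>F_ret\<close>.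
  Neither kind can leave \<open>q\<close>, which is last in its cell and, by \<open>to_last\<close>,
  preceded by all points of the previous cell.\<close>

lemma last_reach:
  assumes q: "is_last q" and "y \<in> V"
  shows "(q, y) \<in> F\<^sup>*"
proof -
  have cell: "(q, z) \<in> F\<^sup>*" if y: "(q, y) \<in> F\<^sup>*" "z \<in> V" "g z = g y" "R y z" for y z
    using y(1)
  proof (cases rule: rtranclE)
    case base
    then show ?thesis using y q unfolding is_last_def by blast
  next
    case (step x)
    then show ?thesis using F_cell[OF step(2) y(2-4)] by (meson rtrancl_into_rtrancl)
  qed
  have qV: "q \<in> V" using q is_lastV by blast
  have "(q, y) \<in> {(a, b). a \<in> V \<and> b \<in> V \<and> R a b}\<^sup>*" using str qV assms(2) by blast
  then show ?thesis
  proof (induction rule: rtrancl_induct)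
    case (step y z)
    then have yz: "y \<in> V" "z \<in> V" "R y z" by auto
    from R_near[OF yz] show ?case
    proof (rule near_cases[OF yz(1,2)])
      assume "g y = g z"
      then show ?thesis using cell[OF step.IH] yz by simp
    next
      assume "g z = Suc (g y) mod l"
      then show ?thesis using FI yz step.IH by (meson rtrancl_into_rtrancl)
    next
      assume ret: "g y = Suc (g z) mod l"
      from step.IH show ?thesis
      proof (cases rule: rtranclE)
        case base
        then show ?thesis using to_last[OF q yz(2)] ret yz asym[of y z] F_R by blast
      next
        case (step x)
        note x = F_ret[OF step(2) yz(2,3) ret]
        show ?thesis
        using cell[OF step(1) yz(2)] x by simp
      qed
    qed
  qed simp
qed

lemma reach:
  assumes "x \<in> V" "y \<in> V"
  shows "(x, y) \<in> F\<^sup>*"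
proof -
  obtain e where e: "is_last e" "g e = g x" "x = e \<or> R x e" using ex_last assms(1) by blast
  have "Suc (g x) mod l < l" using l3 by simp
  then obtain e' where e': "is_last e'" "g e' = Suc (g x) mod l" using last_in_cell by blast
  have "(x, e') \<in> F" using to_last[OF e'(1) assms(1) e'(2)] .
  then show ?thesis using last_reach[OF e'(1) assms(2)] by (rule converse_rtrancl_into_rtrancl)
qed

lemma dist: "x \<in> V \<Longrightarrow> y \<in> V \<Longrightarrow> (x, y) \<in> F ^^ dist x y"
  using reach rtrancl_imp_relpow unfolding dist_def by (metis LeastI_ex)

lemma dist_step_left: "(x, x') \<in> F \<Longrightarrow> y \<in> V \<Longrightarrow> dist x y \<le> Suc (dist x' y)"
  using dist[of x' y] F_V[of x x'] by (intro dist_le) (meson relpow_Suc_I2)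

lemma dist_step_right: "x \<in> V \<Longrightarrow> (y, y') \<in> F \<Longrightarrow> dist x y' \<le> Suc (dist x y)"
  using dist[of x y] F_V[of y y'] by (intro dist_le) (meson relpow_Suc_I)

lemma dist_0: "x \<in> V \<Longrightarrow> y \<in> V \<Longrightarrow> dist x y = 0 \<longleftrightarrow> x = y"
  using dist[of x y] dist_le[of x y 0] by auto

lemma dist_Suc_left:
  assumes "x \<in> V" "y \<in> V" "dist x y = Suc k"
  obtains x' where "(x, x') \<in> F" "dist x' y = k"
proof -
  have "(x, y) \<in> F ^^ Suc k" using dist[of x y] assms by simp
  then obtain x' where x': "(x, x') \<in> F" "(x', y) \<in> F ^^ k" by (meson relpow_Suc_D2)
  then have "dist x' y \<le> k" "Suc k \<le> Suc (dist x' y)"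
    using dist_le dist_step_left[OF x'(1) assms(2)] assms(3) by auto
  then show thesis using that x' by simp
qed

lemma dist_Suc_right:
  assumes "x \<in> V" "y \<in> V" "dist x y = Suc k"
  obtains y' where "(y', y) \<in> F" "dist x y' = k"
proof -
  have "(x, y) \<in> F ^^ Suc k" using dist[of x y] assms by simp
  then obtain y' where y': "(y', y) \<in> F" "(x, y') \<in> F ^^ k" by auto
  then have "dist x y' \<le> k" "Suc k \<le> Suc (dist x y')"
    using dist_le dist_step_right[OF assms(1) y'(1)] assms(3) by auto
  then show thesis using that y' by simp
qed

lemma dist_g: "x \<in> V \<Longrightarrow> y \<in> V \<Longrightarrow> g y = (g x + dist x y) mod l"
  using F_pow_g dist by blast

text \<open>The last points form a directed cycle of length \<open>l\<close>, and it suffices to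
  walk along it.\<close>

lemma dist_last_last:
  assumes "is_last x" "is_last y"
  shows "dist x y < l"
proof -
  have *: "\<exists>e. is_last e \<and> (x, e) \<in> F ^^ k" for k
  proof (induction k)
    case 0
    then show ?case using assms(1) by auto
  next
    case (Suc k)
    then obtain e where e: "is_last e" "(x, e) \<in> F ^^ k" by blast
    have "Suc (g e) mod l < l" using l3 by simp
    then obtain e' where "is_last e'" "g e' = Suc (g e) mod l" using last_in_cell by blast
    then show ?case using last_last[OF e(1)] e(2) by auto
  qed
  have gx: "g x < l" "g y < l" using g_less assms is_lastV by auto
  define k where "k = (if g x \<le> g y then g y - g x else g y + l - g x)"
  have k: "k < l" "(g x + k) mod l = g y" using gx unfolding k_def by auto
  obtain e where e: "is_last e" "(x, e) \<in> F ^^ k" using * by blast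
  then have "e = y" using last_unique[OF _ assms(2)] F_pow_g[OF e(2)] is_lastV[OF assms(1)] k by simp
  then show ?thesis using dist_le e k by fastforce
qed

text \<open>The replacement of arcs from \<open>last_reach\<close> with lengths counted: only a
  forward arc can increase the distance from \<open>q\<close>.\<close>

lemma R_dist:
  assumes q: "is_last q" and yz: "y \<in> V" "z \<in> V" "R y z"
  shows "dist q z \<le> Suc (dist q y)"
proof -
  have qV: "q \<in> V" using q is_lastV by blast
  have cell: "dist q z \<le> dist q y" if yz: "y \<in> V" "z \<in> V" "R y z" "g z = g y" for y z
  proof (cases "dist q y")
    case 0
    then have "y = q" using dist_0 qV yz by simp
    then show ?thesis using yz q unfolding is_last_def by blast
  next
    case (Suc k)
    obtain x where x: "(x, y) \<in> F" "dist q x = k" using dist_Suc_right[OF qV yz(1) Suc] by blast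
    then show ?thesis using dist_step_right[OF qV F_cell[OF x(1) yz(2,4,3)]] Suc by simp
  qed
  from R_near[OF yz] show ?thesis
  proof (rule near_cases[OF yz(1,2)])
    assume "g y = g z"
    then show ?thesis using cell[OF yz] by simp
  next
    assume "g z = Suc (g y) mod l"
    then show ?thesis using dist_step_right[OF qV FI] yz by blast
  next
    assume ret: "g y = Suc (g z) mod l"
    show ?thesis
    proof (cases "dist q y")
      case 0
      then have "y = q" using dist_0 qV yz by simp
      then show ?thesis using to_last[OF q yz(2)] ret yz asym[of y z] F_R by blast
    next
      case (Suc k)
      obtain x where x: "(x, y) \<in> F" "dist q x = k" using dist_Suc_right[OF qV yz(1) Suc] by blast
      then show ?thesis using cell[OF F_V(1)[OF x(1)] yz(2)] F_ret[OF x(1) yz(2,3) ret] Suc by simp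
    qed
  qed
qed

text \<open>By \<open>R_dist\<close> no arc leads to a class two or more higher, so between such
  classes totality leaves only the arcs back. Two consecutive classes lie in two consecutive cells,
  on which \<open>R\<close> is linear.\<close>

lemma stair_dist:
  assumes q: "is_last q"
  shows "stair l V (dist q) R"
proof -
  have qV: "q \<in> V" using q is_lastV by blast
  have gd: "g x = (g q + dist q x) mod l" if "x \<in> V" for x using dist_g qV that by blast
  have nr: "near l (g x) (g y) \<longleftrightarrow> near l (dist q x) (dist q y)" if "x \<in> V" "y \<in> V" for x y
    unfolding gd[OF that(1)] gd[OF that(2)] near_mod near_add ..
  show ?thesis
  proof
    show "finite V" by (rule fin)
    show "\<not> R x x" if "x \<in> V" for x using irr that by blast
    show far': "\<not> R x y" if "x \<in> V" "y \<in> V" "dist q x + 2 \<le> dist q y" for x y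
      using R_dist[OF q that(1,2)] that(3) by auto
    show "R y x \<longleftrightarrow> near l (dist q x) (dist q y)" if "x \<in> V" "y \<in> V" "dist q x + 2 \<le> dist q y" for x y
    proof -
      have "x \<noteq> y" using that by auto
      then show ?thesis using far'[OF that] tot[OF that(1,2)] R_near[of y x] nr that near_sym by blast
    qed
    show "R x y \<longleftrightarrow> \<not> R y x" if "x \<in> V" "y \<in> V" "dist q x \<le> Suc (dist q y)" "dist q y \<le> Suc (dist q x)" "x \<noteq> y" for x y
    proof -
      have "dist q x = dist q y \<or> dist q x = Suc (dist q y) \<or> dist q y = Suc (dist q x)" using that by linarith
      then have "near l (dist q x) (dist q y)" unfolding near_def by auto
      then have "near l (g x) (g y)" using nr that by blast
      then show ?thesis using not_R that by blast
    qed
    show "R x z" if "x \<in> V" "y \<in> V" "z \<in> V" "{dist q x, dist q y, dist q z} \<subseteq> {k, Suc k}" "R x y" "R y z" for x y z k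
    proof -
      have "g w \<in> {(g q + k) mod l, Suc ((g q + k) mod l) mod l}" if "w \<in> V" "dist q w \<in> {k, Suc k}" for w
        using gd[OF that(1)] that(2) by (auto simp: mod_Suc_eq)
      then show ?thesis using tr[of x y z "(g q + k) mod l"] that by auto
    qed
  qed
qed

end

section \<open>Twins of coil points\<close>

text \<open>An abstract end-inflated coil: w 0, ..., w (n - 1) are the points of the coil,
  and y, y' are the additional copies of w 0 and w (n - 1).\<close>

definition inflated_coil :: "nat \<Rightarrow> nat \<Rightarrow> nat set \<Rightarrow> (nat \<Rightarrow> nat) \<Rightarrow> (nat \<Rightarrow> nat \<Rightarrow> bool) \<Rightarrow> (nat \<Rightarrow> nat) \<Rightarrow> nat \<Rightarrow> nat \<Rightarrow> bool" where
  "inflated_coil l n V g R w y y' \<longleftrightarrow>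
     (\<forall>i<n. w i \<in> V \<and> g (w i) = (g (w 0) + i) mod l) \<and>
     (\<forall>i. Suc i < n \<longrightarrow> R (w i) (w (Suc i))) \<and>
     (\<forall>i j. i + 2 \<le> j \<and> j < n \<and> near l i j \<longrightarrow> R (w j) (w i)) \<and>
     y \<in> V \<and> y \<noteq> w 0 \<and> g y = g (w 0) \<and> R y (w 1) \<and> (\<forall>j. 2 \<le> j \<and> j < n \<and> near l 0 j \<longrightarrow> R (w j) y) \<and>
     y' \<in> V \<and> y' \<noteq> w (n - 1) \<and> g y' = g (w (n - 1)) \<and> R (w (n - 2)) y' \<and>
     (\<forall>i. i + 2 < n \<and> near l i (n - 1) \<longrightarrow> R y' (w i)) \<and>
     (near l 0 (n - 1) \<longrightarrow> R y' y)"

text \<open>The number \<open>n\<close> counts the coil points without the two copies; the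
  corresponding permutation has \<open>n + 2\<close> points.\<close>

definition has_inflated_coil :: "nat \<Rightarrow> nat \<Rightarrow> ldg \<Rightarrow> bool" where
  "has_inflated_coil l n S \<longleftrightarrow> (\<exists>w y y'. inflated_coil l n (fst S) (fst (snd S)) (snd (snd S)) w y y')"

locale cw_path = cw +
  fixes q e T v
  assumes q: "is_last q" and e: "e \<in> V" and T: "dist q e = T"
    and T_max: "is_last x \<Longrightarrow> y \<in> V \<Longrightarrow> dist x y \<le> T"
    and v0: "v 0 = q" and vT: "v T = e" and vF: "i < T \<Longrightarrow> (v i, v (Suc i)) \<in> F"
begin

abbreviation "c \<equiv> dist q"

sublocale st: stair l V c R
  using stair_dist q .

lemma F_pow_add: "(x, y) \<in> F ^^ a \<Longrightarrow> (y, z) \<in> F ^^ b \<Longrightarrow> (x, z) \<in> F ^^ (a + b)"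
  unfolding relpow_add by blast

lemma qV: "q \<in> V" using q is_lastV by blast

lemma vV: "i \<le> T \<Longrightarrow> v i \<in> V"
  using vF[of i] F_V vT e by (cases "i = T") auto

lemma v_pow: "i + k \<le> T \<Longrightarrow> (v i, v (i + k)) \<in> F ^^ k"
  by (induction k) (use vF in auto)

lemma c_v: "i \<le> T \<Longrightarrow> c (v i) = i"
proof -
  assume i: "i \<le> T"
  have "c (v i) \<le> i" using v_pow[of 0 i] i v0 dist_le by simp
  moreover have "(q, e) \<in> F ^^ (c (v i) + (T - i))"
    using F_pow_add[OF dist[OF qV vV[OF i]], of "v T" "T - i"] v_pow[of i "T - i"] i vT by simp
  then have "T \<le> c (v i) + (T - i)" using dist_le T by blast
  ultimately show ?thesis using i by simp
qed

lemma c_le: "x \<in> V \<Longrightarrow> c x \<le> T"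
  using T_max q by blast

lemma to_e_v: "i \<le> T \<Longrightarrow> dist (v i) e = T - i"
proof -
  assume i: "i \<le> T"
  have "dist (v i) e \<le> T - i" using v_pow[of i "T - i"] i vT dist_le by simp
  moreover have "(q, e) \<in> F ^^ (i + dist (v i) e)"
    using dist[OF vV[OF i] e] v_pow[of 0 i] i v0 by (auto simp: relpow_add)
  then have "T \<le> i + dist (v i) e" using dist_le T by blast
  ultimately show ?thesis using i by simp
qed

text \<open>An arc of \<open>F\<close> that leaves the last point of the cell of \<open>z\<close>
  can be started at \<open>z\<close> instead. So \<open>z\<close> is no further from
  \<open>e\<close> than that last point, whose distances are bounded by \<open>T\<close>. The
  condition \<open>l \<le> T\<close> prevents the last point from being \<open>e\<close>
  itself.\<close>

lemma to_e_le:
  assumes "z \<in> V" "l \<le> T"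
  shows "dist z e \<le> T"
proof -
  obtain b where b: "is_last b" "g b = g z" "z = b \<or> R z b" using ex_last assms(1) by blast
  have "e \<noteq> b" using dist_last_last[OF q, of b] b T assms(2) by auto
  then obtain k where k: "dist b e = Suc k" using dist_0[OF is_lastV[OF b(1)] e] not0_implies_Suc by metis
  obtain y where y: "(b, y) \<in> F" "dist y e = k" using dist_Suc_left[OF is_lastV[OF b(1)] e k] by blast
  have "(z, y) \<in> F" using cell_F[OF y(1) assms(1)] b y(1) by auto
  then have "dist z e \<le> Suc k" using dist_step_left[of z y e] e y by simp
  then show ?thesis using k T_max[OF b(1) e] by simp
qed

lemma g_c: "x \<in> V \<Longrightarrow> g x = (g q + c x) mod l"
  using dist_g qV by blast

lemma near_g: "x \<in> V \<Longrightarrow> y \<in> V \<Longrightarrow> near l (g x) (g y) \<longleftrightarrow> near l (c x) (c y)"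
  using g_c[of x] g_c[of y] by (simp add: near_mod near_add)

lemma far: "x \<in> V \<Longrightarrow> y \<in> V \<Longrightarrow> c x + 2 \<le> c y \<Longrightarrow> near l (c x) (c y) \<Longrightarrow> R y x"
  using st.stair_far by blast

lemma F_c: "(x, y) \<in> F \<Longrightarrow> c y \<le> Suc (c x)"
  using dist_step_right qV by blast

lemma F_iff:
  assumes "x \<in> V" "y \<in> V" "Suc (c x) mod l = c y mod l"
  shows "(x, y) \<in> F \<longleftrightarrow> R x y"
proof -
  have "g y = Suc (g x) mod l" unfolding g_c[OF assms(1)] g_c[OF assms(2)]
    using assms(3) by (metis add_Suc_right mod_Suc_eq mod_add_right_eq)
  then show ?thesis using assms FI F_R by blast
qed

text \<open>Only the arcs from the path points one turn later are listed; those from further path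
  points follow by transitivity. The class of \<open>y\<close> need not be \<open>a\<close>: a point
  may serve as twin of a path point one turn earlier.\<close>

definition start_twin :: "nat \<Rightarrow> nat \<Rightarrow> bool" where
  "start_twin a y \<longleftrightarrow> y \<in> V \<and> y \<noteq> v a \<and> (y, v (Suc a)) \<in> F \<and> R (v (a + l)) y \<and> R (v (Suc (a + l))) y"

definition end_twin :: "nat \<Rightarrow> nat \<Rightarrow> bool" where
  "end_twin b y \<longleftrightarrow> y \<in> V \<and> y \<noteq> v b \<and> (v (b - 1), y) \<in> F \<and> R y (v (b - l)) \<and> R y (v (b - l - 1))"

text \<open>A point of class \<open>j\<close> off the path is a twin of \<open>v j\<close> if it
  precedes \<open>v (Suc j)\<close>. Otherwise both \<open>v j\<close> and \<open>v (Suc j)\<close>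
  precede it, while its larger class makes it precede \<open>v (Suc (j - l))\<close>; hence it is a
  twin of \<open>v (j - l)\<close>.\<close>

lemma start_twin_ge:
  assumes z: "z \<in> V" "z \<noteq> v (c z)" "l \<le> c z" "Suc (c z + l) \<le> T"
  shows "\<exists>a y. start_twin a y \<and> a \<le> c z"
proof -
  define j where "j = c z"
  have j: "l \<le> j" "Suc (j + l) \<le> T" using z j_def by auto
  have V: "v j \<in> V" "v (Suc j) \<in> V" "v (j + l) \<in> V" "v (Suc (j + l)) \<in> V" "v (j - l) \<in> V" "v (Suc (j - l)) \<in> V"
    using j by (auto intro!: vV)
  have C: "c (v j) = j" "c (v (Suc j)) = Suc j" "c (v (j + l)) = j + l" "c (v (Suc (j + l))) = Suc (j + l)"
    "c (v (j - l)) = j - l" "c (v (Suc (j - l))) = Suc (j - l)"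
    using j by (auto intro!: c_v)
  have m: "(j - l) mod l = j mod l" using j by (metis mod_add_self2 le_add_diff_inverse2)
  show ?thesis
  proof (cases "R z (v (Suc j))")
    case True
    have "(z, v (Suc j)) \<in> F" using F_iff[OF z(1) V(2)] True C j_def by simp
    moreover have "R (v (j + l)) z" by (rule far[OF z(1) V(3)]) (use C l3 j_def in \<open>auto simp: near_def\<close>)
    moreover have "R (v (Suc (j + l))) z"
      by (rule far[OF z(1) V(4)]) (use C l3 j_def mod_Suc_eq[of "j + l" l] mod_Suc_eq[of j l] in \<open>auto simp: near_def\<close>)
    moreover have "z \<noteq> v j" using z(2) j_def by simp
    ultimately have "start_twin j z" unfolding start_twin_def using z(1) by blast
    then show ?thesis using j_def by blast
  next
    case False
    have n: "near l (g z) (g (v (Suc j)))" unfolding near_g[OF z(1) V(2)] C j_def[symmetric] by (simp add: near_def)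
    have nz: "z \<noteq> v (Suc j)" using C j_def by auto
    have 1: "R (v (Suc j)) z" using tot[OF z(1) V(2) nz n] False by blast
    have 2: "R (v j) z"
    proof (rule ccontr)
      assume "\<not> R (v j) z"
      then have "R z (v j)" using tot[OF z(1) V(1)] z(2) near_g[OF z(1) V(1)] C j_def by (auto simp: near_def)
      moreover have "g z = g (v j)" using g_c[OF z(1)] g_c[OF V(1)] C j_def by simp
      ultimately have "(z, v (Suc j)) \<in> F" using cell_F[OF vF[of j] z(1)] j by simp
      then show False using F_R False by blast
    qed
    have "R z (v (Suc (j - l)))"
      by (rule far[OF V(6) z(1)]) (use C l3 j j_def m mod_Suc_eq[of "j - l" l] mod_Suc_eq[of j l] in \<open>auto simp: near_def\<close>)
    then have 3: "(z, v (Suc (j - l))) \<in> F"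
      by (subst F_iff[OF z(1) V(6)]) (use C m j_def in \<open>metis mod_Suc_eq\<close>)
    have "z \<noteq> v (j - l)" using C j_def j l3 by auto
    then have "start_twin (j - l) z" unfolding start_twin_def using z(1) 1 2 3 j by simp
    then show ?thesis using j_def by (intro exI[of _ "j - l"] exI[of _ z]) simp
  qed
qed

text \<open>The path from \<open>x\<close> is followed to the place where it joins \<open>v\<close>,
  and the point just before is the twin. The way through \<open>v m\<close> is a shortest one to
  \<open>e\<close>, so this point has no arc to \<open>v (Suc (a + l))\<close>, which would be a
  shortcut; the arcs between them must go the other way.\<close>

lemma start_twin_path:
  assumes "m + l < T"
  shows "(x, v m) \<in> F ^^ n \<Longrightarrow> x \<in> V \<Longrightarrow> n \<le> m \<Longrightarrow> dist x e = n + (T - m) \<Longrightarrow> x \<noteq> v (m - n) \<Longrightarrow>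
    \<exists>a y. start_twin a y \<and> a < m"
proof (induction n arbitrary: x)
  case (Suc n)
  obtain x' where x': "(x, x') \<in> F" "(x', v m) \<in> F ^^ n" using Suc.prems(1) by (meson relpow_Suc_D2)
  have x'V: "x' \<in> V" using F_V x' by blast
  have "(x', e) \<in> F ^^ (n + (T - m))"
    using F_pow_add[OF x'(2), of "v T" "T - m"] v_pow[of m "T - m"] assms vT by simp
  then have "dist x' e \<le> n + (T - m)" by (rule dist_le)
  then have d: "dist x' e = n + (T - m)" using dist_step_left[OF x'(1) e] Suc.prems(4) by simp
  show ?case
  proof (cases "x' = v (m - n)")
    case False
    then show ?thesis using Suc.IH[OF x'(2) x'V _ d] Suc.prems(3) by simp
  next
    case True
    define a where "a = m - Suc n"
    have a: "Suc a = m - n" "a + l < T" "a < m" using Suc.prems(3) assms unfolding a_def by auto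
    have F1: "(x, v (Suc a)) \<in> F" using x'(1) True a by simp
    have V: "v a \<in> V" "v (Suc a) \<in> V" "v (a + l) \<in> V" "v (Suc (a + l)) \<in> V" using a by (auto intro!: vV)
    have C: "c (v a) = a" "c (v (Suc a)) = Suc a" "c (v (a + l)) = a + l" "c (v (Suc (a + l))) = Suc (a + l)"
      using a by (auto intro!: c_v)
    have dx: "dist x e = T - a" using Suc.prems(3,4) a assms by linarith
    have gx: "g x = g (v a)"
      using Suc_mod_inj[of "g x" "g (v a)"] F_g[OF F1] F_g[OF vF[of a]] a g_less Suc.prems(2) V by simp
    have nF: "(x, v (Suc (a + l))) \<notin> F"
      using dist_step_left[of x "v (Suc (a + l))" e] to_e_v[of "Suc (a + l)"] e dx a l3 by auto
    have g1: "g (v (a + l)) = g x" unfolding gx using g_c[OF V(1)] g_c[OF V(3)] C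
      by (metis add.assoc mod_add_self2)
    have g2: "g (v (Suc (a + l))) = Suc (g x) mod l" using F_g[OF vF[of "a + l"]] a g1 by simp
    have "R (v (a + l)) x"
    proof (rule ccontr)
      assume "\<not> R (v (a + l)) x"
      moreover have "x \<noteq> v (a + l)" using dx to_e_v[of "a + l"] a l3 by auto
      ultimately have "R x (v (a + l))" using tot[OF Suc.prems(2) V(3)] g1 by (simp add: near_def)
      then show False using cell_F[OF vF[of "a + l"] Suc.prems(2)] a g1 nF by simp
    qed
    moreover have "R (v (Suc (a + l))) x"
    proof (rule ccontr)
      assume "\<not> R (v (Suc (a + l))) x"
      moreover have "x \<noteq> v (Suc (a + l))" using dx to_e_v[of "Suc (a + l)"] a l3 by auto
      ultimately have "R x (v (Suc (a + l)))" using tot[OF Suc.prems(2) V(4)] g2 by (simp add: near_def)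
      then show False using FI[OF Suc.prems(2) V(4)] g2 nF by simp
    qed
    moreover have "x \<noteq> v a" using Suc.prems(5) a_def by simp
    ultimately have "start_twin a x" unfolding start_twin_def using F1 Suc.prems(2) by blast
    then show ?thesis using a by blast
  qed
qed simp

text \<open>A step along \<open>F\<close> raises the class by at most one, so no class between those
  of the two ends is skipped.\<close>

lemma F_class_meet:
  assumes "(x, z) \<in> F ^^ n" "x \<in> V" "c x \<le> m" "m \<le> c z"
  shows "\<exists>y i. i \<le> n \<and> (x, y) \<in> F ^^ i \<and> (y, z) \<in> F ^^ (n - i) \<and> c y = m \<and> y \<in> V"
  using assms
proof (induction n arbitrary: x)
  case (Suc n)
  show ?case
  proof (cases "c x = m")
    case True
    then show ?thesis using Suc.prems by (intro exI[of _ x] exI[of _ 0]) simp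
  next
    case False
    obtain x' where x': "(x, x') \<in> F" "(x', z) \<in> F ^^ n" using Suc.prems(1) by (meson relpow_Suc_D2)
    have "c x' \<le> m" using F_c[OF x'(1)] False Suc.prems(3) by simp
    then obtain y i where y: "i \<le> n" "(x', y) \<in> F ^^ i" "(y, z) \<in> F ^^ (n - i)" "c y = m" "y \<in> V"
      using Suc.IH[OF x'(2) F_V(2)[OF x'(1)] _ Suc.prems(4)] by blast
    have "(x, y) \<in> F ^^ Suc i" using x'(1) y(2) by (rule relpow_Suc_I2)
    then show ?thesis using y by (intro exI[of _ y] exI[of _ "Suc i"]) simp
  qed
qed (auto intro!: exI)

text \<open>Points of the first \<open>l\<close> classes leave no room for a twin one turn earlier.
  From such a point a shortest path to \<open>e\<close> is followed up to class \<open>l\<close>: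
  there it either meets a point off \<open>v\<close>, to which \<open>start_twin_ge\<close> applies,
  or passes through \<open>v l\<close>, and then \<open>start_twin_path\<close> applies. In the
  latter case \<open>to_e_le\<close> ensures that at most \<open>l\<close> steps were made.\<close>

lemma ex_start_twin:
  assumes z: "z \<in> V" "z \<noteq> v (c z)" "Suc (c z + l) \<le> T" "Suc (l + l) \<le> T"
  shows "\<exists>a y. start_twin a y \<and> a \<le> max (c z) l"
proof (cases "l \<le> c z")
  case True
  then show ?thesis using start_twin_ge[OF z(1,2) True z(3)] by (meson le_max_iff_disj)
next
  case False
  have "c e = T" using T by simp
  then obtain y i where y: "i \<le> dist z e" "(z, y) \<in> F ^^ i" "(y, e) \<in> F ^^ (dist z e - i)" "c y = l" "y \<in> V"
    using F_class_meet[OF dist[OF z(1) e] z(1), of l] False z(4) by auto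
  show ?thesis
  proof (cases "y = v l")
    case False
    then show ?thesis using start_twin_ge[of y] y z(4) by auto
  next
    case True
    have "dist y e = T - l" using to_e_v[of l] True z(4) by simp
    then have "T - l \<le> dist z e - i" using dist_le[OF y(3)] by simp
    moreover have "dist z e \<le> i + (T - l)"
      using F_pow_add[OF y(2), of "v T" "T - l"] v_pow[of l "T - l"] z(4) vT True by (intro dist_le) simp
    moreover have "dist z e \<le> T" using to_e_le[OF z(1)] z(4) by simp
    ultimately have d: "dist z e = i + (T - l)" "i \<le> l" using z(4) y(1) by auto
    have "z \<noteq> v (l - i)" using z(2) c_v[of "l - i"] z(4) by fastforce
    then have "\<exists>a y. start_twin a y \<and> a < l"
      using start_twin_path[of l z i] y(2) True z d by simp
    then show ?thesis by (meson le_max_iff_disj less_imp_le)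
  qed
qed

text \<open>The mirror image of \<open>start_twin_ge\<close>, with a twin one turn later if
  \<open>z\<close> precedes \<open>v (j - 1)\<close>. When the path is too short for that turn, a
  predecessor of \<open>z\<close> in class \<open>j - 1\<close> is off the path too, because
  \<open>v (j - 1)\<close> does not precede \<open>z\<close>; the induction continues there.\<close>

lemma ex_end_twin:
  assumes "z \<in> V" "z \<noteq> v (c z)" "l < c z" "Suc (l + l) \<le> T"
  shows "\<exists>b y. end_twin b y \<and> min (c z) (T - l) \<le> b \<and> b \<le> T"
  using assms
proof (induction "c z" arbitrary: z)
  case (Suc k)
  note z = Suc.prems
  define j where "j = c z"
  have j: "Suc k = j" "l < j" "j \<le> T" using Suc.hyps z c_le j_def by auto
  have V: "v j \<in> V" "v (j - 1) \<in> V" "v (j - l) \<in> V" "v (j - l - 1) \<in> V"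
    using j by (auto intro!: vV)
  have C: "c (v j) = j" "c (v (j - 1)) = j - 1" "c (v (j - l)) = j - l" "c (v (j - l - 1)) = j - l - 1"
    using j by (auto intro!: c_v)
  have m: "(j - l) mod l = j mod l" "(j - l - 1) mod l = (j - 1) mod l" using j
    by (metis mod_add_self2 le_add_diff_inverse2 less_imp_le, metis add.commute diff_diff_eq diff_le_mono less_imp_le mod_add_self1 ordered_cancel_comm_monoid_diff_class.add_diff_inverse plus_1_eq_Suc Suc_leI diff_Suc_1 le_diff_conv2)
  show ?case
  proof (cases "R (v (j - 1)) z")
    case True
    have "(v (j - 1), z) \<in> F" by (subst F_iff[OF V(2) z(1)]) (use True C j j_def in auto)
    moreover have "R z (v (j - l))"
    proof (rule far[OF V(3) z(1)])
      show "c (v (j - l)) + 2 \<le> c z" using C(3) l3 j j_def by linarith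
      show "near l (c (v (j - l))) (c z)" using C(3) j_def m(1) by (simp add: near_def)
    qed
    moreover have "R z (v (j - l - 1))"
    proof (rule far[OF V(4) z(1)])
      show "c (v (j - l - 1)) + 2 \<le> c z" using C(4) l3 j j_def by linarith
      have "Suc (j - l - 1) mod l = j mod l" using m(1) j by (simp add: Suc_diff_Suc)
      then show "near l (c (v (j - l - 1))) (c z)" using C(4) j_def by (simp add: near_def)
    qed
    moreover have "z \<noteq> v j" using z(2) j_def by simp
    ultimately have "end_twin j z" unfolding end_twin_def using z(1) by blast
    then show ?thesis using j_def j by (intro exI[of _ j] exI[of _ z]) auto
  next
    case False
    have n: "near l (g z) (g (v (j - 1)))" unfolding near_g[OF z(1) V(2)] C j_def[symmetric] using j by (auto simp: near_def)
    have nz: "z \<noteq> v (j - 1)" using C j_def j by auto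
    have 1: "R z (v (j - 1))" using tot[OF z(1) V(2) nz n] False by blast
    have 2: "R z (v j)"
    proof (rule ccontr)
      assume "\<not> R z (v j)"
      then have "R (v j) z" using tot[OF z(1) V(1)] z(2) near_g[OF z(1) V(1)] C j_def by (auto simp: near_def)
      moreover have "g z = g (v j)" using g_c[OF z(1)] g_c[OF V(1)] C j_def by simp
      moreover have "(v (j - 1), v j) \<in> F" using vF[of "j - 1"] j by simp
      ultimately have "(v (j - 1), z) \<in> F" using F_cell z(1) by blast
      then show False using F_R False by blast
    qed
    show ?thesis
    proof (cases "j + l \<le> T")
      case True
      have V': "v (j + l) \<in> V" "v (j + l - 1) \<in> V" using True by (auto intro!: vV)
      have C': "c (v (j + l)) = j + l" "c (v (j + l - 1)) = j + l - 1" using True by (auto intro!: c_v)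
      have jl: "Suc (j + l - 1) = j + l" using j by simp
      have "R (v (j + l - 1)) z"
        by (rule far[OF z(1) V'(2)]) (use C' l3 j j_def jl in \<open>auto simp: near_def\<close>)
      then have "(v (j + l - 1), z) \<in> F" by (subst F_iff[OF V'(2) z(1)]) (use C' j_def jl in auto)
      moreover have "z \<noteq> v (j + l)" using C' j_def l3 by auto
      ultimately have "end_twin (j + l) z" unfolding end_twin_def using z(1) 1 2 by simp
      then show ?thesis using j_def True by (intro exI[of _ "j + l"] exI[of _ z]) auto
    next
      case jT: False
      obtain x where x: "(x, z) \<in> F" "c x = k" using dist_Suc_right[OF qV z(1), of k] Suc.hyps(2) by metis
      have "x \<noteq> v k" using x(1) F_R False j by auto
      then obtain b y where b: "end_twin b y" "min k (T - l) \<le> b" "b \<le> T"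
        using Suc.hyps(1)[of x] x F_V(1)[OF x(1)] z(4) jT j by auto
      then show ?thesis using jT j j_def by (intro exI[of _ b] exI[of _ y]) auto
    qed
  qed
qed simp

text \<open>Transitivity in a row or column carries the arcs at the path points one turn away to all
  further ones. The gap \<open>3 * l\<close> ensures a path point in the cell of \<open>y\<close> at
  least one turn from both ends, through which \<open>y'\<close> precedes \<open>y\<close> if their
  cells are near.\<close>

lemma inflated_coil_between:
  assumes a: "start_twin a y" and b: "end_twin b y'" "b \<le> T" and ab: "a + 3 * l \<le> b"
  shows "inflated_coil l (Suc (b - a)) V g R (\<lambda>i. v (a + i)) y y'"
proof -
  have yV: "y \<in> V" "y' \<in> V" using a b unfolding start_twin_def end_twin_def by auto
  have gv: "g (v i) = (g q + i) mod l" if "i \<le> T" for i using g_c[OF vV[OF that]] c_v[OF that] by simp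
  have farv: "R (v j) (v i)" if "i + 2 \<le> j" "j \<le> T" "near l i j" for i j
    using far[OF vV vV, of i j] c_v[of i] c_v[of j] that by simp
  have gy: "g y = g (v a)"
  proof -
    have "a < T" using ab b(2) l3 by linarith
    then show ?thesis using Suc_mod_inj[of "g y" "g (v a)"] F_g[of y "v (Suc a)"] F_g[OF vF[of a]] a g_less yV vV[of a]
      unfolding start_twin_def by simp
  qed
  have gy': "g y' = g (v b)"
    using F_g[of "v (b - 1)" y'] F_g[OF vF[of "b - 1"]] b ab l3 unfolding end_twin_def by simp
  have Ry: "R (v i) y" if i: "a + 2 \<le> i" "i \<le> T" "near l a i" for i
  proof -
    have al: "Suc (a + l) \<le> T" using ab b(2) l3 by linarith
    have V: "v i \<in> V" "v (a + l) \<in> V" "v (Suc (a + l)) \<in> V" using i al by (auto intro!: vV)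
    have 0: "R (v (a + l)) y" "R (v (Suc (a + l))) y" using a unfolding start_twin_def by auto
    have ga: "g (v (a + l)) = g (v a)" using gv[of "a + l"] gv[of a] al by (simp add: add.assoc[symmetric])
    have ga': "g (v (Suc (a + l))) = Suc (g (v a)) mod l"
      using gv[of "Suc (a + l)"] gv[of a] al by (metis ga F_g vF Suc_le_lessD)
    from i(3) consider "a mod l = i mod l" | "Suc a mod l = i mod l" | "Suc i mod l = a mod l" unfolding near_def by blast
    then show ?thesis
    proof cases
      case 1
      have gi: "g (v i) = g (v a)" using gv[of i] gv[of a] 1 i al mod_add_left_eq_iff[of "g q" i l a] by simp
      have "l dvd i - a" using 1 i by (metis mod_eq_dvd_iff_nat add_leD1)
      then have "a + l \<le> i" using i by (auto dest!: dvd_imp_le)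
      then consider "i = a + l" | "a + l < i" by linarith
      then show ?thesis
      proof cases
        case 2
        have "l dvd i - (a + l)" using \<open>l dvd i - a\<close> 2 by (metis diff_diff_left dvd_minus_self)
        then have "a + l + 2 \<le> i" using 2 l3 by (auto dest!: dvd_imp_le)
        then have "R (v i) (v (a + l))" using farv[of "a + l" i] i 1 by (simp add: near_def)
        then show ?thesis using tr[OF V(1,2) yV(1), of "g (v a)"] 0 gi ga gy by simp
      qed (use 0 in simp)
    next
      case 2
      have gi: "g (v i) = Suc (g (v a)) mod l"
        using gv[of i] gv[of a] gv[of "Suc a"] i al 2 mod_add_left_eq_iff[of "g q" i l "Suc a"] F_g[OF vF[of a]] by simp
      have "l dvd i - Suc a" using 2 i by (metis Suc_leD add_2_eq_Suc' mod_eq_dvd_iff_nat)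
      then have "Suc a + l \<le> i" using i by (auto dest!: dvd_imp_le)
      then consider "i = Suc (a + l)" | "Suc (a + l) < i" by linarith
      then show ?thesis
      proof cases
        case c2: 2
        have "l dvd i - Suc (a + l)" using \<open>l dvd i - Suc a\<close> c2 by (metis add_Suc diff_diff_left dvd_minus_self)
        then have "Suc (a + l) + 2 \<le> i" using c2 l3 by (auto dest!: dvd_imp_le)
        moreover have "near l (Suc (a + l)) i" using 2 mod_Suc_eq[of "a + l" l] mod_Suc_eq[of a l] by (simp add: near_def)
        ultimately have "R (v i) (v (Suc (a + l)))" using farv[of "Suc (a + l)" i] i by simp
        then show ?thesis using tr[OF V(1,3) yV(1), of "g (v a)"] 0 gi ga' gy by simp
      qed (use 0 in simp)
    next
      case 3
      have "l dvd Suc i - a" using 3 i by (metis mod_eq_dvd_iff_nat add_leD1 le_SucI)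
      then have il: "a + l \<le> Suc i" using i by (auto dest!: dvd_imp_le)
      have gi: "g (v a) = Suc (g (v i)) mod l"
        using gv[of i] gv[of a] i al 3 mod_add_left_eq_iff[of "g q" "Suc i" l a] mod_Suc_eq[of "g q + i" l] by simp
      have "R (v i) (v (a + l))"
      proof (cases "a + l = Suc i")
        case True
        then show ?thesis using F_R[OF vF[of i]] al by simp
      next
        case False
        have "l dvd Suc i - (a + l)" using \<open>l dvd Suc i - a\<close> il by (metis diff_diff_left dvd_minus_self)
        then have "a + l + l \<le> Suc i" using False il by (auto dest!: dvd_imp_le)
        then have "a + l + 2 \<le> i" using l3 by linarith
        then show ?thesis using farv[of "a + l" i] i 3 by (simp add: near_def)
      qed
      then show ?thesis using tr[OF V(1,2) yV(1), of "g (v i)"] 0 gi ga gy by simp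
    qed
  qed
  have Ry': "R y' (v i)" if i: "i + 2 \<le> b" "near l i b" for i
  proof -
    have bl: "l + l \<le> b" using ab by linarith
    have V: "v i \<in> V" "v (b - l) \<in> V" "v (b - l - 1) \<in> V" using i b(2) by (auto intro!: vV)
    have 0: "R y' (v (b - l))" "R y' (v (b - l - 1))" using b unfolding end_twin_def by auto
    have gb: "g (v (b - l)) = g (v b)"
      using gv[of "b - l"] gv[of b] bl b(2) mod_add_self2[of "g q + (b - l)" l] by simp
    have gb': "Suc (g (v (b - l - 1))) mod l = g (v b)"
    proof -
      have "Suc (b - l - 1) = b - l" "b - l - 1 < T" using bl b(2) l3 by simp_all
      then show ?thesis using F_g[OF vF[of "b - l - 1"]] gb by metis
    qed
    from i(2) consider "i mod l = b mod l" | "Suc b mod l = i mod l" | "Suc i mod l = b mod l" unfolding near_def by blast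
    then show ?thesis
    proof cases
      case 1
      have gi: "g (v i) = g (v b)" using gv[of i] gv[of b] 1 i b(2) mod_add_left_eq_iff[of "g q" i l b] by simp
      have "l dvd b - i" using 1 i by (metis mod_eq_dvd_iff_nat add_leD1)
      then have il: "i + l \<le> b" using i by (auto dest!: dvd_imp_le)
      show ?thesis
      proof (cases "i = b - l")
        case False
        have "l dvd b - l - i" using \<open>l dvd b - i\<close> il by (metis add.commute add_le_imp_le_diff diff_commute dvd_minus_self)
        then have "i + l \<le> b - l" using False il by (auto dest!: dvd_imp_le)
        then have "i + 2 \<le> b - l" using l3 by linarith
        moreover have "near l i (b - l)" using 1 bl mod_add_self2[of "b - l" l] by (simp add: near_def)
        ultimately have "R (v (b - l)) (v i)" using farv[of i "b - l"] b(2) by simp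
        then show ?thesis using tr[OF yV(2) V(2,1), of "g (v b)"] 0 gi gb gy' by simp
      qed (use 0 in simp)
    next
      case 3
      have gi: "Suc (g (v i)) mod l = g (v b)"
        using gv[of i] gv[of b] i b(2) 3 mod_add_left_eq_iff[of "g q" "Suc i" l b] mod_Suc_eq[of "g q + i" l] by simp
      have "l dvd b - Suc i" using 3 i by (metis Suc_leD add_2_eq_Suc' mod_eq_dvd_iff_nat)
      then have il: "Suc i + l \<le> b" using i by (auto dest!: dvd_imp_le)
      show ?thesis
      proof (cases "i = b - l - 1")
        case False
        have "l dvd b - Suc i - l" using \<open>l dvd b - Suc i\<close> il by (metis dvd_minus_self)
        then have "Suc i + l \<le> b - l" using False il by (auto dest!: dvd_imp_le)
        then have "i + 2 \<le> b - l - 1" using l3 by linarith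
        moreover have "near l i (b - l - 1)"
        proof -
          have "b - l - 1 - i = b - Suc i - l" by simp
          then have "i mod l = (b - l - 1) mod l"
            using \<open>l dvd b - Suc i - l\<close> \<open>i + 2 \<le> b - l - 1\<close> mod_eq_dvd_iff_nat[of i "b - l - 1" l] by simp
          then show ?thesis by (simp add: near_def)
        qed
        ultimately have "R (v (b - l - 1)) (v i)" using farv[of i "b - l - 1"] b(2) by simp
        then show ?thesis using tr[OF yV(2) V(3,1), of "g (v i)"] 0 gi gb' gy' Suc_mod_inj[of "g (v i)" "g (v (b - l - 1))"] g_less V by simp
      qed (use 0 in simp)
    next
      case 2
      have "l dvd Suc b - i" using 2 i by (metis mod_eq_dvd_iff_nat add_leD1 le_SucI)
      then have il: "i + l \<le> Suc b" using i by (auto dest!: dvd_imp_le)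
      have gi: "g (v i) = Suc (g (v b)) mod l"
        using gv[of i] gv[of b] i b(2) 2 mod_add_left_eq_iff[of "g q" "Suc b" l i] mod_Suc_eq[of "g q + b" l] by simp
      have "R (v (b - l)) (v i)"
      proof (cases "i = Suc b - l")
        case True
        then have "i = Suc (b - l)" using bl l3 by simp
        then show ?thesis using F_R[OF vF[of "b - l"]] b(2) bl l3 by simp
      next
        case False
        have "l dvd Suc b - i - l" using \<open>l dvd Suc b - i\<close> il by (metis add.commute add_le_imp_le_diff dvd_minus_self)
        then have "i + l + l \<le> Suc b" using False il by (auto dest!: dvd_imp_le)
        then have "i + 2 \<le> b - l" using l3 by linarith
        moreover have "near l i (b - l)" using 2 bl mod_add_self2[of "Suc (b - l)" l] by (simp add: near_def Suc_diff_le)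
        ultimately show ?thesis using farv[of i "b - l"] b(2) by simp
      qed
      then show ?thesis using tr[OF yV(2) V(2,1), of "g (v b)"] 0 gi gb gy' by simp
    qed
  qed
  have yy: "R y' y" if "near l a b"
  proof -
    define i where "i = a + l * ((b - a) div l - 1)"
    have d: "2 \<le> (b - a) div l" using ab l3 by (simp add: Suc_le_eq less_eq_div_iff_mult_less_eq)
    have "l * ((b - a) div l) \<le> b - a" by simp
    then have ib: "i + l \<le> b" unfolding i_def using d ab by (cases "(b - a) div l") auto
    have "l * 1 \<le> l * ((b - a) div l - 1)" using d by (intro mult_le_mono2) simp
    then have ia: "a + l \<le> i" unfolding i_def by simp
    have im: "i mod l = a mod l" unfolding i_def by simp
    have m: "near l a i" "near l i b" using im that unfolding near_def by (auto simp: mod_Suc_eq) (metis mod_Suc_eq)+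
    have iT: "i \<le> T" using ib b(2) by simp
    have 1: "R (v i) y" using Ry[of i] ia iT m l3 by simp
    have 2: "R y' (v i)" using Ry'[of i] ib m l3 by simp
    have gi: "g (v i) = g y" unfolding gy using gv[of i] gv[of a] im ia iT mod_add_left_eq_iff[of "g q" i l a] by simp
    from R_near[OF yV(2) vV[OF iT] 2] show ?thesis
    proof (rule near_cases[OF yV(2) vV[OF iT]])
      show "g y' = g (v i) \<Longrightarrow> ?thesis" using tr[OF yV(2) vV[OF iT] yV(1), of "g y"] 1 2 gi by simp
      show "g (v i) = Suc (g y') mod l \<Longrightarrow> ?thesis" using tr[OF yV(2) vV[OF iT] yV(1), of "g y'"] 1 2 gi by simp
      show "g y' = Suc (g (v i)) mod l \<Longrightarrow> ?thesis" using tr[OF yV(2) vV[OF iT] yV(1), of "g y"] 1 2 gi by simp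
    qed
  qed
  have na: "near l (a + i) (a + j) \<longleftrightarrow> near l i j" for i j by (rule near_add)
  have nb: "near l i (b - a) \<longleftrightarrow> near l (a + i) b" for i using na[of i "b - a"] ab by simp
  have abT: "a + j \<le> T" if "j < Suc (b - a)" for j using that ab b(2) by linarith
  show ?thesis unfolding inflated_coil_def
  proof (intro conjI allI impI)
    show "v (a + i) \<in> V" if "i < Suc (b - a)" for i using that b(2) ab by (intro vV) linarith
    show "g (v (a + i)) = (g (v (a + 0)) + i) mod l" if "i < Suc (b - a)" for i
      using gv[of "a + i"] gv[of a] that b(2) ab by (simp add: mod_add_left_eq add.assoc)
    show "R (v (a + i)) (v (a + Suc i))" if "Suc i < Suc (b - a)" for i using F_R[OF vF[of "a + i"]] that b(2) ab by simp
    show "R (v (a + j)) (v (a + i))" if "i + 2 \<le> j \<and> j < Suc (b - a) \<and> near l i j" for i j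
      using farv[of "a + i" "a + j"] that abT na by simp
    show "y \<in> V" "y' \<in> V" by fact+
    show "y \<noteq> v (a + 0)" "R y (v (a + 1))" using a F_R unfolding start_twin_def by auto
    show "g y = g (v (a + 0))" using gy by simp
    show "R (v (a + j)) y" if "2 \<le> j \<and> j < Suc (b - a) \<and> near l 0 j" for j
      using Ry[of "a + j"] that na[of 0 j] abT by simp
    show "y' \<noteq> v (a + (Suc (b - a) - 1))" using b ab unfolding end_twin_def by simp
    show "R (v (a + (Suc (b - a) - 2))) y'" using b ab l3 F_R unfolding end_twin_def by simp
    show "g y' = g (v (a + (Suc (b - a) - 1)))" using gy' ab by simp
    show "R y' (v (a + i))" if "i + 2 < Suc (b - a) \<and> near l i (Suc (b - a) - 1)" for i
    proof -
      have "a + i + 2 \<le> b" using that ab by linarith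
      then show ?thesis using Ry'[of "a + i"] that nb by simp
    qed
    show "R y' y" if "near l 0 (Suc (b - a) - 1)" using yy that nb[of 0] by simp
  qed
qed

text \<open>The start twin found has index at most \<open>c z + l\<close> and the end twin index at
  least \<open>c z' - l\<close>, so classes \<open>K + 6 * l\<close> apart leave at least
  \<open>K + 4 * l\<close> indices in between. The constant also gives the room at both ends that
  the existence lemmas ask for.\<close>

lemma extras_close:
  assumes K: "\<And>n. K \<le> n \<Longrightarrow> \<not> has_inflated_coil l n (V, g, R)"
    and z: "z \<in> V" "z \<noteq> v (c z)" and z': "z' \<in> V" "z' \<noteq> v (c z')"
  shows "c z' < c z + (K + 6 * l)"
proof (rule ccontr)
  assume "\<not> ?thesis"
  then have d: "c z + (K + 6 * l) \<le> c z'" by simp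
  moreover have "c z' \<le> T" using c_le z' by blast
  ultimately obtain a y where a: "start_twin a y" "a \<le> max (c z) l" using ex_start_twin[OF z] l3 by auto
  obtain b y' where b: "end_twin b y'" "min (c z') (T - l) \<le> b" "b \<le> T"
    using ex_end_twin[OF z'] d l3 \<open>c z' \<le> T\<close> by auto
  have ab: "a + 3 * l \<le> b" "K \<le> Suc (b - a)" using a(2) b(2) d \<open>c z' \<le> T\<close> by linarith+
  then show False using inflated_coil_between[OF a(1) b(1,3) ab(1)] K unfolding has_inflated_coil_def by auto
qed

end

section \<open>Coils with few further points\<close>

text \<open>A coil v 0, ..., v T with all further points in a window of W classes, starting at class p.\<close>

locale coily = stair l V c R for l V c R +
  fixes W :: nat and g :: "nat \<Rightarrow> nat" and s T p :: nat and v :: "nat \<Rightarrow> nat"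
  assumes g: "x \<in> V \<Longrightarrow> g x = (s + c x) mod l"
    and c_le: "x \<in> V \<Longrightarrow> c x \<le> T"
    and v: "i \<le> T \<Longrightarrow> v i \<in> V" "i \<le> T \<Longrightarrow> c (v i) = i"
    and p_le: "p \<le> T"
    and single: "x \<in> V \<Longrightarrow> c x < p \<or> p + W \<le> c x \<Longrightarrow> x = v (c x)"
    and pred: "x \<in> V \<Longrightarrow> 0 < c x \<Longrightarrow> \<exists>y\<in>V. Suc (c y) = c x \<and> R y x"
begin

text \<open>Class \<open>p + W\<close> contains only a coil point, but it is included in order to
  record its arcs to class \<open>p + W - 1\<close>, which may contain further points. Outside the
  window, arcs between consecutive classes follow from \<open>chain\<close>.\<close>

definition window :: "nat set" where
  "window = {x \<in> V. p \<le> c x \<and> c x \<le> p + W}"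

text \<open>The lower class consists of a single point, and by \<open>pred\<close> some point of
  that class precedes \<open>y\<close>.\<close>

lemma chain:
  assumes "x \<in> V" "y \<in> V" "c y = Suc (c x)" "c x < p \<or> p + W \<le> c x"
  shows "R x y" "\<not> R y x"
proof -
  obtain x' where x': "x' \<in> V" "c x' = c x" "R x' y" using pred[OF assms(2)] assms(3) by auto
  then have "x' = x" using single[OF assms(1,4)] single[OF x'(1)] assms(4) by simp
  then show R: "R x y" using x' by simp
  have "x \<noteq> y" using assms(3) by auto
  then show "\<not> R y x" using stair_tot[OF assms(1,2)] R assms(3) by simp
qed

lemma stair_window: "stair l window (\<lambda>x. c x - p) R"
proof
  show "finite window" using stair_finite unfolding window_def by simp
  have V: "x \<in> V" "p \<le> c x" if "x \<in> window" for x using that unfolding window_def by auto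
  show "\<not> R x x" if "x \<in> window" for x using stair_irr V that by blast
  show "R y x \<longleftrightarrow> near l (c x - p) (c y - p)" if *: "x \<in> window" "y \<in> window" "c x - p + 2 \<le> c y - p" for x y
    using stair_far[of x y] near_add[of l p "c x - p" "c y - p"] V[OF *(1)] V[OF *(2)] *(3) by simp
  show "\<not> R x y" if *: "x \<in> window" "y \<in> window" "c x - p + 2 \<le> c y - p" for x y
    using stair_far'[of x y] V[OF *(1)] V[OF *(2)] *(3) by simp
  show "R x y \<longleftrightarrow> \<not> R y x" if *: "x \<in> window" "y \<in> window" "c x - p \<le> Suc (c y - p)" "c y - p \<le> Suc (c x - p)" "x \<noteq> y" for x y
    using stair_tot[of x y] V[OF *(1)] V[OF *(2)] *(3-) by simp
  show "R x z" if *: "x \<in> window" "y \<in> window" "z \<in> window" "{c x - p, c y - p, c z - p} \<subseteq> {k, Suc k}" "R x y" "R y z" for x y z k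
  proof (rule stair_trans[OF V(1)[OF *(1)] V(1)[OF *(2)] V(1)[OF *(3)] _ *(5,6), of "k + p"])
    show "{c x, c y, c z} \<subseteq> {k + p, Suc (k + p)}"
      using V(2)[OF *(1)] V(2)[OF *(2)] V(2)[OF *(3)] *(4) by auto
  qed
qed

end

text \<open>Outside the window the coil carries no information except its two lengths. A shift by
  \<open>p' - p\<close> aligns the windows, and the equal residues keep the cells. With truncated
  subtraction the condition on \<open>T\<close> is void if the coil ends within the window, where no
  point lies above it.\<close>

lemma coily_emb:
  assumes S: "coily l V c R W g s T p v" and S': "coily l V' c' R' W g' s' T' p' v'"
    and res: "(s + p) mod l = (s' + p') mod l" and p: "p \<le> p'" and t: "T - (p + W) \<le> T' - (p' + W)"
    and e: "emb (coily.window V c W p, \<lambda>x. c x - p, R) (coily.window V' c' W p', \<lambda>x. c' x - p', R')"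
  shows "emb (V, g, R) (V', g', R')"
proof -
  interpret S: coily l V c R W g s T p v by fact
  interpret S': coily l V' c' R' W g' s' T' p' v' by fact
  obtain f where "emb_via f (S.window, \<lambda>x. c x - p, R) (S'.window, \<lambda>x. c' x - p', R')"
    using e unfolding emb_def by blast
  note f = emb_viaD[OF this]
  define d where "d = p' - p"
  have d: "p' = p + d" using p unfolding d_def by simp
  define h where "h x = (if x \<in> S.window then f x else v' (c x + d))" for x
  have out: "c x < p \<or> p + W < c x" if "x \<in> V" "x \<notin> S.window" for x using that unfolding S.window_def by auto
  have outT: "c x + d \<le> T'" if "x \<in> V" "x \<notin> S.window" for x
    using out[OF that] S.c_le[OF that(1)] S'.p_le t d by auto
  have hV: "h x \<in> V'" if "x \<in> V" for x
    using f(1)[of x] S'.v(1)[OF outT[OF that]] unfolding h_def S'.window_def by auto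
  have hc: "c' (h x) = c x + d" if x: "x \<in> V" for x
  proof (cases "x \<in> S.window")
    case True
    then have "p \<le> c x" "p' \<le> c' (f x)" "c' (f x) - p' = c x - p"
      using f(1,2)[of x] unfolding S.window_def S'.window_def by auto
    then show ?thesis using True d unfolding h_def by simp
  qed (use S'.v(2)[OF outT[OF x]] in \<open>simp add: h_def\<close>)
  have "emb_via h (V, g, R) (V', g', R')"
  proof (rule emb_viaI)
    show "h x \<in> V'" if "x \<in> V" for x by (rule hV[OF that])
    show "g' (h x) = g x" if x: "x \<in> V" for x
    proof -
      have "(p + (s' + (c x + d))) mod l = (s' + p' + c x) mod l" using d by (simp add: ac_simps)
      also have "\<dots> = (s + p + c x) mod l" using res by (metis mod_add_left_eq)
      also have "\<dots> = (p + (s + c x)) mod l" by (simp add: ac_simps)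
      finally have "(s' + (c x + d)) mod l = (s + c x) mod l" by (simp only: mod_add_left_eq_iff)
      then show ?thesis using S.g[OF x] S'.g[OF hV[OF x]] hc[OF x] by simp
    qed
    have win: "x \<in> S.window \<longleftrightarrow> y \<in> S.window" if "x \<in> V" "y \<in> V" "c x = c y" for x y
      using that unfolding S.window_def by simp
    show "inj_on h V"
    proof (rule inj_onI)
      fix x y assume xy: "x \<in> V" "y \<in> V" "h x = h y"
      then have c: "c x = c y" using hc[of x] hc[of y] by simp
      show "x = y"
      proof (cases "x \<in> S.window")
        case True
        then show ?thesis using win[OF xy(1,2) c] xy(3) inj_onD[OF f(3), of x y] unfolding h_def by simp
      next
        case False
        then show ?thesis using S.single[OF xy(1)] S.single[OF xy(2)] out[OF xy(1)] c by auto
      qed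
    qed
    have far: "R' (h x) (h y) = R x y \<and> R' (h y) (h x) = R y x" if xy: "x \<in> V" "y \<in> V" "c x + 2 \<le> c y" for x y
    proof -
      have "near l (c x) (c y) = near l (c x + d) (c y + d)"
        using near_add[of l d "c x" "c y"] by (simp add: add.commute)
      then show ?thesis
        using S.stair_far[OF xy] S.stair_far'[OF xy] S'.stair_far[OF hV[OF xy(1)] hV[OF xy(2)]]
          S'.stair_far'[OF hV[OF xy(1)] hV[OF xy(2)]] hc[OF xy(1)] hc[OF xy(2)] xy(3) by simp
    qed
    have adj: "R' (h x) (h y) = R x y \<and> R' (h y) (h x) = R y x" if xy: "x \<in> V" "y \<in> V" "c y = Suc (c x)"
      "\<not> (x \<in> S.window \<and> y \<in> S.window)" for x y
    proof -
      have o: "c x < p \<or> p + W \<le> c x" using xy unfolding S.window_def by auto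
      then have o': "c' (h x) < p' \<or> p' + W \<le> c' (h x)" using hc[OF xy(1)] d by auto
      show ?thesis
        using S.chain[OF xy(1-3) o] S'.chain[OF hV[OF xy(1)] hV[OF xy(2)] _ o'] hc[OF xy(1)] hc[OF xy(2)] xy(3) by simp
    qed
    show "R' (h x) (h y) = R x y" if xy: "x \<in> V" "y \<in> V" for x y
    proof (cases "x \<in> S.window \<and> y \<in> S.window")
      case True
      then show ?thesis using f(4)[of x y] unfolding h_def by simp
    next
      case False
      consider "c x + 2 \<le> c y" | "c y + 2 \<le> c x" | "c y = Suc (c x)" | "c x = Suc (c y)" | "c x = c y" by linarith
      then show ?thesis
      proof cases
        case 1 then show ?thesis using far xy by blast
      next
        case 2 then show ?thesis using far xy by blast
      next
        case 3 then show ?thesis using adj xy False by blast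
      next
        case 4 then show ?thesis using adj xy False by blast
      next
        case 5
        then have "x \<notin> S.window" using False win xy by blast
        then have "x = y" using S.single[OF xy(1)] S.single[OF xy(2)] out[OF xy(1)] 5 by auto
        then show ?thesis using S.stair_irr S'.stair_irr hV xy by blast
      qed
    qed
  qed
  then show ?thesis unfolding emb_def by blast
qed

lemma wqo_coily:
  assumes "0 < l"
  shows "wqo_on emb {(V, g, R). \<exists>c s T p v. coily l V c R W g s T p v}" (is "wqo_on emb ?A")
proof -
  define P where "P S = (SOME P. case P of (c, s, T, p, v) \<Rightarrow> coily l (fst S) c (snd (snd S)) W (fst (snd S)) s T p v)" for S :: ldg
  have P: "case P S of (c, s, T, p, v) \<Rightarrow> coily l (fst S) c (snd (snd S)) W (fst (snd S)) s T p v" if S: "S \<in> ?A" for S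
  proof -
    obtain c s T p v where "coily l (fst S) c (snd (snd S)) W (fst (snd S)) s T p v" using S by auto
    then have "case (c, s, T, p, v) of (c, s, T, p, v) \<Rightarrow> coily l (fst S) c (snd (snd S)) W (fst (snd S)) s T p v" by simp
    then show ?thesis unfolding P_def by (rule someI)
  qed
  define f where "f S = (case P S of (c, s, T, p, v) \<Rightarrow>
    ((s + p) mod l, p, T - (p + W), coily.window (fst S) c W p, \<lambda>x. c x - p, snd (snd S)))" for S :: ldg
  let ?Q = "\<lambda>a b. fst a = fst b \<and> (fst (snd a) \<le> fst (snd b) \<and> (fst (snd (snd a)) \<le> fst (snd (snd b)) \<and> emb (snd (snd (snd a))) (snd (snd (snd b)))))"
  let ?B = "{..<l} \<times> ((UNIV :: nat set) \<times> ((UNIV :: nat set) \<times> {(V, c, R). stair l V c R \<and> (\<forall>x\<in>V. c x \<le> W)}))"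
  have "wqo_on ?Q ?B"
    by (intro wqo_on_prod wqo_on_finite_eq wqo_on_nat_le wqo_stair) simp
  then show ?thesis
  proof (rule wqo_on_map[where f = f])
    fix S assume S: "S \<in> ?A"
    obtain c s T p v where c: "P S = (c, s, T, p, v)" by (cases "P S")
    interpret coily l "fst S" c "snd (snd S)" W "fst (snd S)" s T p v using P[OF S] unfolding c by simp
    show "f S \<in> ?B" using stair_window assms unfolding f_def c by (auto simp: window_def)
  next
    fix S S' assume S: "S \<in> ?A" and S': "S' \<in> ?A" and Q: "?Q (f S) (f S')"
    obtain c s T p v where c: "P S = (c, s, T, p, v)" by (cases "P S")
    obtain c' s' T' p' v' where c': "P S' = (c', s', T', p', v')" by (cases "P S'")
    have "emb (fst S, fst (snd S), snd (snd S)) (fst S', fst (snd S'), snd (snd S'))"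
      by (rule coily_emb[of l _ c _ W _ s T p v _ c' _ _ s' T' p' v']) (use P[OF S] P[OF S'] Q c c' in \<open>auto simp: f_def\<close>)
    then show "emb S S'" by simp
  qed
qed

lemma (in cw) coily:
  assumes K: "\<And>n. K \<le> n \<Longrightarrow> \<not> has_inflated_coil l n (V, g, R)"
  shows "\<exists>c s T p v. coily l V c R (K + 6 * l) g s T p v"
proof -
  define D where "D = {(x, y). is_last x \<and> y \<in> V}"
  obtain q0 where "is_last q0" using last_in_cell[of 0] l3 by auto
  then have "(q0, q0) \<in> D" using is_lastV unfolding D_def by blast
  moreover have "finite D" using is_lastV by (intro finite_subset[OF _ finite_cartesian_product[OF fin fin]]) (auto simp: D_def)
  ultimately have fD: "finite ((\<lambda>xy. dist (fst xy) (snd xy)) ` D)" "(\<lambda>xy. dist (fst xy) (snd xy)) ` D \<noteq> {}" by auto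
  obtain qe where qe1: "qe \<in> D" "dist (fst qe) (snd qe) = Max ((\<lambda>xy. dist (fst xy) (snd xy)) ` D)"
    using Max_in[OF fD] by auto
  have qe: "qe \<in> D" "dist (fst xy) (snd xy) \<le> dist (fst qe) (snd qe)" if "xy \<in> D" for xy
    using qe1 Max_ge[OF fD(1)] that by auto
  define q e T where "q = fst qe" and "e = snd qe" and "T = dist q e"
  have q: "is_last q" "e \<in> V" using qe1(1) unfolding D_def q_def e_def by auto
  have Tmax: "dist x y \<le> T" if "is_last x" "y \<in> V" for x y using qe(2)[of "(x, y)"] that unfolding D_def T_def q_def e_def by simp
  have "(q, e) \<in> F ^^ T" using dist q is_lastV unfolding T_def by blast
  then obtain v where v: "v 0 = q" "v T = e" "\<forall>i<T. (v i, v (Suc i)) \<in> F" unfolding relpow_fun_conv by blast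
  interpret cw_path l V g R q e T v
    by unfold_locales (use q Tmax v T_def in auto)
  \<comment> \<open>The least class with a point off the path; by \<open>extras_close\<close> all
    such points lie in fewer than \<open>K + 6 * l\<close> classes from there on. If there is none,
    any start of the window will do.\<close>
  define p where "p = (if \<exists>z\<in>V. z \<noteq> v (c z) then Min (c ` {z \<in> V. z \<noteq> v (c z)}) else 0)"
  have sing: "x = v (c x)" if x: "x \<in> V" "c x < p \<or> p + (K + 6 * l) \<le> c x" for x
  proof (rule ccontr)
    let ?E = "{z \<in> V. z \<noteq> v (c z)}"
    assume "x \<noteq> v (c x)"
    then have xE: "x \<in> ?E" using x by blast
    then have p: "p = Min (c ` ?E)" unfolding p_def by auto
    have "p \<in> c ` ?E" unfolding p by (rule Min_in) (use fin xE in auto)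
    then obtain z where z: "z \<in> V" "z \<noteq> v (c z)" "p = c z" by blast
    have "p \<le> c x" unfolding p by (rule Min_le) (use fin xE in auto)
    moreover have "c x < p + (K + 6 * l)" using extras_close[OF K z(1,2)] xE z(3) by blast
    ultimately show False using x by linarith
  qed
  have "p \<le> T"
  proof (cases "\<exists>z\<in>V. z \<noteq> v (c z)")
    case True
    then have "p \<in> c ` {z \<in> V. z \<noteq> v (c z)}" unfolding p_def using fin by (auto intro!: Min_in)
    then show ?thesis using c_le by auto
  qed (simp add: p_def)
  have "coily l V c R (K + 6 * l) g (g q) T p v"
  proof unfold_locales
    show "g x = (g q + c x) mod l" if "x \<in> V" for x using g_c that by blast
    show "c x \<le> T" if "x \<in> V" for x using c_le that by blast
    show "v i \<in> V" "c (v i) = i" if "i \<le> T" for i using vV c_v that by auto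
    show "p \<le> T" by fact
    show "x = v (c x)" if "x \<in> V" "c x < p \<or> p + (K + 6 * l) \<le> c x" for x using sing that by blast
    show "\<exists>y\<in>V. Suc (c y) = c x \<and> R y x" if x: "x \<in> V" "0 < c x" for x
    proof -
      obtain k where k: "c x = Suc k" using x gr0_implies_Suc by blast
      obtain y where "(y, x) \<in> F" "c y = k" using dist_Suc_right[OF qV x(1) k] by blast
      then show ?thesis using k F_V F_R by auto
    qed
  qed
  then show ?thesis by blast
qed

section \<open>Reversal of the numbering, and the theorem for labelled digraphs\<close>

definition neg :: "nat \<Rightarrow> nat \<Rightarrow> nat" where
  "neg l a = (l - a) mod l"

lemma neg_less: "0 < l \<Longrightarrow> neg l a < l"
  unfolding neg_def by simp

lemma neg_neg: "a < l \<Longrightarrow> neg l (neg l a) = a"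
  unfolding neg_def by (cases "a = 0") auto

lemma neg_eq_iff: "a < l \<Longrightarrow> b < l \<Longrightarrow> neg l a = neg l b \<longleftrightarrow> a = b"
  using neg_neg by metis

lemma neg_Suc: "a < l \<Longrightarrow> Suc (neg l (Suc a mod l)) mod l = neg l a"
  unfolding neg_def by (cases "Suc a = l") (auto simp: mod_Suc Suc_diff_Suc)

lemma ex_pred_mod: "b < l \<Longrightarrow> \<exists>a<l. Suc a mod l = (b::nat)"
proof (cases b)
  case 0
  assume "b < l"
  then show ?thesis using 0 by (intro exI[of _ "l - 1"]) simp
next
  case (Suc a)
  assume "b < l"
  then show ?thesis using Suc by (intro exI[of _ a]) simp
qed

lemma neg_Suc_iff:
  assumes "a < l" "b < l"
  shows "Suc (neg l a) mod l = neg l b \<longleftrightarrow> Suc b mod l = a"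
proof
  assume h: "Suc (neg l a) mod l = neg l b"
  obtain b' where b': "b' < l" "Suc b' mod l = a" using ex_pred_mod assms by blast
  then show "Suc b mod l = a" using neg_Suc[OF b'(1)] h neg_eq_iff[OF b'(1) assms(2)] by simp
qed (use neg_Suc assms in blast)

lemma near_neg:
  assumes "a < l" "b < l"
  shows "near l (neg l a) (neg l b) \<longleftrightarrow> near l a b"
proof -
  have "0 < l" using assms by simp
  then have "neg l a mod l = neg l a" "neg l b mod l = neg l b" "a mod l = a" "b mod l = b"
    using neg_less assms by auto
  then show ?thesis
    unfolding near_def using neg_Suc_iff[of a l b] neg_Suc_iff[of b l a] neg_eq_iff[of a l b] assms by metis
qed

lemma (in cyc) cyc_neg: "cyc l V (\<lambda>x. neg l (g x)) R"
proof
  have l0: "0 < l" using l3 by simp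
  show "3 \<le> l" "finite V" by (fact l3 fin)+
  show "neg l (g x) < l" for x using neg_less l0 by blast
  show "near l (neg l (g x)) (neg l (g y))" if "x \<in> V" "y \<in> V" "R x y" for x y
    using near_neg[OF g_less g_less] R_near that by blast
  show "\<not> R x x" if "x \<in> V" for x using irr that by blast
  show "R x y \<or> R y x" if "x \<in> V" "y \<in> V" "x \<noteq> y" "near l (neg l (g x)) (neg l (g y))" for x y
    using near_neg[OF g_less g_less] tot that by blast
  show "R x z" if xyz: "x \<in> V" "y \<in> V" "z \<in> V" and n: "neg l (g x) \<in> {a, Suc a mod l}" "neg l (g y) \<in> {a, Suc a mod l}"
    "neg l (g z) \<in> {a, Suc a mod l}" and R: "R x y" "R y z" for x y z a
  proof -
    define b where "b = neg l (Suc a mod l)"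
    have "g w \<in> {b, Suc b mod l}" if w: "w \<in> V" "neg l (g w) \<in> {a, Suc a mod l}" for w
    proof (cases "neg l (g w) = a")
      case True
      then have "a < l" using neg_less[OF l0] by blast
      then have "Suc b mod l = neg l a" unfolding b_def by (rule neg_Suc)
      then show ?thesis using True neg_neg[OF g_less[OF w(1)]] by auto
    next
      case False
      then show ?thesis using w neg_neg[OF g_less[OF w(1)]] unfolding b_def by auto
    qed
    then show ?thesis using tr[OF xyz, of b] n R xyz by blast
  qed
qed

lemma mod_closed_all:
  assumes A: "A \<subseteq> {..<l}" "a0 \<in> A" "\<And>a. a \<in> A \<Longrightarrow> Suc a mod l \<in> A" and "b < (l::nat)"
  shows "b \<in> A"
proof -
  have "(a0 + k) mod l \<in> A" for k
  proof (induction k)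
    case 0
    then show ?case using A by auto
  next
    case (Suc k)
    then show ?case using A(3)[of "(a0 + k) mod l"] by (simp add: mod_Suc_eq)
  qed
  from this[of "l - a0 + b"] show ?thesis using A(1,2) assms(4) by auto
qed

text \<open>If a last point \<open>x\<close> has no forward arc, its arcs lead back, and it precedes
  the last point \<open>e\<close> of the previous cell. A forward arc from \<open>e\<close> would by
  transitivity give an arc from \<open>x\<close> inside its own cell, so \<open>e\<close> has none
  either. Going round the cycle, all last points have backward arcs, which are forward arcs in the
  reversed numbering.\<close>

lemma (in cyc) strong_cw:
  assumes s: "strong (V, g, R)" and xy: "x0 \<in> V" "y0 \<in> V" "x0 \<noteq> y0"
  shows "cw l V g R \<or> cw l V (\<lambda>x. neg l (g x)) R"
proof -
  have l0: "0 < l" using l3 by simp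
  have str: "(x, y) \<in> {(a, b). a \<in> V \<and> b \<in> V \<and> R a b}\<^sup>*" if "x \<in> V" "y \<in> V" for x y
    using s that unfolding strong_def by simp
  have out: "\<exists>y\<in>V. R x y" if "x \<in> V" for x
  proof -
    obtain y where y: "y \<in> V" "y \<noteq> x" using xy by metis
    from str[OF that y(1)] show ?thesis by (cases rule: converse_rtranclE) (use y in auto)
  qed
  interpret n: cyc l V "\<lambda>x. neg l (g x)" R by (rule cyc_neg)
  have nl: "n.is_last x \<longleftrightarrow> is_last x" for x
    unfolding n.is_last_def is_last_def using neg_eq_iff[OF g_less g_less] by blast
  have nF: "(x, y) \<in> n.F \<longleftrightarrow> x \<in> V \<and> y \<in> V \<and> R x y \<and> Suc (g y) mod l = g x" for x y
    unfolding n.F_def using neg_Suc_iff[OF g_less g_less, of x y] by (auto simp: eq_commute[of "neg l (g y)"])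
  show ?thesis
  proof (cases "\<forall>x. is_last x \<longrightarrow> (\<exists>y. (x, y) \<in> F)")
    case True
    have "\<exists>x\<in>V. g x = a" if "a < l" for a
    proof -
      have "a \<in> g ` V"
      proof (rule mod_closed_all[OF _ _ _ that])
        show "g ` V \<subseteq> {..<l}" using g_less by auto
        show "g x0 \<in> g ` V" using xy by blast
        show "Suc b mod l \<in> g ` V" if b: "b \<in> g ` V" for b
        proof -
          obtain x where x: "x \<in> V" "g x = b" using b by blast
          obtain e where e: "is_last e" "g e = g x" using ex_last[OF x(1)] by blast
          then obtain y where "(e, y) \<in> F" using True by blast
          then show ?thesis using F_g[of e y] F_V[of e y] e x by (metis image_eqI)
        qed
      qed
      then show ?thesis by auto
    qed
    then have "cw l V g R" by unfold_locales (use str True in auto)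
    then show ?thesis by blast
  next
    case False
    then obtain x1 where x1: "is_last x1" "\<And>y. (x1, y) \<notin> F" by blast
    have step: "\<exists>y. is_last y \<and> (\<forall>z. (y, z) \<notin> F) \<and> (x, y) \<in> n.F" if x: "is_last x" "\<And>y. (x, y) \<notin> F" for x
    proof -
      have xV: "x \<in> V" using x is_lastV by blast
      obtain y where y: "y \<in> V" "R x y" using out xV by blast
      from R_near[OF xV y] have gy: "g x = Suc (g y) mod l"
      proof (rule near_cases[OF xV y(1)])
        show "g x = g y \<Longrightarrow> ?thesis" using x(1) y unfolding is_last_def by auto
        show "g y = Suc (g x) mod l \<Longrightarrow> ?thesis" using x(2)[of y] FI xV y by blast
      qed
      obtain e where e: "is_last e" "g e = g y" "y = e \<or> R y e" using ex_last[OF y(1)] by blast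
      have eV: "e \<in> V" using e is_lastV by blast
      have Re: "R x e"
      proof (cases "y = e")
        case False
        then show ?thesis using tr[OF xV y(1) eV, of "g y"] e gy y by simp
      qed (use y in simp)
      have "(e, z) \<notin> F" for z
      proof
        assume z: "(e, z) \<in> F"
        have zV: "z \<in> V" "R e z" "g z = g x" using F_V[OF z] F_R[OF z] F_g[OF z] e gy by auto
        then have "R x z" using tr[OF xV eV zV(1), of "g e"] Re e gy by simp
        then show False using x(1) zV unfolding is_last_def by blast
      qed
      moreover have "(x, e) \<in> n.F" unfolding nF using xV eV Re gy e by simp
      ultimately show ?thesis using e by blast
    qed
    define A where "A = {neg l (g x) | x. is_last x \<and> (\<forall>y. (x, y) \<notin> F)}"
    have all: "a \<in> A" if "a < l" for a
    proof (rule mod_closed_all[OF _ _ _ that])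
      show "A \<subseteq> {..<l}" using neg_less[OF l0] unfolding A_def by auto
      show "neg l (g x1) \<in> A" using x1 unfolding A_def by blast
      show "Suc b mod l \<in> A" if b: "b \<in> A" for b
      proof -
        obtain x where x: "is_last x" "\<And>y. (x, y) \<notin> F" "b = neg l (g x)" using b unfolding A_def by blast
        obtain y where y: "is_last y" "\<forall>z. (y, z) \<notin> F" "(x, y) \<in> n.F" using step[OF x(1,2)] by blast
        have "Suc b mod l = neg l (g y)" using n.F_g[OF y(3)] x(3) by simp
        then show ?thesis using y unfolding A_def by blast
      qed
    qed
    have "cw l V (\<lambda>x. neg l (g x)) R"
    proof unfold_locales
      show "(x, y) \<in> {(a, b). a \<in> V \<and> b \<in> V \<and> R a b}\<^sup>*" if "x \<in> V" "y \<in> V" for x y using str that by blast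
      show "\<exists>x\<in>V. neg l (g x) = a" if "a < l" for a using all[OF that] is_lastV unfolding A_def by blast
      show "\<exists>y. (x, y) \<in> n.F" if x: "n.is_last x" for x
      proof -
        have "neg l (g x) \<in> A" using all neg_less[OF l0] by blast
        then obtain x' where x': "is_last x'" "\<And>y. (x', y) \<notin> F" "neg l (g x) = neg l (g x')" unfolding A_def by blast
        then have "x = x'" using n.last_unique[OF x] nl by simp
        then show ?thesis using step[OF x'(1,2)] by blast
      qed
    qed
    then show ?thesis by blast
  qed
qed

lemma emb_neg_iff:
  assumes "cyc l V g R" "cyc l V' g' R'" "emb (V, \<lambda>x. neg l (g x), R) (V', \<lambda>x. neg l (g' x), R')"
  shows "emb (V, g, R) (V', g', R')"
proof -
  obtain f where "emb_via f (V, \<lambda>x. neg l (g x), R) (V', \<lambda>x. neg l (g' x), R')" using assms(3) unfolding emb_def by blast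
  note f = emb_viaD[OF this]
  have "emb_via f (V, g, R) (V', g', R')"
    by (rule emb_viaI) (use f neg_eq_iff[OF cyc.g_less[OF assms(2)] cyc.g_less[OF assms(1)]] in auto)
  then show ?thesis unfolding emb_def by blast
qed

lemma has_inflated_coil_mono:
  assumes "has_inflated_coil l n (A, g, R)" "A \<subseteq> V"
  shows "has_inflated_coil l n (V, g, R)"
proof -
  obtain w y y' where w: "inflated_coil l n A g R w y y'" using assms(1) unfolding has_inflated_coil_def by auto
  have "inflated_coil l n V g R w y y'"
    using w assms(2) unfolding inflated_coil_def by (elim conjE, intro conjI) (assumption | blast)+
  then show ?thesis unfolding has_inflated_coil_def by auto
qed

text \<open>Coils are excluded for both directions of numbering since either may be the one in which
  \<open>strong_cw\<close> applies. The family is closed under subsets of points, as the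
  decomposition into parts requires.\<close>

theorem wqo_no_inflated_coils:
  "wqo_on emb {(V, g, R). cyc l V g R \<and> (\<forall>n\<ge>K. \<not> has_inflated_coil l n (V, g, R) \<and>
    \<not> has_inflated_coil l n (V, \<lambda>x. neg l (g x), R))}" (is "wqo_on emb ?\<S>")
proof (cases "3 \<le> l")
  case False
  then have "?\<S> = {}" using cyc.l3 by blast
  then show ?thesis unfolding wqo_on_def by blast
next
  case l3: True
  let ?A = "{(V, g, R). \<exists>c s T p v. coily l V c R (K + 6 * l) g s T p v}"
  have A: "wqo_on emb ?A" using wqo_coily l3 by simp
  define S1 where "S1 = {S \<in> ?\<S>. S \<in> ?A}"
  define S2 where "S2 = {S \<in> ?\<S>. (fst S, \<lambda>x. neg l (fst (snd S) x), snd (snd S)) \<in> ?A}"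
  \<comment> \<open>A digraph with one point is strongly connected, but its last point has no arc at
    all; these and the empty one are treated separately.\<close>
  define S3 where "S3 = {S \<in> ?\<S>. fst S = {} \<or> (\<exists>x. fst S = {x})}"
  have "wqo_on emb S1" by (rule wqo_on_subset[OF A]) (auto simp: S1_def)
  moreover have "wqo_on emb S2"
  proof (rule wqo_on_map[OF A, where f = "\<lambda>S. (fst S, \<lambda>x. neg l (fst (snd S) x), snd (snd S))"])
    show "(fst S, \<lambda>x. neg l (fst (snd S) x), snd (snd S)) \<in> ?A" if "S \<in> S2" for S using that unfolding S2_def by blast
    show "emb S S'" if "S \<in> S2" "S' \<in> S2" "emb (fst S, \<lambda>x. neg l (fst (snd S) x), snd (snd S)) (fst S', \<lambda>x. neg l (fst (snd S') x), snd (snd S'))" for S S'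
    proof -
      have "cyc l (fst S) (fst (snd S)) (snd (snd S))" "cyc l (fst S') (fst (snd S')) (snd (snd S'))"
        using that(1,2) unfolding S2_def by auto
      then show ?thesis using emb_neg_iff[OF _ _ that(3)] by simp
    qed
  qed
  moreover have "wqo_on emb S3"
  proof (rule wqo_on_map[where Q = "(=)" and B = "insert None (Some ` {..<l})"
        and f = "\<lambda>S. if fst S = {} then None else Some (fst (snd S) (SOME x. x \<in> fst S))"])
    show "wqo_on (=) (insert None (Some ` {..<l}))" by (rule wqo_on_finite_eq) simp
    show "(if fst S = {} then None else Some (fst (snd S) (SOME x. x \<in> fst S))) \<in> insert None (Some ` {..<l})" if "S \<in> S3" for S
      using that cyc.g_less[of l "fst S" "fst (snd S)" "snd (snd S)"] unfolding S3_def by (auto simp: some_in_eq)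
    show "emb S S'" if S: "S \<in> S3" "S' \<in> S3" and e: "(if fst S = {} then None else Some (fst (snd S) (SOME x. x \<in> fst S))) =
       (if fst S' = {} then None else Some (fst (snd S') (SOME x. x \<in> fst S')))" for S S'
    proof (cases "fst S = {}")
      case True
      then show ?thesis unfolding emb_def emb_via_def by simp
    next
      case False
      obtain V g R where V: "S = (V, g, R)" by (cases S)
      obtain V' g' R' where V': "S' = (V', g', R')" by (cases S')
      have "V' \<noteq> {}" using False e V' by (auto split: if_splits)
      then obtain x x' where x: "V = {x}" "V' = {x'}" using False S unfolding V V' S3_def by auto
      have c: "cyc l V g R" "cyc l V' g' R'" using S V V' unfolding S3_def by auto
      have "g' x' = g x" using e unfolding V V' x by simp
      then have "emb_via (\<lambda>_. x') S S'" unfolding V V' x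
        by (intro emb_viaI) (use cyc.irr[OF c(1)] cyc.irr[OF c(2)] x in auto)
      then show ?thesis unfolding emb_def by blast
    qed
  qed
  ultimately have "wqo_on emb (S1 \<union> S2 \<union> S3)" by (intro wqo_on_Un)
  moreover have "{S \<in> ?\<S>. strong S} \<subseteq> S1 \<union> S2 \<union> S3"
  proof
    fix S assume S: "S \<in> {S \<in> ?\<S>. strong S}"
    obtain V g R where V: "S = (V, g, R)" by (cases S)
    have c: "cyc l V g R" and K: "\<And>n. K \<le> n \<Longrightarrow> \<not> has_inflated_coil l n (V, g, R)"
      "\<And>n. K \<le> n \<Longrightarrow> \<not> has_inflated_coil l n (V, \<lambda>x. neg l (g x), R)" and s: "strong (V, g, R)" using S V by auto
    show "S \<in> S1 \<union> S2 \<union> S3"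
    proof (cases "V = {} \<or> (\<exists>x. V = {x})")
      case True
      then show ?thesis using S V unfolding S3_def by auto
    next
      case False
      then obtain x where x: "x \<in> V" by blast
      then obtain y where "y \<in> V" "x \<noteq> y" using False by blast
      then have "cw l V g R \<or> cw l V (\<lambda>x. neg l (g x)) R" using cyc.strong_cw[OF c s x] by blast
      then show ?thesis using cw.coily[of l V g R K, OF _ K(1)] cw.coily[of l V "\<lambda>x. neg l (g x)" R K, OF _ K(2)] S
        unfolding V S1_def S2_def by auto
    qed
  qed
  ultimately have str: "wqo_on emb {S \<in> ?\<S>. strong S}" by (rule wqo_on_subset)
  show ?thesis
  proof (rule wqo_cyc_from_strong[OF _ _ str, where l = l])
    show "cyc_ldg l S" if "S \<in> ?\<S>" for S using that unfolding cyc_ldg_def by auto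
    show "(A, g, R) \<in> ?\<S>" if "(V, g, R) \<in> ?\<S>" "A \<subseteq> V" for V g R A
    proof -
      have V: "cyc l V g R" "\<And>n. K \<le> n \<Longrightarrow> \<not> has_inflated_coil l n (V, g, R) \<and> \<not> has_inflated_coil l n (V, \<lambda>x. neg l (g x), R)"
        using that(1) by auto
      have "cyc l A g R" by (rule cyc.cyc_subset[OF V(1) that(2)])
      moreover have "\<not> has_inflated_coil l n (A, g, R) \<and> \<not> has_inflated_coil l n (A, \<lambda>x. neg l (g x), R)" if "K \<le> n" for n
        using V(2)[OF that] has_inflated_coil_mono[OF _ \<open>A \<subseteq> V\<close>] by blast
      ultimately show ?thesis by simp
    qed
  qed
qed

section \<open>Griddings by cells\<close>

text \<open>A gridding, given by the cell of each point instead of the grid lines.\<close>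

definition cell_gridding :: "(nat \<Rightarrow> nat \<Rightarrow> int) \<Rightarrow> nat \<Rightarrow> nat \<Rightarrow> nat list \<Rightarrow> (nat \<Rightarrow> nat \<times> nat) \<Rightarrow> bool" where
  "cell_gridding M m n p cc \<longleftrightarrow> (\<forall>x<length p. cc x \<in> nonzero_cells M m n) \<and>
     (\<forall>x y. x < y \<and> y < length p \<longrightarrow> fst (cc x) \<le> fst (cc y)) \<and>
     (\<forall>x<length p. \<forall>y<length p. p ! x < p ! y \<longrightarrow> snd (cc x) \<le> snd (cc y)) \<and>
     (\<forall>x y. x < y \<and> y < length p \<and> cc x = cc y \<longrightarrow> (p ! x < p ! y \<longleftrightarrow> M (fst (cc x)) (snd (cc x)) = 1))"

definition cell_arrow :: "(nat \<Rightarrow> int) \<Rightarrow> (nat \<Rightarrow> int) \<Rightarrow> nat list \<Rightarrow> (nat \<Rightarrow> nat \<times> nat) \<Rightarrow> nat \<Rightarrow> nat \<Rightarrow> bool" where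
  "cell_arrow c r p cc x y \<longleftrightarrow> x < length p \<and> y < length p \<and>
     ((fst (cc x) = fst (cc y) \<and> (if c (fst (cc x)) = 1 then x < y else y < x)) \<or>
      (snd (cc x) = snd (cc y) \<and> (if r (snd (cc x)) = 1 then p ! x < p ! y else p ! y < p ! x)))"

lemma cell_griddingD:
  assumes "cell_gridding M m n p cc"
  shows "x < length p \<Longrightarrow> cc x \<in> nonzero_cells M m n"
    "x < y \<Longrightarrow> y < length p \<Longrightarrow> fst (cc x) \<le> fst (cc y)"
    "x < length p \<Longrightarrow> y < length p \<Longrightarrow> p ! x < p ! y \<Longrightarrow> snd (cc x) \<le> snd (cc y)"
    "x < y \<Longrightarrow> y < length p \<Longrightarrow> cc x = cc y \<Longrightarrow> p ! x < p ! y \<longleftrightarrow> M (fst (cc x)) (snd (cc x)) = 1"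
  using assms unfolding cell_gridding_def by auto

lemma is_perm_nth_less: "is_perm p \<Longrightarrow> x < length p \<Longrightarrow> p ! x < length p"
  unfolding is_perm_def by (metis atLeastLessThan_iff nth_mem)

lemma is_perm_nth_eq: "is_perm p \<Longrightarrow> x < length p \<Longrightarrow> y < length p \<Longrightarrow> p ! x = p ! y \<longleftrightarrow> x = y"
  unfolding is_perm_def using nth_eq_iff_index_eq by blast

lemma lines_mono:
  fixes v :: "nat \<Rightarrow> nat"
  shows "(\<forall>i<k. v i \<le> v (Suc i)) \<Longrightarrow> i \<le> j \<Longrightarrow> j \<le> k \<Longrightarrow> v i \<le> (v j :: nat)"
proof (induction j)
  case (Suc j)
  then show ?case by (cases "i = Suc j") (auto intro: order_trans)
qed simp

lemma lines_ex:
  fixes v :: "nat \<Rightarrow> nat"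
  assumes "v 0 = (0::nat)" "x < v k"
  shows "\<exists>i\<in>{1..k}. v (i - 1) \<le> x \<and> x < v i"
proof -
  define i where "i = (LEAST i. x < v i)"
  have i: "x < v i" unfolding i_def by (rule LeastI[of "\<lambda>i. x < v i", OF assms(2)])
  have le: "i \<le> k" unfolding i_def by (rule Least_le[of "\<lambda>i. x < v i", OF assms(2)])
  have "0 < i" using i assms(1) by (cases i) auto
  then have "\<not> x < v (i - 1)" unfolding i_def by (intro not_less_Least) (simp add: i_def)
  then show ?thesis using i le \<open>0 < i\<close> by (intro bexI[of _ i]) auto
qed

lemma lines_le:
  fixes v :: "nat \<Rightarrow> nat"
  assumes "\<forall>i<k. v i \<le> v (Suc i)" "i \<in> {1..k}" "j \<in> {1..k}" "v (i - 1) \<le> x" "x < v i" "v (j - 1) \<le> y" "y < v j" "x \<le> (y::nat)"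
  shows "i \<le> j"
proof (rule ccontr)
  assume "\<not> i \<le> j"
  then have "v j \<le> v (i - 1)" using assms(2,3) by (intro lines_mono[OF assms(1)]) auto
  then show False using assms by simp
qed

lemma gridding_cells:
  assumes gm: "gridding_matrix M m n" and g: "is_gridding M m n p v h"
  obtains cc where "cell_gridding M m n p cc" "\<forall>x<length p. in_cell p v h (cc x) x"
proof -
  have p: "is_perm p" and v: "v 0 = 0" "v m = length p" "\<forall>i<m. v i \<le> v (Suc i)"
    and h: "h 0 = 0" "h n = length p" "\<forall>j<n. h j \<le> h (Suc j)"
    and cells: "\<And>i j. i \<in> {1..m} \<Longrightarrow> j \<in> {1..n} \<Longrightarrow>
        (M i j = 0 \<longrightarrow> (\<forall>x. \<not> in_cell p v h (i, j) x)) \<and>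
        (M i j = 1 \<longrightarrow> (\<forall>x y. in_cell p v h (i, j) x \<and> in_cell p v h (i, j) y \<and> x < y \<longrightarrow> p!x < p!y)) \<and>
        (M i j = -1 \<longrightarrow> (\<forall>x y. in_cell p v h (i, j) x \<and> in_cell p v h (i, j) y \<and> x < y \<longrightarrow> p!y < p!x))"
    using g unfolding is_gridding_def by blast+
  have "\<exists>e. fst e \<in> {1..m} \<and> snd e \<in> {1..n} \<and> in_cell p v h e x" if x: "x < length p" for x
  proof -
    obtain i where i: "i \<in> {1..m}" "v (i - 1) \<le> x \<and> x < v i" using lines_ex[of v x m] v(1,2) x by auto
    have "p ! x < h n" using is_perm_nth_less[OF p x] h(2) by simp
    then obtain j where j: "j \<in> {1..n}" "h (j - 1) \<le> p ! x \<and> p ! x < h j" using lines_ex[of h "p ! x" n] h(1) by blast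
    show ?thesis using i j x unfolding in_cell_def in_col_def in_row_def by (intro exI[of _ "(i, j)"]) simp
  qed
  then obtain cc where cc: "\<And>x. x < length p \<Longrightarrow> fst (cc x) \<in> {1..m} \<and> snd (cc x) \<in> {1..n} \<and> in_cell p v h (cc x) x" by metis
  have "cell_gridding M m n p cc" unfolding cell_gridding_def
  proof (intro conjI allI impI)
    fix x assume x: "x < length p"
    show "cc x \<in> nonzero_cells M m n"
      using cc[OF x] cells[of "fst (cc x)" "snd (cc x)"] unfolding nonzero_cells_def by (cases "cc x") auto
  next
    fix x y assume xy: "x < y \<and> y < length p"
    have x: "x < length p" using xy by simp
    show "fst (cc x) \<le> fst (cc y)"
      using lines_le[OF v(3), of "fst (cc x)" "fst (cc y)" x y] cc[OF x] cc[of y] xy unfolding in_cell_def in_col_def by simp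
  next
    fix x y assume xy: "x < length p" "y < length p" "p ! x < p ! y"
    show "snd (cc x) \<le> snd (cc y)"
      using lines_le[OF h(3), of "snd (cc x)" "snd (cc y)" "p ! x" "p ! y"] cc[OF xy(1)] cc[OF xy(2)] xy(3)
      unfolding in_cell_def in_row_def by simp
  next
    fix x y assume xy: "x < y \<and> y < length p \<and> cc x = cc y"
    have x: "x < length p" "y < length p" using xy by auto
    let ?i = "fst (cc x)" and ?j = "snd (cc x)"
    have "M ?i ?j \<in> {-1, 0, 1}" using gm cc[OF x(1)] unfolding gridding_matrix_def by blast
    moreover have "in_cell p v h (?i, ?j) x" "in_cell p v h (?i, ?j) y" using cc[OF x(1)] cc[OF x(2)] xy by auto
    moreover have "?i \<in> {1..m}" "?j \<in> {1..n}" using cc[OF x(1)] by auto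
    ultimately show "p ! x < p ! y \<longleftrightarrow> M ?i ?j = 1"
      using cells[of ?i ?j] xy by (metis insertE less_asym singletonD one_neq_neg_one)
  qed
  then show thesis using that cc by blast
qed

lemma orient_arrow_cell_arrow:
  assumes g: "is_gridding M m n p v h" and cc: "\<forall>x<length p. in_cell p v h (cc x) x"
    and E: "\<forall>x<length p. cc x \<in> nonzero_cells M m n"
  shows "orient_arrow m n c r p v h x y \<longleftrightarrow> cell_arrow c r p cc x y"
proof (cases "x < length p \<and> y < length p")
  case True
  have v: "\<forall>i<m. v i \<le> v (Suc i)" and h: "\<forall>j<n. h j \<le> h (Suc j)" using g unfolding is_gridding_def by blast+
  have R: "fst (cc z) \<in> {1..m}" "snd (cc z) \<in> {1..n}" if "z < length p" for z
    using E[rule_format, OF that] unfolding nonzero_cells_def by (auto split: prod.splits)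
  have col: "i \<in> {1..m} \<Longrightarrow> in_col v i z \<longleftrightarrow> i = fst (cc z)" if "z < length p" for i z
    using lines_le[OF v, of i "fst (cc z)" z z] lines_le[OF v, of "fst (cc z)" i z z] R[OF that] cc that
    unfolding in_cell_def in_col_def by (metis le_antisym le_refl)
  have row: "j \<in> {1..n} \<Longrightarrow> in_row p h j z \<longleftrightarrow> j = snd (cc z)" if "z < length p" for j z
    using lines_le[OF h, of j "snd (cc z)" "p ! z" "p ! z"] lines_le[OF h, of "snd (cc z)" j "p ! z" "p ! z"] R[OF that] cc that
    unfolding in_cell_def in_row_def by (metis le_antisym le_refl)
  have "(\<exists>i\<in>{1..m}. in_col v i x \<and> in_col v i y \<and> (if c i = 1 then x < y else y < x)) \<longleftrightarrow>
    (fst (cc x) = fst (cc y) \<and> (if c (fst (cc x)) = 1 then x < y else y < x))"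
    using col[of x] col[of y] R[of x] R[of y] True by metis
  moreover have "(\<exists>j\<in>{1..n}. in_row p h j x \<and> in_row p h j y \<and> (if r j = 1 then p!x < p!y else p!y < p!x)) \<longleftrightarrow>
    (snd (cc x) = snd (cc y) \<and> (if r (snd (cc x)) = 1 then p!x < p!y else p!y < p!x))"
    using row[of x] row[of y] R[of x] R[of y] True by metis
  ultimately show ?thesis unfolding orient_arrow_def cell_arrow_def using True by blast
qed (auto simp: orient_arrow_def cell_arrow_def)

lemma down_set_lessThan:
  fixes D :: "nat set"
  assumes "finite D" "\<And>x y. y \<in> D \<Longrightarrow> x < y \<Longrightarrow> x \<in> D"
  shows "x < card D \<longleftrightarrow> x \<in> D"
proof (cases "D = {}")
  case False
  have "D = {..Max D}"
  proof
    show "D \<subseteq> {..Max D}" using assms(1) by auto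
    have "Max D \<in> D" using assms(1) False by (rule Max_in)
    then show "{..Max D} \<subseteq> D" using assms(2)[of "Max D"] by (auto simp: le_less)
  qed
  then have "card D = Suc (Max D)" by (metis card_atMost)
  then show ?thesis using \<open>D = {..Max D}\<close> by (metis atMost_iff less_Suc_eq_le)
qed simp

lemma cells_gridding:
  assumes p: "is_perm p" and cg: "cell_gridding M m n p cc"
  obtains v h where "is_gridding M m n p v h" "\<forall>x<length p. in_cell p v h (cc x) x"
proof -
  note cg = cell_griddingD[OF cg]
  define N where "N = length p"
  \<comment> \<open>A line is placed after as many points as lie in the columns or rows up to it. By
    monotonicity these points form an initial segment, so their number determines them.\<close>
  define v where "v k = card {x. x < N \<and> fst (cc x) \<le> k}" for k
  define h where "h k = card {x. x < N \<and> snd (cc x) \<le> k}" for k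
  have E: "fst (cc x) \<in> {1..m} \<and> snd (cc x) \<in> {1..n} \<and> M (fst (cc x)) (snd (cc x)) \<noteq> 0" if "x < N" for x
    using cg(1)[of x] that unfolding nonzero_cells_def N_def by (auto split: prod.splits)
  have inj: "inj_on ((!) p) {x. x < N \<and> P x}" for P
    using is_perm_nth_eq[OF p] unfolding inj_on_def N_def by simp
  have V: "x < v k \<longleftrightarrow> fst (cc x) \<le> k" if "x < N" for x k
  proof -
    have "x < v k \<longleftrightarrow> x \<in> {x. x < N \<and> fst (cc x) \<le> k}" unfolding v_def
      by (rule down_set_lessThan) (use cg(2) N_def in \<open>auto intro: order_trans\<close>)
    then show ?thesis using that by simp
  qed
  have H: "p ! x < h k \<longleftrightarrow> snd (cc x) \<le> k" if x: "x < N" for x k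
  proof -
    let ?D = "(!) p ` {x. x < N \<and> snd (cc x) \<le> k}"
    have "p ! x < card ?D \<longleftrightarrow> p ! x \<in> ?D"
    proof (rule down_set_lessThan)
      fix a b assume b: "b \<in> ?D" and ab: "a < b"
      then obtain y where y: "b = p ! y" "y < N" "snd (cc y) \<le> k" by blast
      then have "a < N" using ab is_perm_nth_less[OF p, of y] N_def by simp
      then obtain z where z: "z < N" "p ! z = a" using p unfolding is_perm_def N_def by (metis atLeastLessThan_iff in_set_conv_nth le0)
      then have "snd (cc z) \<le> snd (cc y)" using cg(3)[of z y] y ab N_def by simp
      then show "a \<in> ?D" using z y by auto
    qed simp
    moreover have "card ?D = h k" unfolding h_def by (rule card_image[OF inj])
    moreover have "p ! x \<in> ?D \<longleftrightarrow> snd (cc x) \<le> k" using is_perm_nth_eq[OF p] x unfolding N_def by auto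
    ultimately show ?thesis by simp
  qed
  have cell: "in_cell p v h (i, j) x \<longleftrightarrow> x < N \<and> cc x = (i, j)" if ij: "i \<in> {1..m}" "j \<in> {1..n}" for i j x
  proof (cases "x < N")
    case True
    have "(v (i - 1) \<le> x \<and> x < v i) \<longleftrightarrow> fst (cc x) = i" using V[OF True, of i] V[OF True, of "i - 1"] ij by auto
    moreover have "(h (j - 1) \<le> p ! x \<and> p ! x < h j) \<longleftrightarrow> snd (cc x) = j" using H[OF True, of j] H[OF True, of "j - 1"] ij by auto
    ultimately show ?thesis unfolding in_cell_def in_col_def in_row_def using True N_def by (auto simp: prod_eq_iff)
  qed (simp add: in_cell_def N_def)
  have "is_gridding M m n p v h" unfolding is_gridding_def
  proof (intro conjI allI impI ballI)
    show "is_perm p" by fact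
    have "{x. x < N \<and> fst (cc x) \<le> 0} = {}" "{x. x < N \<and> snd (cc x) \<le> 0} = {}" using E by fastforce+
    then show "v 0 = 0" "h 0 = 0" unfolding v_def h_def by (metis card.empty)+
    have "{x. x < N \<and> fst (cc x) \<le> m} = {..<N}" "{x. x < N \<and> snd (cc x) \<le> n} = {..<N}" using E by fastforce+
    then show "v m = length p" "h n = length p" unfolding v_def h_def N_def by simp_all
    show "v i \<le> v (Suc i)" for i unfolding v_def by (rule card_mono) auto
    show "h i \<le> h (Suc i)" for i unfolding h_def by (rule card_mono) auto
  next
    fix i j x assume "i \<in> {1..m}" "j \<in> {1..n}" "M i j = 0"
    then show "\<not> in_cell p v h (i, j) x" using cell E[of x] by auto
  next
    fix i j x y assume "i \<in> {1..m}" "j \<in> {1..n}" "M i j = 1" "in_cell p v h (i, j) x \<and> in_cell p v h (i, j) y \<and> x < y"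
    then show "p ! x < p ! y" using cell cg(4)[of x y] N_def by auto
  next
    fix i j x y assume *: "i \<in> {1..m}" "j \<in> {1..n}" "M i j = - 1" "in_cell p v h (i, j) x \<and> in_cell p v h (i, j) y \<and> x < y"
    then have "\<not> p ! x < p ! y" "x < N" "y < N" "x \<noteq> y" using cell cg(4)[of x y] N_def by auto
    then show "p ! y < p ! x" using is_perm_nth_eq[OF p, of x y] N_def by auto
  qed
  moreover have "\<forall>x<length p. in_cell p v h (cc x) x" using cell[of "fst (cc x)" "snd (cc x)" x for x] E N_def by auto
  ultimately show thesis using that by blast
qed

definition cell_coil ::
  "(nat \<Rightarrow> nat \<Rightarrow> int) \<Rightarrow> nat \<Rightarrow> nat \<Rightarrow> (nat \<Rightarrow> int) \<Rightarrow> (nat \<Rightarrow> int) \<Rightarrow> nat list \<Rightarrow>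
    (nat \<Rightarrow> nat \<times> nat) \<Rightarrow> (nat \<Rightarrow> nat) \<Rightarrow> (nat \<Rightarrow> nat \<times> nat) \<Rightarrow> bool" where
  "cell_coil M m n c r p cc w lab \<longleftrightarrow>
     (let l = card (nonzero_cells M m n); N = length p; arr = cell_arrow c r p cc in
      is_perm p \<and> cell_gridding M m n p cc \<and> N > l \<and>
      bij_betw w {1..N} {0..<N} \<and>
      bij_betw lab {1..l} (nonzero_cells M m n) \<and>
      (\<forall>i\<in>{1..N}. cc (w i) = lab ((i - 1) mod l + 1)) \<and>
      (\<forall>i. 1 < i \<and> i \<le> N \<longrightarrow> arr (w (i - 1)) (w i)) \<and>
      (\<forall>i. l + 1 < i \<and> i \<le> N \<longrightarrow> arr (w i) (w (i - l - 1))) \<and>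
      arr (w (l + 1)) (w 1))"

lemma cell_coilI:
  assumes "gridded_coil M m n c r p v h w lab" and gm: "gridding_matrix M m n" and l: "0 < card (nonzero_cells M m n)"
  shows "\<exists>cc. cell_coil M m n c r p cc w lab"
proof -
  define l where "l = card (nonzero_cells M m n)"
  note gc = assms(1)[unfolded gridded_coil_def Let_def, folded l_def]
  have g: "is_gridding M m n p v h" using gc by blast
  obtain cc where cc: "cell_gridding M m n p cc" "\<forall>x<length p. in_cell p v h (cc x) x" using gridding_cells[OF gm g] by blast
  note cg = cell_griddingD[OF cc(1)]
  have arr: "orient_arrow m n c r p v h x y \<longleftrightarrow> cell_arrow c r p cc x y" for x y
    by (rule orient_arrow_cell_arrow[OF g cc(2)]) (use cg(1) in blast)
  have "cc (w i) = lab ((i - 1) mod l + 1)" if i: "i \<in> {1..length p}" for i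
  proof -
    have v: "\<forall>i<m. v i \<le> v (Suc i)" and h: "\<forall>j<n. h j \<le> h (Suc j)" using g unfolding is_gridding_def by blast+
    have "w i < length p" using gc i unfolding bij_betw_def by auto
    then have 1: "in_cell p v h (cc (w i)) (w i)" "cc (w i) \<in> nonzero_cells M m n" using cc cg(1) by auto
    have 2: "in_cell p v h (lab ((i - 1) mod l + 1)) (w i)" using gc i by blast
    have "(i - 1) mod l + 1 \<in> {1..l}" using l unfolding l_def by (simp add: Suc_le_eq)
    then have 3: "lab ((i - 1) mod l + 1) \<in> nonzero_cells M m n" using gc unfolding bij_betw_def by blast
    let ?a = "cc (w i)" and ?b = "lab ((i - 1) mod l + 1)"
    have R: "fst ?a \<in> {1..m}" "snd ?a \<in> {1..n}" "fst ?b \<in> {1..m}" "snd ?b \<in> {1..n}"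
      using 1(2) 3 unfolding nonzero_cells_def by (auto split: prod.splits)
    have "fst ?a = fst ?b"
      using lines_le[OF v R(1,3), of "w i" "w i"] lines_le[OF v R(3,1), of "w i" "w i"] 1(1) 2
      unfolding in_cell_def in_col_def by simp
    moreover have "snd ?a = snd ?b"
      using lines_le[OF h R(2,4), of "p ! w i" "p ! w i"] lines_le[OF h R(4,2), of "p ! w i" "p ! w i"] 1(1) 2
      unfolding in_cell_def in_row_def by simp
    ultimately show ?thesis by (simp add: prod_eq_iff)
  qed
  note cw = this
  have "is_perm p" using g unfolding is_gridding_def by blast
  then have "cell_coil M m n c r p cc w lab"
    unfolding cell_coil_def Let_def l_def[symmetric] arr[symmetric] using gc cc(1) cw by (intro conjI ballI) blast+
  then show ?thesis by blast
qed

lemma gridded_coilI: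
  assumes "cell_coil M m n c r p cc w lab"
  shows "\<exists>v h. gridded_coil M m n c r p v h w lab"
proof -
  note gc = assms[unfolded cell_coil_def Let_def]
  have p: "is_perm p" and cg: "cell_gridding M m n p cc" using gc by blast+
  obtain v h where g: "is_gridding M m n p v h" and cc: "\<forall>x<length p. in_cell p v h (cc x) x"
    using cells_gridding[OF p cg] by blast
  have arr: "orient_arrow m n c r p v h x y \<longleftrightarrow> cell_arrow c r p cc x y" for x y
    by (rule orient_arrow_cell_arrow[OF g cc]) (use cell_griddingD(1)[OF cg] in blast)
  have "in_cell p v h (lab ((i - 1) mod card (nonzero_cells M m n) + 1)) (w i)" if i: "i \<in> {1..length p}" for i
  proof -
    have "w i < length p" using gc i unfolding bij_betw_def by auto
    then show ?thesis using cc gc i by metis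
  qed
  note cw = this
  have "gridded_coil M m n c r p v h w lab"
    unfolding gridded_coil_def Let_def arr using gc g cw by (intro conjI ballI) blast+
  then show ?thesis by blast
qed

section \<open>Arrows and the cyclic order of the non-zero cells\<close>

locale cycle_matrix =
  fixes M :: "nat \<Rightarrow> nat \<Rightarrow> int" and m n :: nat and c r :: "nat \<Rightarrow> int"
  assumes gm: "gridding_matrix M m n"
    and pm: "partial_mult_matrix_wrt M m n c r"
    and rc: "rc_graph_is_cycle M m n"
begin

abbreviation "E \<equiv> nonzero_cells M m n"
abbreviation "l \<equiv> card E"

lemma cellD: "e \<in> E \<Longrightarrow> fst e \<in> {1..m}" "e \<in> E \<Longrightarrow> snd e \<in> {1..n}" "e \<in> E \<Longrightarrow> M (fst e) (snd e) \<noteq> 0"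
  "e \<in> E \<Longrightarrow> M (fst e) (snd e) = c (fst e) * r (snd e)"
  "e \<in> E \<Longrightarrow> c (fst e) \<in> {-1, 1}" "e \<in> E \<Longrightarrow> r (snd e) \<in> {-1, 1}"
  using pm unfolding nonzero_cells_def partial_mult_matrix_wrt_def by (auto split: prod.splits)

lemma finite_E: "finite E"
  by (rule finite_subset[of _ "{1..m} \<times> {1..n}"]) (auto simp: nonzero_cells_def)

text \<open>Two points of one cell also share its row. There the factorisation \<open>c * r\<close>
  of the entry makes the row orientation agree with that of the column.\<close>

lemma arrow_col:
  assumes p: "is_perm p" and cg: "cell_gridding M m n p cc" and xy: "x < length p" "y < length p" and col: "fst (cc x) = fst (cc y)"
  shows "cell_arrow c r p cc x y \<longleftrightarrow> (if c (fst (cc x)) = 1 then x < y else y < x)"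
proof (cases "snd (cc x) = snd (cc y) \<and> x \<noteq> y")
  case True
  then have eq: "cc x = cc y" using col by (simp add: prod_eq_iff)
  note cg = cell_griddingD[OF cg]
  have e: "cc x \<in> E" using cg(1) xy by blast
  have M1: "M (fst (cc x)) (snd (cc x)) = 1 \<longleftrightarrow> c (fst (cc x)) = r (snd (cc x))"
    using cellD(4-6)[OF e] by auto
  have "p ! x \<noteq> p ! y" using is_perm_nth_eq[OF p] xy True by blast
  then show ?thesis
    using cg(4)[of x y] cg(4)[of y x] eq True M1 cellD(5,6)[OF e] xy unfolding cell_arrow_def
    by (cases x y rule: linorder_cases) (auto split: if_splits)
next
  case False
  then show ?thesis using xy col unfolding cell_arrow_def by auto
qed

lemma arrow_row:
  assumes p: "is_perm p" and cg: "cell_gridding M m n p cc" and xy: "x < length p" "y < length p" and row: "snd (cc x) = snd (cc y)"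
  shows "cell_arrow c r p cc x y \<longleftrightarrow> (if r (snd (cc x)) = 1 then p ! x < p ! y else p ! y < p ! x)"
proof (cases "fst (cc x) = fst (cc y) \<and> x \<noteq> y")
  case True
  then have eq: "cc x = cc y" using row by (simp add: prod_eq_iff)
  have a: "cell_arrow c r p cc x y \<longleftrightarrow> (if c (fst (cc x)) = 1 then x < y else y < x)"
    using arrow_col[OF p cg xy] True by blast
  note cg = cell_griddingD[OF cg]
  have e: "cc x \<in> E" using cg(1) xy by blast
  have M1: "M (fst (cc x)) (snd (cc x)) = 1 \<longleftrightarrow> c (fst (cc x)) = r (snd (cc x))"
    using cellD(4-6)[OF e] by auto
  have "p ! x \<noteq> p ! y" using is_perm_nth_eq[OF p] xy True by blast
  then show ?thesis
    using cg(4)[of x y] cg(4)[of y x] eq True M1 cellD(5,6)[OF e] xy unfolding a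
    by (cases x y rule: linorder_cases) (auto split: if_splits)
next
  case False
  then show ?thesis using xy row unfolding cell_arrow_def by auto
qed

text \<open>A numbering of the cells along the cycle.\<close>

definition cyclic_numbering :: "(nat \<Rightarrow> nat \<times> nat) \<Rightarrow> bool" where
  "cyclic_numbering lab \<longleftrightarrow> 3 \<le> l \<and> bij_betw lab {..<l} E \<and>
    (\<forall>a<l. \<forall>b<l. near l a b \<longleftrightarrow> fst (lab a) = fst (lab b) \<or> snd (lab a) = snd (lab b))"

lemma cyc_gridded:
  assumes p: "is_perm p" and cg: "cell_gridding M m n p cc"
    and lab: "cyclic_numbering lab" and g: "\<And>x. x < length p \<Longrightarrow> g x < l \<and> lab (g x) = cc x"
  shows "cyc l {..<length p} g (cell_arrow c r p cc)"
proof
  have near: "near l (g x) (g y) \<longleftrightarrow> fst (cc x) = fst (cc y) \<or> snd (cc x) = snd (cc y)" if "x < length p" "y < length p" for x y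
    using lab g that unfolding cyclic_numbering_def by metis
  show "3 \<le> l" using lab unfolding cyclic_numbering_def by blast
  show "finite {..<length p}" by simp
  show "g x < l" if "x \<in> {..<length p}" for x using g that by simp
  show "near l (g x) (g y)" if "x \<in> {..<length p}" "y \<in> {..<length p}" "cell_arrow c r p cc x y" for x y
    using near[of x y] that unfolding cell_arrow_def by auto
  show "\<not> cell_arrow c r p cc x x" if "x \<in> {..<length p}" for x unfolding cell_arrow_def by simp
  show "cell_arrow c r p cc x y \<or> cell_arrow c r p cc y x"
    if xy: "x \<in> {..<length p}" "y \<in> {..<length p}" "x \<noteq> y" "near l (g x) (g y)" for x y
  proof -
    have x: "x < length p" and y: "y < length p" using xy by auto
    have ne: "p ! x < p ! y \<or> p ! y < p ! x" "x < y \<or> y < x" using is_perm_nth_eq[OF p x y] xy(3) by linarith+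
    have "fst (cc x) = fst (cc y) \<or> snd (cc x) = snd (cc y)" using near[OF x y] xy(4) by blast
    then show ?thesis
    proof
      assume e: "fst (cc x) = fst (cc y)"
      show ?thesis unfolding arrow_col[OF p cg x y e] arrow_col[OF p cg y x e[symmetric]] using e ne by metis
    next
      assume e: "snd (cc x) = snd (cc y)"
      show ?thesis unfolding arrow_row[OF p cg x y e] arrow_row[OF p cg y x e[symmetric]] using e ne by metis
    qed
  qed
  show "cell_arrow c r p cc x z" if xyz: "x \<in> {..<length p}" "y \<in> {..<length p}" "z \<in> {..<length p}"
    and gs: "g x \<in> {a, Suc a mod l}" "g y \<in> {a, Suc a mod l}" "g z \<in> {a, Suc a mod l}"
    and R: "cell_arrow c r p cc x y" "cell_arrow c r p cc y z" for x y z a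
  proof -
    have l0: "3 \<le> l" and "bij_betw lab {..<l} E" using lab unfolding cyclic_numbering_def by blast+
    have "(fst (cc x) = fst (cc y) \<and> fst (cc y) = fst (cc z)) \<or> (snd (cc x) = snd (cc y) \<and> snd (cc y) = snd (cc z))"
    proof (cases "a < l")
      case True
      have "near l a (Suc a mod l)" unfolding near_def by simp
      then have "fst (lab a) = fst (lab (Suc a mod l)) \<or> snd (lab a) = snd (lab (Suc a mod l))"
        using lab True l0 unfolding cyclic_numbering_def by (metis mod_less_divisor less_le_trans zero_less_numeral)
      moreover have "cc w \<in> {lab a, lab (Suc a mod l)}" if "w \<in> {..<length p}" "g w \<in> {a, Suc a mod l}" for w
        using g[of w] that by auto
      then have "cc x \<in> {lab a, lab (Suc a mod l)}" "cc y \<in> {lab a, lab (Suc a mod l)}" "cc z \<in> {lab a, lab (Suc a mod l)}"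
        using xyz gs by blast+
      ultimately show ?thesis by auto
    next
      \<comment> \<open>The locale allows any \<open>a\<close>; if it is not the number of a cell,
        all three points lie in the single cell \<open>Suc a mod l\<close>.\<close>
      case False
      then have "g w = Suc a mod l" if "w \<in> {..<length p}" "g w \<in> {a, Suc a mod l}" for w using g[of w] that by auto
      then have "cc x = lab (Suc a mod l)" "cc y = lab (Suc a mod l)" "cc z = lab (Suc a mod l)"
        using xyz gs g by (metis lessThan_iff)+
      then show ?thesis by simp
    qed
    then show ?thesis
    proof
      assume "fst (cc x) = fst (cc y) \<and> fst (cc y) = fst (cc z)"
      then show ?thesis using arrow_col[OF p cg, of x y] arrow_col[OF p cg, of y z] arrow_col[OF p cg, of x z] R xyz
        by (auto split: if_splits)
    next
      assume "snd (cc x) = snd (cc y) \<and> snd (cc y) = snd (cc z)"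
      then show ?thesis using arrow_row[OF p cg, of x y] arrow_row[OF p cg, of y z] arrow_row[OF p cg, of x z] R xyz
        by (auto split: if_splits)
    qed
  qed
qed

text \<open>Points in a common column are ordered by their arcs, points in different columns by the
  column numbers, and likewise for rows. Embeddings of labelled digraphs preserve both kinds of
  data.\<close>

lemma emb_perm_le:
  assumes p: "is_perm p" "cell_gridding M m n p cc" and p': "is_perm p'" "cell_gridding M m n p' cc'"
    and g: "\<And>x. x < length p \<Longrightarrow> lab (g x) = cc x" "\<And>x. x < length p' \<Longrightarrow> lab (g' x) = cc' x"
    and e: "emb ({..<length p}, g, cell_arrow c r p cc) ({..<length p'}, g', cell_arrow c r p' cc')"
  shows "perm_le p p'"
proof -
  obtain f where "emb_via f ({..<length p}, g, cell_arrow c r p cc) ({..<length p'}, g', cell_arrow c r p' cc')"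
    using e unfolding emb_def by blast
  note f = emb_viaD[OF this, unfolded lessThan_iff]
  have cc: "cc' (f x) = cc x" if "x < length p" for x using f(1,2)[OF that] g that by metis
  note cg = cell_griddingD[OF p(2)] and cg' = cell_griddingD[OF p'(2)]
  show ?thesis unfolding perm_le_def
  proof (intro exI[of _ f] conjI allI impI)
    show "f x < length p'" if "x < length p" for x using f(1) that by blast
    show "f x < f y" if xy: "x < y \<and> y < length p" for x y
    proof (cases "fst (cc x) = fst (cc y)")
      case True
      have "x < length p" using xy by simp
      then show ?thesis
        using arrow_col[OF p, of x y] arrow_col[OF p, of y x] arrow_col[OF p', of "f x" "f y"] arrow_col[OF p', of "f y" "f x"]
          f(1)[of x] f(1)[of y] f(4)[of x y] f(4)[of y x] cc[of x] cc[of y] True xy by (auto split: if_splits)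
    next
      case False
      have x: "x < length p" using xy by simp
      have "fst (cc' (f x)) < fst (cc' (f y))" using False cg(2)[of x y] xy cc[of x] cc[of y] by simp
      moreover have "f y < f x \<Longrightarrow> fst (cc' (f y)) \<le> fst (cc' (f x))" using cg'(2)[of "f y" "f x"] f(1)[OF x] by blast
      ultimately show ?thesis by (metis not_le linorder_neqE_nat less_irrefl)
    qed
    show "p ! x < p ! y \<longleftrightarrow> p' ! f x < p' ! f y" if x: "x < length p" and y: "y < length p" for x y
    proof (cases "snd (cc x) = snd (cc y)")
      case True
      then show ?thesis
        using arrow_row[OF p, of x y] arrow_row[OF p, of y x] arrow_row[OF p', of "f x" "f y"] arrow_row[OF p', of "f y" "f x"]
          f(1)[OF x] f(1)[OF y] f(4)[OF x y] f(4)[OF y x] cc[OF x] cc[OF y] x y by (auto split: if_splits)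
    next
      case False
      have 1: "p ! x < p ! y \<longleftrightarrow> snd (cc x) < snd (cc y)"
        using cg(3)[OF x y] cg(3)[OF y x] False is_perm_nth_eq[OF p(1) x y] by (metis le_less less_asym linorder_neqE_nat)
      have 2: "p' ! f x < p' ! f y \<longleftrightarrow> snd (cc' (f x)) < snd (cc' (f y))"
        using cg'(3)[OF f(1)[OF x] f(1)[OF y]] cg'(3)[OF f(1)[OF y] f(1)[OF x]] False cc[OF x] cc[OF y]
          is_perm_nth_eq[OF p'(1) f(1)[OF x] f(1)[OF y]] by (metis le_less less_asym linorder_neqE_nat)
      show ?thesis using 1 2 cc x y by simp
    qed
  qed
qed

text \<open>Degree 2 in the row-column graph means two non-zero cells in every row and column, so a
  cell has exactly one neighbour in each direction.\<close>

definition col_mate :: "nat \<times> nat \<Rightarrow> nat \<times> nat" where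
  "col_mate e = (THE e'. e' \<in> E \<and> fst e' = fst e \<and> e' \<noteq> e)"

definition row_mate :: "nat \<times> nat \<Rightarrow> nat \<times> nat" where
  "row_mate e = (THE e'. e' \<in> E \<and> snd e' = snd e \<and> e' \<noteq> e)"

lemma ex1_other: "card A = 2 \<Longrightarrow> x \<in> A \<Longrightarrow> \<exists>!y. y \<in> A \<and> y \<noteq> x"
  by (auto simp: card_2_iff)

lemma col_mate_ex1: 
  assumes "e \<in> E"
  shows "\<exists>!e'. e' \<in> E \<and> fst e' = fst e \<and> e' \<noteq> e"
proof -
  let ?i = "fst e"
  have i: "?i \<in> {1..m}" using cellD(1) assms by blast
  let ?A = "{w \<in> rc_vertices m n. rc_adj M m n (Inl ?i) w}"
  have "Inl ?i \<in> rc_vertices m n" using i unfolding rc_vertices_def by blast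
  then have "card ?A = 2" using rc unfolding rc_graph_is_cycle_def by blast
  moreover have "?A = Inr ` {j \<in> {1..n}. M ?i j \<noteq> 0}" using i unfolding rc_vertices_def by auto
  moreover have "{e' \<in> E. fst e' = ?i} = Pair ?i ` {j \<in> {1..n}. M ?i j \<noteq> 0}"
    using i unfolding nonzero_cells_def by auto
  ultimately have "card {e' \<in> E. fst e' = ?i} = 2" by (simp add: card_image inj_on_def)
  from ex1_other[OF this, of e] assms show ?thesis by auto
qed

lemma row_mate_ex1:
  assumes "e \<in> E"
  shows "\<exists>!e'. e' \<in> E \<and> snd e' = snd e \<and> e' \<noteq> e"
proof -
  let ?j = "snd e"
  have j: "?j \<in> {1..n}" using cellD(2) assms by blast
  let ?A = "{w \<in> rc_vertices m n. rc_adj M m n (Inr ?j) w}"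
  have "Inr ?j \<in> rc_vertices m n" using j unfolding rc_vertices_def by blast
  then have "card ?A = 2" using rc unfolding rc_graph_is_cycle_def by blast
  moreover have "?A = Inl ` {i \<in> {1..m}. M i ?j \<noteq> 0}" using j unfolding rc_vertices_def by auto
  moreover have "{e' \<in> E. snd e' = ?j} = (\<lambda>i. (i, ?j)) ` {i \<in> {1..m}. M i ?j \<noteq> 0}"
    using j unfolding nonzero_cells_def by auto
  ultimately have "card {e' \<in> E. snd e' = ?j} = 2" by (simp add: card_image inj_on_def)
  from ex1_other[OF this, of e] assms show ?thesis by auto
qed

lemma col_mate: "e \<in> E \<Longrightarrow> col_mate e \<in> E \<and> fst (col_mate e) = fst e \<and> col_mate e \<noteq> e"
  unfolding col_mate_def by (rule theI'[OF col_mate_ex1])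

lemma row_mate: "e \<in> E \<Longrightarrow> row_mate e \<in> E \<and> snd (row_mate e) = snd e \<and> row_mate e \<noteq> e"
  unfolding row_mate_def by (rule theI'[OF row_mate_ex1])

lemma col_mate_eq: "e \<in> E \<Longrightarrow> e' \<in> E \<Longrightarrow> fst e' = fst e \<Longrightarrow> e' \<noteq> e \<Longrightarrow> e' = col_mate e"
  using col_mate_ex1[of e] col_mate[of e] by blast

lemma row_mate_eq: "e \<in> E \<Longrightarrow> e' \<in> E \<Longrightarrow> snd e' = snd e \<Longrightarrow> e' \<noteq> e \<Longrightarrow> e' = row_mate e"
  using row_mate_ex1[of e] row_mate[of e] by blast

lemma col_mate_col_mate: "e \<in> E \<Longrightarrow> col_mate (col_mate e) = e"
  using col_mate_eq[of "col_mate e" e] col_mate[of e] by metis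

lemma row_mate_row_mate: "e \<in> E \<Longrightarrow> row_mate (row_mate e) = e"
  using row_mate_eq[of "row_mate e" e] row_mate[of e] by metis

text \<open>Connectedness of the row-column graph, expressed by cells.\<close>

lemma mates_closed:
  assumes A: "A \<subseteq> E" "A \<noteq> {}" "\<And>e. e \<in> A \<Longrightarrow> col_mate e \<in> A" "\<And>e. e \<in> A \<Longrightarrow> row_mate e \<in> A"
  shows "A = E"
proof
  show "E \<subseteq> A"
  proof
    fix e assume e: "e \<in> E"
    obtain a where a: "a \<in> A" using A by blast
    define S where "S = Inl ` fst ` A \<union> Inr ` snd ` A"
    have closed: "w \<in> S" if uw: "u \<in> S" "rc_adj M m n u w" for u w
    proof (cases u)
      case (Inl i)
      then obtain j where w: "w = Inr j" and ij: "(i, j) \<in> E" using uw Inl by (cases w) (auto simp: nonzero_cells_def)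
      obtain b where b: "b \<in> A" "fst b = i" using uw Inl unfolding S_def by auto
      then have "(i, j) = b \<or> (i, j) = col_mate b" using col_mate_eq[of b "(i, j)"] ij A(1) by auto
      then have "(i, j) \<in> A" using b(1) A(3)[OF b(1)] A(4)[OF b(1)] by metis
      then show ?thesis unfolding S_def w by force
    next
      case (Inr j)
      then obtain i where w: "w = Inl i" and ij: "(i, j) \<in> E" using uw Inr by (cases w) (auto simp: nonzero_cells_def)
      obtain b where b: "b \<in> A" "snd b = j" using uw Inr unfolding S_def by auto
      then have "(i, j) = b \<or> (i, j) = row_mate b" using row_mate_eq[of b "(i, j)"] ij A(1) by auto
      then have "(i, j) \<in> A" using b(1) A(3)[OF b(1)] A(4)[OF b(1)] by metis
      then show ?thesis unfolding S_def w by force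
    qed
    have "Inl (fst a) \<in> rc_vertices m n" "Inl (fst e) \<in> rc_vertices m n"
      using cellD(1) a A(1) e unfolding rc_vertices_def by blast+
    then have "(Inl (fst a), Inl (fst e)) \<in> {(a, b). rc_adj M m n a b}\<^sup>*" using rc unfolding rc_graph_is_cycle_def by blast
    then have "Inl (fst e) \<in> S"
    proof (induction rule: rtrancl_induct)
      case base
      then show ?case using a unfolding S_def by blast
    next
      case (step y z)
      have "rc_adj M m n y z" using step.hyps by simp
      with step.IH show ?case by (rule closed)
    qed
    then obtain b where b: "b \<in> A" "fst b = fst e" unfolding S_def by auto
    then have "e = b \<or> e = col_mate b" using col_mate_eq[of b e] e A(1) by auto
    then show "e \<in> A" using b(1) A(3)[OF b(1)] by metis
  qed
qed (rule A(1))

text \<open>Walk around the cycle, moving within the column and within the row alternately.\<close>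

fun walk :: "nat \<times> nat \<Rightarrow> nat \<Rightarrow> nat \<times> nat" where
  "walk e 0 = e"
| "walk e (Suc k) = (if even k then col_mate (walk e k) else row_mate (walk e k))"

declare walk.simps(2) [simp del]

lemmas walk_Suc = walk.simps(2)

lemma walk_E: "e \<in> E \<Longrightarrow> walk e k \<in> E"
  by (induction k) (auto simp: walk_Suc col_mate row_mate)

lemma walk_Suc_back: "e \<in> E \<Longrightarrow> walk e k = (if even k then col_mate (walk e (Suc k)) else row_mate (walk e (Suc k)))"
  using col_mate_col_mate[OF walk_E] row_mate_row_mate[OF walk_E] by (simp add: walk_Suc)

lemma walk_neq_Suc: "e \<in> E \<Longrightarrow> walk e (Suc k) \<noteq> walk e k"
  using col_mate[OF walk_E] row_mate[OF walk_E] by (simp add: walk_Suc)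

lemma walk_shift: "e \<in> E \<Longrightarrow> even a = even b \<Longrightarrow> walk e (a + k) = walk e (b + k) \<longleftrightarrow> walk e a = walk e b"
proof (induction k)
  case (Suc k)
  have "walk e (Suc (a + k)) = walk e (Suc (b + k)) \<longleftrightarrow> walk e (a + k) = walk e (b + k)"
    using walk_Suc_back[of e "a + k"] walk_Suc_back[of e "b + k"] Suc.prems by (metis even_add walk_Suc)
  then show ?case using Suc by simp
qed simp

text \<open>With different parities, the step forward from \<open>a\<close> and the step back from
  \<open>b\<close> use the same kind of mate. So a coincidence would propagate inwards until it
  concerned two consecutive cells, which differ.\<close>

lemma walk_reflect: "e \<in> E \<Longrightarrow> even a \<noteq> even b \<Longrightarrow> a < b \<Longrightarrow> walk e a \<noteq> walk e b"
proof (induction "b - a" arbitrary: a b rule: less_induct)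
  case less
  show ?case
  proof (cases "b = Suc a")
    case True
    then show ?thesis using walk_neq_Suc[OF less.prems(1)] by metis
  next
    case False
    obtain b' where b': "b = Suc b'" using less.prems by (cases b) auto
    have par: "even b' = even a" using less.prems b' by auto
    then have "b' \<noteq> Suc a" by auto
    then have lt: "Suc a < b'" using less.prems False b' by linarith
    have "walk e (Suc a) \<noteq> walk e b'" using less.hyps[of b' "Suc a"] less.prems par lt b' by auto
    moreover have "walk e b' = (if even b' then col_mate (walk e b) else row_mate (walk e b))"
      using walk_Suc_back[OF less.prems(1), of b'] b' by simp
    moreover have "walk e (Suc a) = (if even a then col_mate (walk e a) else row_mate (walk e a))" by (rule walk_Suc)
    ultimately show ?thesis using par by metis
  qed
qed

text \<open>The walk is numbered up to its least even period \<open>L\<close>. Parity matters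
  because only indices of equal parity continue by the same kind of mate; coincidences at odd
  distance are excluded by \<open>walk_reflect\<close>.\<close>

lemma ex_cyclic_numbering:
  assumes "E \<noteq> {}"
  shows "\<exists>lab. cyclic_numbering lab"
proof -
  obtain e where e: "e \<in> E" using assms by blast
  have "\<not> inj (\<lambda>k. walk e (2 * k))"
    using finite_imageD[of "\<lambda>k. walk e (2 * k)" UNIV] finite_subset[OF _ finite_E, of "range (\<lambda>k. walk e (2 * k))"]
      walk_E[OF e] infinite_UNIV_nat by blast
  then obtain a b where ab: "a < b" "walk e (2 * a) = walk e (2 * b)" unfolding inj_def by (metis nat_neq_iff)
  have "walk e (0 + 2 * a) = walk e (2 * (b - a) + 2 * a) \<longleftrightarrow> walk e 0 = walk e (2 * (b - a))"
    by (rule walk_shift[OF e]) simp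
  moreover have "2 * (b - a) + 2 * a = 2 * b" using ab by simp
  ultimately have per: "walk e (2 * (b - a)) = e" using ab by simp
  define L where "L = (LEAST k. 0 < k \<and> even k \<and> walk e k = e)"
  have L: "0 < L \<and> even L \<and> walk e L = e" unfolding L_def
    by (rule LeastI[of _ "2 * (b - a)"]) (use per ab in auto)
  have Lmin: "L \<le> k" if "0 < k" "even k" "walk e k = e" for k unfolding L_def using that by (intro Least_le) blast
  have inj: "inj_on (walk e) {..<L}"
  proof (rule linorder_inj_onI)
    fix a b assume ab: "a < b" "a \<in> {..<L}" "b \<in> {..<L}"
    show "walk e a \<noteq> walk e b"
    proof (cases "even a = even b")
      case True
      have "walk e (0 + a) = walk e (b - a + a) \<longleftrightarrow> walk e 0 = walk e (b - a)"
        by (rule walk_shift[OF e]) (use ab True in auto)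
      then show ?thesis using Lmin[of "b - a"] ab True by auto
    next
      case False
      then show ?thesis using walk_reflect[OF e] ab by blast
    qed
  qed auto
  have wL: "walk e (k + L) = walk e k" for k
    using walk_shift[OF e, of L 0 k] L by (metis add.commute add_0 even_zero walk.simps(1))
  have wm: "walk e k = walk e (k mod L)" for k
  proof (induction k rule: less_induct)
    case (less k)
    show ?case
    proof (cases "k < L")
      case False
      then have "walk e k = walk e (k - L)" using wL[of "k - L"] by simp
      then show ?thesis using less[of "k - L"] False L by (simp add: le_mod_geq)
    qed simp
  qed
  have mate: "col_mate (walk e k) = (if even k then walk e (Suc k) else walk e (k + L - 1))"
    "row_mate (walk e k) = (if even k then walk e (k + L - 1) else walk e (Suc k))" for k
  proof -
    obtain j where j: "k + L = Suc j" using L by (cases L) auto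
    then have "even j \<longleftrightarrow> odd k" using L by (metis even_Suc even_add)
    then show "col_mate (walk e k) = (if even k then walk e (Suc k) else walk e (k + L - 1))"
      "row_mate (walk e k) = (if even k then walk e (k + L - 1) else walk e (Suc k))"
      using walk_Suc_back[OF e, of j] wL[of k] j walk_Suc[of e k] by (auto split: if_splits)
  qed
  have img: "walk e ` {..<L} = E"
  proof (rule mates_closed)
    show "walk e ` {..<L} \<subseteq> E" using walk_E[OF e] by auto
    show "walk e ` {..<L} \<noteq> {}" using L by (auto simp: lessThan_empty_iff)
    have "walk e k \<in> walk e ` {..<L}" for k using wm[of k] L by (metis imageI lessThan_iff mod_less_divisor)
    then show "col_mate x \<in> walk e ` {..<L}" "row_mate x \<in> walk e ` {..<L}" if "x \<in> walk e ` {..<L}" for x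
      using that mate by auto
  qed
  have Ll: "L = l" using card_image[OF inj] img by simp
  have "L \<noteq> 2"
  proof
    assume "L = 2"
    then have eq: "row_mate (col_mate e) = e" using L by (simp add: numeral_2_eq_2 walk_Suc)
    have "fst (col_mate e) = fst e" "snd (row_mate (col_mate e)) = snd (col_mate e)" "col_mate e \<noteq> e"
      using col_mate[OF e] row_mate[of "col_mate e"] by auto
    then show False using eq by (simp add: prod_eq_iff)
  qed
  moreover have "L \<noteq> 0" "L \<noteq> 1" using L by auto
  ultimately have l3: "3 \<le> l" using Ll by linarith
  have weq: "walk e a = walk e b \<longleftrightarrow> a mod L = b mod L" for a b
  proof
    assume "walk e a = walk e b"
    then have "walk e (a mod L) = walk e (b mod L)" using wm by metis
    then show "a mod L = b mod L" using inj_onD[OF inj, of "a mod L" "b mod L"] L by simp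
  qed (metis wm)
  have near: "near l a b \<longleftrightarrow> fst (walk e a) = fst (walk e b) \<or> snd (walk e a) = snd (walk e b)" if "a < l" "b < l" for a b
  proof -
    have f: "fst (walk e a) = fst (walk e b) \<longleftrightarrow> walk e b = walk e a \<or> walk e b = col_mate (walk e a)"
      using col_mate_eq[OF walk_E[OF e, of a] walk_E[OF e, of b]] col_mate[OF walk_E[OF e], of a] by metis
    have s: "snd (walk e a) = snd (walk e b) \<longleftrightarrow> walk e b = walk e a \<or> walk e b = row_mate (walk e a)"
      using row_mate_eq[OF walk_E[OF e, of a] walk_E[OF e, of b]] row_mate[OF walk_E[OF e], of a] by metis
    have "(walk e b = walk e (a + L - 1)) \<longleftrightarrow> Suc b mod L = a mod L"
    proof -
      have "b mod L = (a + L - 1) mod L \<longleftrightarrow> Suc b mod L = Suc (a + L - 1) mod L"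
        using mod_add_left_eq_iff[of 1 b L "a + L - 1"] by simp
      then show ?thesis using weq L by simp
    qed
    moreover have "walk e b = walk e (Suc a) \<longleftrightarrow> Suc a mod L = b mod L" using weq by metis
    moreover have "walk e b = walk e a \<longleftrightarrow> a mod L = b mod L" using weq by metis
    ultimately show ?thesis unfolding f s mate near_def Ll[symmetric] by auto
  qed
  have "cyclic_numbering (walk e)" unfolding cyclic_numbering_def bij_betw_def
    using l3 inj img near Ll by simp
  then show ?thesis by blast
qed

end

section \<open>Patterns and inflations\<close>

definition pattern_emb :: "nat list \<Rightarrow> nat list \<Rightarrow> (nat \<Rightarrow> nat) \<Rightarrow> bool" where
  "pattern_emb s p f \<longleftrightarrow> (\<forall>i j. i < j \<and> j < length s \<longrightarrow> f i < f j)
      \<and> (\<forall>i < length s. f i < length p)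
      \<and> (\<forall>i < length s. \<forall>j < length s. s!i < s!j \<longleftrightarrow> p!(f i) < p!(f j))"

lemma perm_le_iff: "perm_le s p \<longleftrightarrow> (\<exists>f. pattern_emb s p f)"
  unfolding perm_le_def pattern_emb_def ..

lemma pattern_embD:
  assumes "pattern_emb s p f"
  shows "i < j \<Longrightarrow> j < length s \<Longrightarrow> f i < f j" "i < length s \<Longrightarrow> f i < length p"
    "i < length s \<Longrightarrow> j < length s \<Longrightarrow> s ! i < s ! j \<longleftrightarrow> p ! (f i) < p ! (f j)"
  using assms unfolding pattern_emb_def by auto

text \<open>The point of p from which position i of the inflation at x originates.\<close>

definition collapse :: "nat \<Rightarrow> nat \<Rightarrow> nat" where
  "collapse x i = (if i \<le> x then i else i - 1)"

lemma length_inflate [simp]: "x < length p \<Longrightarrow> length (inflate p x inc) = Suc (length p)"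
  unfolding inflate_def Let_def by simp

lemma inflate_nth:
  assumes "x < length p" "i < Suc (length p)"
  shows "inflate p x inc ! i = (if i = x then p ! x + (if inc then 0 else 1)
    else if i = Suc x then p ! x + (if inc then 1 else 0)
    else if p ! x < p ! collapse x i then p ! collapse x i + 1 else p ! collapse x i)"
proof -
  consider "i < x" | "i = x" | "i = Suc x" | k where "i = Suc (Suc (x + k))"
    by (metis add_Suc_right less_iff_Suc_add linorder_neqE_nat not_less_less_Suc_eq)
  then show ?thesis
  proof cases
    case 1
    then show ?thesis using assms unfolding inflate_def Let_def collapse_def by (simp add: nth_append)
  next
    case 2
    then show ?thesis using assms unfolding inflate_def Let_def collapse_def by (simp add: nth_append)
  next
    case 3
    then show ?thesis using assms unfolding inflate_def Let_def collapse_def by (simp add: nth_append)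
  next
    case 4
    then show ?thesis using assms unfolding inflate_def Let_def collapse_def by (simp add: nth_append)
  qed
qed

lemma collapse_less: "x < N \<Longrightarrow> i < Suc N \<Longrightarrow> collapse x i < N"
  unfolding collapse_def by auto

lemma collapse_mono: "i \<le> j \<Longrightarrow> collapse x i \<le> collapse x j"
  unfolding collapse_def by auto

lemma collapse_eq: "collapse x i = collapse x j \<Longrightarrow> i < j \<Longrightarrow> i = x \<and> j = Suc x"
  unfolding collapse_def by (auto split: if_splits)

lemma inflate_less:
  assumes p: "distinct p" and x: "x < length p" and ij: "i < Suc (length p)" "j < Suc (length p)"
    and ne: "collapse x i \<noteq> collapse x j"
  shows "inflate p x inc ! i < inflate p x inc ! j \<longleftrightarrow> p ! collapse x i < p ! collapse x j"
proof -
  have cx: "collapse x x = x" "collapse x (Suc x) = x" unfolding collapse_def by auto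
  have "p ! x \<noteq> p ! k" if "k \<noteq> x" "k < length p" for k using p x that nth_eq_iff_index_eq by metis
  then have "p ! x \<noteq> p ! collapse x i \<or> collapse x i = x" "p ! x \<noteq> p ! collapse x j \<or> collapse x j = x"
    using collapse_less[OF x] ij by metis+
  then show ?thesis using ne cx unfolding inflate_nth[OF x ij(1)] inflate_nth[OF x ij(2)]
    by (auto split: if_splits)
qed

lemma inflate_pair: "x < length p \<Longrightarrow> inflate p x inc ! x < inflate p x inc ! Suc x \<longleftrightarrow> inc"
  "x < length p \<Longrightarrow> inflate p x inc ! Suc x < inflate p x inc ! x \<longleftrightarrow> \<not> inc"
  by (auto simp: inflate_nth)

lemma inflate_is_perm:
  assumes p: "is_perm p" and x: "x < length p"
  shows "is_perm (inflate p x inc)"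
proof -
  let ?q = "inflate p x inc"
  have d: "distinct p" using p unfolding is_perm_def by blast
  have ne: "?q ! i \<noteq> ?q ! j" if ij: "i < j" "j < Suc (length p)" for i j
  proof (cases "collapse x i = collapse x j")
    case True
    then have "i = x" "j = Suc x" using collapse_eq ij by blast+
    then show ?thesis using inflate_pair[OF x, of inc] by (metis less_irrefl)
  next
    case False
    have "p ! collapse x i \<noteq> p ! collapse x j"
      using d False collapse_less[OF x, of i] collapse_less[OF x, of j] ij nth_eq_iff_index_eq by fastforce
    then show ?thesis
      using inflate_less[OF d x _ _ False, of inc] inflate_less[OF d x _ _ False[symmetric], of inc] ij
      by (metis Suc_lessD less_SucI less_trans_Suc linorder_neqE_nat less_irrefl less_trans)
  qed
  have "distinct ?q" unfolding distinct_conv_nth using ne x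
    by (metis length_inflate linorder_neqE_nat)
  moreover have "set ?q \<subseteq> {0..<length ?q}"
  proof
    fix y assume "y \<in> set ?q"
    then obtain i where i: "i < Suc (length p)" "y = ?q ! i" using x by (metis in_set_conv_nth length_inflate)
    have "p ! x < length p" "p ! collapse x i < length p"
      using is_perm_nth_less[OF p] x collapse_less[OF x i(1)] by auto
    then show "y \<in> {0..<length ?q}" using i x inflate_nth[OF x i(1), of inc] by auto
  qed
  ultimately show ?thesis unfolding is_perm_def
    by (metis card_atLeastLessThan card_subset_eq diff_zero distinct_card finite_atLeastLessThan)
qed

text \<open>The pair that replaces \<open>x\<close> goes to \<open>f x\<close> and \<open>t\<close>,
  taken from left to right. As \<open>t\<close> lies on the same sides of all other points as
  \<open>f x\<close>, no other comparison changes.\<close>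

lemma pattern_emb_inflate:
  assumes p: "is_perm p" and q: "is_perm q" and f: "pattern_emb q p f" and x: "x < length q" and t: "t < length p" "t \<noteq> f x"
    and tw: "\<And>i. i < length q \<Longrightarrow> i \<noteq> x \<Longrightarrow> t \<noteq> f i \<and> (t < f i \<longleftrightarrow> f x < f i) \<and> (p ! t < p ! f i \<longleftrightarrow> p ! f x < p ! f i)"
    and inc: "inc \<longleftrightarrow> (f x < t \<longleftrightarrow> p ! f x < p ! t)"
  defines "f' \<equiv> \<lambda>i. if i = x then min (f x) t else if i = Suc x then max (f x) t else f (collapse x i)"
  shows "pattern_emb (inflate q x inc) p f'"
proof -
  note fD = pattern_embD[OF f]
  let ?q = "inflate q x inc"
  have len: "length ?q = Suc (length q)" using x by simp
  have d: "distinct q" using q unfolding is_perm_def by blast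
  have cx: "collapse x x = x" "collapse x (Suc x) = x" unfolding collapse_def by auto
  have cne: "collapse x i \<noteq> x" if "i \<noteq> x" "i \<noteq> Suc x" for i using that unfolding collapse_def by auto
  have pt: "p ! t \<noteq> p ! f x" using is_perm_nth_eq[OF p t(1) fD(2)[OF x]] t(2) by blast
  have f': "f' i \<in> (if collapse x i = x then {f x, t} else {f (collapse x i)})" for i
    unfolding f'_def using cx cne by (auto simp: min_def max_def)
  have twv: "p ! f i < p ! t \<longleftrightarrow> p ! f i < p ! f x" "f i < t \<longleftrightarrow> f i < f x" if i: "i < length q" "i \<noteq> x" for i
  proof -
    have fne: "f i \<noteq> f x" using fD(1)[of i x] fD(1)[of x i] i x by (metis linorder_neqE_nat less_irrefl)
    have "p ! f i \<noteq> p ! t" using is_perm_nth_eq[OF p fD(2)[OF i(1)] t(1)] tw[OF i] by metis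
    moreover have "p ! f i \<noteq> p ! f x" using is_perm_nth_eq[OF p fD(2)[OF i(1)] fD(2)[OF x]] fne by blast
    ultimately show "p ! f i < p ! t \<longleftrightarrow> p ! f i < p ! f x" using tw[OF i] by (metis linorder_neqE_nat less_asym)
    show "f i < t \<longleftrightarrow> f i < f x" using tw[OF i] fne by (metis linorder_neqE_nat less_asym)
  qed
  have key: "(f' i < f' j \<longleftrightarrow> f (collapse x i) < f (collapse x j)) \<and> (p ! f' i < p ! f' j \<longleftrightarrow> p ! f (collapse x i) < p ! f (collapse x j))"
    if ij: "i < Suc (length q)" "j < Suc (length q)" "collapse x i \<noteq> collapse x j" for i j
  proof -
    have c: "collapse x i < length q" "collapse x j < length q" using collapse_less[OF x] ij by auto
    consider "collapse x i = x" "collapse x j \<noteq> x" | "collapse x i \<noteq> x" "collapse x j = x" | "collapse x i \<noteq> x" "collapse x j \<noteq> x"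
      using ij(3) by metis
    then show ?thesis
    proof cases
      case 1
      then show ?thesis using f'[of i] f'[of j] tw[OF c(2)] by auto
    next
      case 2
      then show ?thesis using f'[of i] f'[of j] twv[OF c(1)] by auto
    next
      case 3
      then show ?thesis using f'[of i] f'[of j] by auto
    qed
  qed
  have pair: "f' x < f' (Suc x)" "p ! f' x < p ! f' (Suc x) \<longleftrightarrow> inc" "p ! f' (Suc x) < p ! f' x \<longleftrightarrow> \<not> inc"
    unfolding f'_def using t(2) pt inc by (auto simp: min_def max_def)
  show ?thesis unfolding pattern_emb_def len
  proof (intro conjI allI impI)
    show "f' i < length p" if "i < Suc (length q)" for i
      using f'[of i] fD(2)[OF x] t(1) fD(2)[OF collapse_less[OF x that]] by (auto split: if_splits)
    show "f' i < f' j" if ij: "i < j \<and> j < Suc (length q)" for i j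
    proof (cases "collapse x i = collapse x j")
      case True
      then have "i = x" "j = Suc x" using collapse_eq ij by blast+
      then show ?thesis using pair by simp
    next
      case False
      then have "collapse x i < collapse x j" using collapse_mono[of i j x] ij by simp
      then show ?thesis using key[of i j] False fD(1) collapse_less[OF x, of j] ij by simp
    qed
    show "?q ! i < ?q ! j \<longleftrightarrow> p ! f' i < p ! f' j" if ij: "i < Suc (length q)" "j < Suc (length q)" for i j
    proof (cases "collapse x i = collapse x j")
      case True
      then consider "i = j" | "i = x" "j = Suc x" | "j = x" "i = Suc x" using collapse_eq by (metis linorder_neqE_nat)
      then show ?thesis using pair inflate_pair[OF x, of inc] by cases auto
    next
      case False
      then show ?thesis using key[OF ij False] inflate_less[OF d x ij False] fD(3) collapse_less[OF x] ij by simp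
    qed
  qed
qed

lemma ex_pattern:
  assumes p: "is_perm p" and P: "P \<subseteq> {..<length p}"
  shows "\<exists>q f. is_perm q \<and> length q = card P \<and> pattern_emb q p f \<and> bij_betw f {..<length q} P"
proof -
  define xs where "xs = sorted_list_of_set P"
  have fin: "finite P" using P finite_subset by blast
  have xs: "sorted_wrt (<) xs" "set xs = P" "length xs = card P" "distinct xs"
    using fin unfolding xs_def by (auto simp: strict_sorted_list_of_set)
  define rk where "rk x = card {y \<in> P. p ! y < p ! x}" for x
  define q where "q = map rk xs"
  have rk: "rk x < rk y" if "x \<in> P" "y \<in> P" "p ! x < p ! y" for x y
    unfolding rk_def using that fin by (intro psubset_card_mono) auto
  have rk': "rk x < rk y \<longleftrightarrow> p ! x < p ! y" if "x \<in> P" "y \<in> P" for x y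
  proof (cases "x = y")
    case False
    then have "p ! x \<noteq> p ! y" using is_perm_nth_eq[OF p] P that by blast
    then show ?thesis using rk[OF that] rk[OF that(2,1)] by linarith
  qed simp
  have inj: "inj_on rk P"
    using rk is_perm_nth_eq[OF p] P by (intro inj_onI) (metis less_irrefl linorder_neqE_nat lessThan_iff subsetD)
  have "distinct q" unfolding q_def using xs inj by (simp add: distinct_map)
  moreover have "set q \<subseteq> {0..<card P}"
  proof -
    have "rk x < card P" if "x \<in> P" for x unfolding rk_def using that fin by (intro psubset_card_mono) auto
    then show ?thesis unfolding q_def using xs by auto
  qed
  moreover have lq: "length q = card P" unfolding q_def using xs by simp
  ultimately have "is_perm q" unfolding is_perm_def
    by (metis card_atLeastLessThan card_subset_eq diff_zero distinct_card finite_atLeastLessThan)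
  moreover have "pattern_emb q p ((!) xs)" unfolding pattern_emb_def
  proof (intro conjI allI impI)
    show "xs ! i < xs ! j" if "i < j \<and> j < length q" for i j using xs(1) that lq xs(3) by (simp add: sorted_wrt_nth_less)
    have xP: "xs ! i \<in> P" if "i < length q" for i using that lq xs(2,3) nth_mem[of i xs] by simp
    show "xs ! i < length p" if "i < length q" for i using xP[OF that] P by blast
    show "q ! i < q ! j \<longleftrightarrow> p ! (xs ! i) < p ! (xs ! j)" if "i < length q" "j < length q" for i j
      using rk'[OF xP xP] that unfolding q_def by simp
  qed
  moreover have "bij_betw ((!) xs) {..<length q} P" using xs lq by (intro bij_betw_nth) simp_all
  ultimately show ?thesis using lq by blast
qed

lemma cell_gridding_pattern:
  assumes f: "pattern_emb q p f" and cg: "cell_gridding M m n p cc"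
  shows "cell_gridding M m n q (\<lambda>i. cc (f i))"
proof -
  note f = pattern_embD[OF f] and cg = cell_griddingD[OF cg]
  show ?thesis unfolding cell_gridding_def
  proof (intro conjI allI impI)
    show "cc (f x) \<in> nonzero_cells M m n" if "x < length q" for x using cg(1) f(2) that by blast
    show "fst (cc (f x)) \<le> fst (cc (f y))" if "x < y \<and> y < length q" for x y using cg(2) f that by blast
    show "snd (cc (f x)) \<le> snd (cc (f y))" if "x < length q" "y < length q" "q ! x < q ! y" for x y
      using cg(3) f(2,3) that by blast
    show "q ! x < q ! y \<longleftrightarrow> M (fst (cc (f x))) (snd (cc (f x))) = 1" if xy: "x < y \<and> y < length q \<and> cc (f x) = cc (f y)" for x y
    proof -
      have "x < length q" using xy by simp
      then show ?thesis using cg(4)[of "f x" "f y"] f(1)[of x y] f(2)[of y] f(3)[of x y] xy by simp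
    qed
  qed
qed

lemma cell_arrow_pattern:
  assumes "pattern_emb q p f" "x < length q" "y < length q"
  shows "cell_arrow c r q (\<lambda>i. cc (f i)) x y \<longleftrightarrow> cell_arrow c r p cc (f x) (f y)"
proof -
  note f = pattern_embD[OF assms(1)]
  have "x < y \<longleftrightarrow> f x < f y" "y < x \<longleftrightarrow> f y < f x"
    using f(1)[of x y] f(1)[of y x] assms by (metis less_irrefl linorder_neqE_nat less_asym)+
  then show ?thesis unfolding cell_arrow_def using f(2,3) assms by simp
qed

section \<open>Abstract inflated coils inside gridded permutations\<close>

context cycle_matrix
begin

text \<open>Two points of the same cell with the same arrows to and from z lie on the same sides of z.\<close>

lemma twin_sides:
  assumes p: "is_perm p" and cg: "cell_gridding M m n p cc"
    and lab: "cyclic_numbering lab" and g: "\<And>x. x < length p \<Longrightarrow> g x < l \<and> lab (g x) = cc x"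
    and xyz: "t < length p" "u < length p" "z < length p" and tu: "g t = g u"
    and R: "near l (g u) (g z) \<Longrightarrow> (cell_arrow c r p cc t z \<and> cell_arrow c r p cc u z) \<or> (cell_arrow c r p cc z t \<and> cell_arrow c r p cc z u)"
  shows "t \<noteq> z \<and> (t < z \<longleftrightarrow> u < z) \<and> (p ! t < p ! z \<longleftrightarrow> p ! u < p ! z)"
proof -
  interpret cyc l "{..<length p}" g "cell_arrow c r p cc" by (rule cyc_gridded[OF p cg lab g])
  have cc: "cc t = cc u" using g xyz tu by metis
  have near: "near l (g u) (g z) \<longleftrightarrow> fst (cc u) = fst (cc z) \<or> snd (cc u) = snd (cc z)"
    using lab g xyz unfolding cyclic_numbering_def by metis
  have ne: "t \<noteq> z" "u \<noteq> z"
  proof -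
    have "z = t \<or> z = u \<Longrightarrow> near l (g u) (g z)" using tu by (auto simp: near_def)
    then show "t \<noteq> z" "u \<noteq> z" using R irr xyz by auto
  qed
  note cgD = cell_griddingD[OF cg]
  have 1: "t < z \<longleftrightarrow> u < z"
  proof (cases "fst (cc u) = fst (cc z)")
    case True
    then have n: "near l (g u) (g z)" using near by blast
    have a: "cell_arrow c r p cc t z \<longleftrightarrow> (if c (fst (cc u)) = 1 then t < z else z < t)"
      "cell_arrow c r p cc u z \<longleftrightarrow> (if c (fst (cc u)) = 1 then u < z else z < u)"
      "cell_arrow c r p cc z t \<longleftrightarrow> (if c (fst (cc u)) = 1 then z < t else t < z)"
      "cell_arrow c r p cc z u \<longleftrightarrow> (if c (fst (cc u)) = 1 then z < u else u < z)"
      using arrow_col[OF p cg, of t z] arrow_col[OF p cg, of u z] arrow_col[OF p cg, of z t] arrow_col[OF p cg, of z u] True cc xyz by auto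
    show ?thesis using R[OF n] unfolding a by (auto split: if_splits)
  next
    case False
    have "t < z \<longleftrightarrow> fst (cc u) < fst (cc z)" "u < z \<longleftrightarrow> fst (cc u) < fst (cc z)"
      using cgD(2)[of t z] cgD(2)[of z t] cgD(2)[of u z] cgD(2)[of z u] ne False cc xyz by (metis le_less less_asym linorder_neqE_nat)+
    then show ?thesis by blast
  qed
  have 2: "p ! t < p ! z \<longleftrightarrow> p ! u < p ! z"
  proof (cases "snd (cc u) = snd (cc z)")
    case True
    then have n: "near l (g u) (g z)" using near by blast
    have a: "cell_arrow c r p cc t z \<longleftrightarrow> (if r (snd (cc u)) = 1 then p ! t < p ! z else p ! z < p ! t)"
      "cell_arrow c r p cc u z \<longleftrightarrow> (if r (snd (cc u)) = 1 then p ! u < p ! z else p ! z < p ! u)"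
      "cell_arrow c r p cc z t \<longleftrightarrow> (if r (snd (cc u)) = 1 then p ! z < p ! t else p ! t < p ! z)"
      "cell_arrow c r p cc z u \<longleftrightarrow> (if r (snd (cc u)) = 1 then p ! z < p ! u else p ! u < p ! z)"
      using arrow_row[OF p cg, of t z] arrow_row[OF p cg, of u z] arrow_row[OF p cg, of z t] arrow_row[OF p cg, of z u] True cc xyz by auto
    show ?thesis using R[OF n] unfolding a by (auto split: if_splits)
  next
    case False
    have "p ! t \<noteq> p ! z" "p ! u \<noteq> p ! z" using is_perm_nth_eq[OF p] ne xyz by auto
    then have "p ! t < p ! z \<longleftrightarrow> snd (cc u) < snd (cc z)" "p ! u < p ! z \<longleftrightarrow> snd (cc u) < snd (cc z)"
      using cgD(3)[of t z] cgD(3)[of z t] cgD(3)[of u z] cgD(3)[of z u] False cc xyz by (metis le_less less_asym linorder_neqE_nat)+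
    then show ?thesis by blast
  qed
  show ?thesis using 1 2 ne by blast
qed

text \<open>Each copy has the cell of its end point and the same arcs to all other points involved,
  including the other copy. By \<open>twin_sides\<close> it lies on the same sides of all of them,
  so the pattern does not change if the copies are placed next to the end points.\<close>

lemma coil_of_inflated_coil:
  assumes p: "is_perm p" and cg: "cell_gridding M m n p cc"
    and lab: "cyclic_numbering lab" and g: "\<And>x. x < length p \<Longrightarrow> g x < l \<and> lab (g x) = cc x"
    and ic: "inflated_coil l N {..<length p} g (cell_arrow c r p cc) w y y'" and N: "l + 2 \<le> N"
  shows "\<exists>\<alpha>\<in>end_inflated_coils M m n c r. is_perm \<alpha> \<and> perm_le \<alpha> p \<and> length \<alpha> = N + 2"
proof -
  let ?R = "cell_arrow c r p cc"
  interpret cyc l "{..<length p}" g ?R by (rule cyc_gridded[OF p cg lab g])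
  have wV: "w i < length p" and wg: "g (w i) = (g (w 0) + i) mod l" if "i < N" for i
    using ic that unfolding inflated_coil_def by blast+
  have wS: "?R (w i) (w (Suc i))" if "Suc i < N" for i using ic that unfolding inflated_coil_def by blast
  have wF: "?R (w j) (w i)" if "i + 2 \<le> j" "j < N" "near l i j" for i j using ic that unfolding inflated_coil_def by blast
  have y: "y < length p" "y \<noteq> w 0" "g y = g (w 0)" "?R y (w 1)" "\<And>j. 2 \<le> j \<Longrightarrow> j < N \<Longrightarrow> near l 0 j \<Longrightarrow> ?R (w j) y"
    using ic unfolding inflated_coil_def by auto
  have y': "y' < length p" "y' \<noteq> w (N - 1)" "g y' = g (w (N - 1))" "?R (w (N - 2)) y'"
    "\<And>i. i + 2 < N \<Longrightarrow> near l i (N - 1) \<Longrightarrow> ?R y' (w i)" "near l 0 (N - 1) \<Longrightarrow> ?R y' y"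
    using ic unfolding inflated_coil_def by auto
  have nw: "near l (g (w i)) (g (w j)) \<longleftrightarrow> near l i j" if "i < N" "j < N" for i j
    unfolding wg[OF that(1)] wg[OF that(2)] near_mod near_add ..
  have inj: "inj_on w {..<N}"
  proof (rule linorder_inj_onI)
    fix i j assume ij: "i < j" "i \<in> {..<N}" "j \<in> {..<N}"
    show "w i \<noteq> w j"
    proof (cases "near l i j")
      case True
      have "?R (w i) (w j) \<or> ?R (w j) (w i)" using wS[of i] wF[of i j] ij True by (cases "j = Suc i") auto
      then show ?thesis using irr wV ij by (metis lessThan_iff)
    next
      case False
      then show ?thesis using nw[of i j] ij by (auto simp: near_def)
    qed
  qed auto
  have "w ` {..<N} \<subseteq> {..<length p}" using wV by auto
  then obtain q f where q: "is_perm q" "length q = card (w ` {..<N})" "pattern_emb q p f" "bij_betw f {..<length q} (w ` {..<N})"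
    using ex_pattern[OF p] by metis
  have lq: "length q = N" using q(2) card_image[OF inj] by simp
  \<comment> \<open>The position in the pattern \<open>q\<close> of the coil point
    \<open>w i\<close>.\<close>
  define ix where "ix i = the_inv_into {..<N} f (w i)" for i
  have fb: "bij_betw f {..<N} (w ` {..<N})" using q(4) lq by simp
  have ixN: "ix i < N" and fx: "f (ix i) = w i" if "i < N" for i
    using that fb unfolding ix_def
    by (metis bij_betw_def imageI lessThan_iff order_refl the_inv_into_into, metis bij_betw_def f_the_inv_into_f imageI lessThan_iff)
  have bix: "bij_betw ix {..<N} {..<N}"
  proof -
    have "inj_on ix {..<N}" using fx inj unfolding inj_on_def by (metis lessThan_iff)
    moreover have "ix ` {..<N} \<subseteq> {..<N}" using ixN by auto
    ultimately show ?thesis unfolding bij_betw_def by (simp add: endo_inj_surj)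
  qed
  have ix_eq: "ix i = ix j \<longleftrightarrow> i = j" if "i < N" "j < N" for i j
    using bix that unfolding bij_betw_def inj_on_def by auto
  have surj: "\<exists>j<N. i = ix j" if "i < N" for i using bix that unfolding bij_betw_def by auto
  \<comment> \<open>Abstract coils are indexed from 0 and \<open>cell_coil\<close> from 1; moreover
    the labelling has to start with the cell of \<open>w 0\<close>.\<close>
  define w' where "w' i = ix (i - 1)" for i
  define lab' where "lab' i = lab ((g (w 0) + (i - 1)) mod l)" for i
  have lb: "bij_betw lab {..<l} E" using lab unfolding cyclic_numbering_def by blast
  have shiftb: "bij_betw (\<lambda>i. i - 1) {1..k} {..<k}" for k :: nat
    by (rule bij_betwI[where g = Suc]) auto
  have "bij_betw w' {1..N} {0..<N}"
    using bij_betw_trans[OF shiftb bix] unfolding w'_def comp_def by (simp add: atLeast0LessThan)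
  have "bij_betw (\<lambda>i. (g (w 0) + i) mod l) {..<l} {..<l}"
  proof -
    have "inj_on (\<lambda>i. (g (w 0) + i) mod l) {..<l}" by (rule inj_onI) (simp add: mod_add_left_eq_iff)
    moreover have "(\<lambda>i. (g (w 0) + i) mod l) ` {..<l} \<subseteq> {..<l}" using l3 by auto
    ultimately show ?thesis unfolding bij_betw_def by (simp add: endo_inj_surj)
  qed
  then have "bij_betw lab' {1..l} E"
    using bij_betw_trans[OF bij_betw_trans[OF shiftb] lb] unfolding lab'_def comp_def by blast
  have ccw: "cc (w i) = lab' (i mod l + 1)" if "i < N" for i
  proof -
    have "cc (w i) = lab (g (w i))" using g wV that by metis
    also have "\<dots> = lab' (i mod l + 1)" unfolding wg[OF that] lab'_def by (simp add: mod_add_right_eq)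
    finally show ?thesis .
  qed
  define cq where "cq = (\<lambda>i. cc (f i))"
  have "cell_gridding M m n q cq" unfolding cq_def by (rule cell_gridding_pattern[OF q(3) cg])
  have arr: "cell_arrow c r q cq (ix i) (ix j) \<longleftrightarrow> ?R (w i) (w j)" if "i < N" "j < N" for i j
    using cell_arrow_pattern[OF q(3), of "ix i" "ix j" c r cc] ixN fx that lq unfolding cq_def by simp
  have "cell_coil M m n c r q cq w' lab'" unfolding cell_coil_def Let_def lq
  proof (intro conjI ballI allI impI)
    show "is_perm q" "cell_gridding M m n q cq" by fact+
    show "l < N" using N by simp
    show "bij_betw w' {1..N} {0..<N}" "bij_betw lab' {1..l} E" by fact+
    show "cq (w' i) = lab' ((i - 1) mod l + 1)" if "i \<in> {1..N}" for i
      using ccw[of "i - 1"] fx[of "i - 1"] that unfolding cq_def w'_def by auto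
    show "cell_arrow c r q cq (w' (i - 1)) (w' i)" if "1 < i \<and> i \<le> N" for i
    proof -
      have "i - 1 = Suc (i - 1 - 1)" using that by auto
      then show ?thesis using arr[of "i - 1 - 1" "i - 1"] wS[of "i - 1 - 1"] that unfolding w'_def by auto
    qed
    show "cell_arrow c r q cq (w' i) (w' (i - l - 1))" if "l + 1 < i \<and> i \<le> N" for i
    proof -
      define k where "k = i - l - 1 - 1"
      have k: "i - 1 = Suc (k + l)" "i - l - 1 - 1 = k" "Suc (k + l) < N" using that unfolding k_def by auto
      have "near l k (Suc (k + l))" unfolding near_def using mod_Suc_eq[of "k + l" l] mod_Suc_eq[of k l] by simp
      then have "?R (w (Suc (k + l))) (w k)" using wF[of k "Suc (k + l)"] k l3 by simp
      then show ?thesis using arr[of "Suc (k + l)" k] k unfolding w'_def by simp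
    qed
    show "cell_arrow c r q cq (w' (l + 1)) (w' 1)"
      using arr[of l 0] wF[of 0 l] N l3 unfolding w'_def by (simp add: near_def)
  qed
  then obtain v h where gc: "gridded_coil M m n c r q v h w' lab'" using gridded_coilI by blast
  let ?x1 = "ix 0" and ?xN = "ix (N - 1)"
  define s1 where "s1 = (M (fst (lab' 1)) (snd (lab' 1)) = 1)"
  define sN where "sN = (M (fst (lab' ((N - 1) mod l + 1))) (snd (lab' ((N - 1) mod l + 1))) = 1)"
  define \<alpha> where "\<alpha> = end_inflate M m n q w' lab'"
  have \<alpha>: "\<alpha> = (if ?x1 < ?xN then inflate (inflate q ?xN sN) ?x1 s1 else inflate (inflate q ?x1 s1) ?xN sN)"
    unfolding \<alpha>_def end_inflate_def Let_def lq s1_def sN_def w'_def by simp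
  have orient: "(M (fst (cc u)) (snd (cc u)) = 1) \<longleftrightarrow> (u < t \<longleftrightarrow> p ! u < p ! t)"
    if "t < length p" "u < length p" "cc t = cc u" "t \<noteq> u" for t u
    using cell_griddingD(4)[OF cg, of t u] cell_griddingD(4)[OF cg, of u t] that is_perm_nth_eq[OF p that(1,2)]
    by (metis linorder_neqE_nat less_asym)
  have N0: "0 < N" "N - 1 < N" "0 < N - 1" using N l3 by auto
  have tu: "cc y = cc (w 0)" "cc y' = cc (w (N - 1))" using g y(1,3) y'(1,3) wV N0 by metis+
  have s1: "s1 \<longleftrightarrow> (w 0 < y \<longleftrightarrow> p ! w 0 < p ! y)" using orient[of y "w 0"] y(1,2) wV N0 tu ccw[of 0] unfolding s1_def by simp
  have sN: "sN \<longleftrightarrow> (w (N - 1) < y' \<longleftrightarrow> p ! w (N - 1) < p ! y')"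
    using orient[of y' "w (N - 1)"] y'(1,2) wV N0 tu ccw[of "N - 1"] unfolding sN_def by simp
  have sides: "t \<noteq> z \<and> (t < z \<longleftrightarrow> u < z) \<and> (p ! t < p ! z \<longleftrightarrow> p ! u < p ! z)"
    if "t < length p" "u < length p" "z < length p" "g t = g u"
      "near l (g u) (g z) \<Longrightarrow> (?R t z \<and> ?R u z) \<or> (?R z t \<and> ?R z u)" for t u z
    by (rule twin_sides[OF p cg lab g]) (use that in blast)+
  have ysides: "y \<noteq> w j \<and> (y < w j \<longleftrightarrow> w 0 < w j) \<and> (p ! y < p ! w j \<longleftrightarrow> p ! w 0 < p ! w j)" if j: "j < N" "j \<noteq> 0" for j
  proof (rule sides[OF y(1) wV[OF N0(1)] wV[OF j(1)] y(3)])
    assume "near l (g (w 0)) (g (w j))"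
    then have n: "near l 0 j" using nw[of 0 j] j N0 by simp
    show "?R y (w j) \<and> ?R (w 0) (w j) \<or> ?R (w j) y \<and> ?R (w j) (w 0)"
      using n y(4) y(5)[of j] wS[of 0] wF[of 0 j] j by (cases "j = 1") auto
  qed
  have y'sides: "y' \<noteq> w j \<and> (y' < w j \<longleftrightarrow> w (N - 1) < w j) \<and> (p ! y' < p ! w j \<longleftrightarrow> p ! w (N - 1) < p ! w j)"
    if j: "j < N" "j \<noteq> N - 1" for j
  proof (rule sides[OF y'(1) wV[OF N0(2)] wV[OF j(1)] y'(3)])
    assume "near l (g (w (N - 1))) (g (w j))"
    then have n: "near l j (N - 1)" using nw[of "N - 1" j] j N0 near_sym by simp
    show "?R y' (w j) \<and> ?R (w (N - 1)) (w j) \<or> ?R (w j) y' \<and> ?R (w j) (w (N - 1))"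
    proof (cases "j = N - 2")
      case True
      have "Suc (N - 2) = N - 1" using N l3 by simp
      then show ?thesis using y'(4) wS[of "N - 2"] True N0 by simp
    next
      case False
      then have "j + 2 < N" "j + 2 \<le> N - 1" using j by auto
      then show ?thesis using y'(5)[of j] wF[of j "N - 1"] n N0 by simp
    qed
  qed
  have nearyy: "near l (g (w 0)) (g (w (N - 1))) \<longleftrightarrow> near l 0 (N - 1)" using nw[of 0 "N - 1"] N0 by simp
  have yy': "y \<noteq> y' \<and> (y < y' \<longleftrightarrow> w 0 < y') \<and> (p ! y < p ! y' \<longleftrightarrow> p ! w 0 < p ! y')"
  proof (rule sides[OF y(1) wV[OF N0(1)] y'(1) y(3)])
    assume "near l (g (w 0)) (g y')"
    then have n: "near l 0 (N - 1)" using nearyy y'(3) by simp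
    then show "?R y y' \<and> ?R (w 0) y' \<or> ?R y' y \<and> ?R y' (w 0)" using y'(6) y'(5)[of 0] N l3 by simp
  qed
  have y'y: "y' \<noteq> y \<and> (y' < y \<longleftrightarrow> w (N - 1) < y) \<and> (p ! y' < p ! y \<longleftrightarrow> p ! w (N - 1) < p ! y)"
  proof (rule sides[OF y'(1) wV[OF N0(2)] y(1) y'(3)])
    assume "near l (g (w (N - 1))) (g y)"
    then have n: "near l 0 (N - 1)" using nearyy y(3) near_sym by simp
    then show "?R y' y \<and> ?R (w (N - 1)) y \<or> ?R y y' \<and> ?R y (w (N - 1))" using y'(6) y(5)[of "N - 1"] N l3 by simp
  qed
  have gen: "y \<noteq> z \<and> (y < z \<longleftrightarrow> w 0 < z) \<and> (p ! y < p ! z \<longleftrightarrow> p ! w 0 < p ! z)"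
    if "z = y' \<or> (\<exists>j<N. j \<noteq> 0 \<and> z = w j)" for z
    using that yy' ysides by blast
  have gen': "y' \<noteq> z \<and> (y' < z \<longleftrightarrow> w (N - 1) < z) \<and> (p ! y' < p ! z \<longleftrightarrow> p ! w (N - 1) < p ! z)"
    if "z = y \<or> (\<exists>j<N. j \<noteq> N - 1 \<and> z = w j)" for z
    using that y'y y'sides by blast
  have x1N: "?x1 < N" "?xN < N" "?x1 \<noteq> ?xN" using ixN N0 ix_eq by auto
  have "is_perm \<alpha> \<and> perm_le \<alpha> p \<and> length \<alpha> = N + 2"
  proof (cases "?x1 < ?xN")
    case True
    let ?q = "inflate q ?xN sN"
    let ?f = "\<lambda>i. if i = ?xN then min (f ?xN) y' else if i = Suc ?xN then max (f ?xN) y' else f (collapse ?xN i)"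
    have f1: "pattern_emb ?q p ?f"
    proof (rule pattern_emb_inflate[OF p q(1,3) _ y'(1)])
      show "?xN < length q" "y' \<noteq> f ?xN" "sN \<longleftrightarrow> (f ?xN < y' \<longleftrightarrow> p ! f ?xN < p ! y')"
        using x1N lq y'(2) sN fx N0 by simp_all
      show "y' \<noteq> f i \<and> (y' < f i \<longleftrightarrow> f ?xN < f i) \<and> (p ! y' < p ! f i \<longleftrightarrow> p ! f ?xN < p ! f i)" if i: "i < length q" "i \<noteq> ?xN" for i
      proof -
        obtain j where "j < N" "i = ix j" using surj i lq by auto
        then show ?thesis using y'sides[of j] fx N0 i by auto
      qed
    qed
    have q1: "is_perm ?q" "length ?q = Suc N" using inflate_is_perm[OF q(1)] x1N lq by auto
    have fx1: "?f ?x1 = w 0" using True fx N0 unfolding collapse_def by simp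
    have "pattern_emb (inflate ?q ?x1 s1) p (\<lambda>i. if i = ?x1 then min (?f ?x1) y else if i = Suc ?x1 then max (?f ?x1) y else ?f (collapse ?x1 i))"
    proof (rule pattern_emb_inflate[OF p q1(1) f1 _ y(1)])
      show "?x1 < length ?q" using x1N q1 by simp
      show "y \<noteq> ?f ?x1" "s1 \<longleftrightarrow> (?f ?x1 < y \<longleftrightarrow> p ! ?f ?x1 < p ! y)" unfolding fx1 using y(2) s1 by simp_all
      show "y \<noteq> ?f i \<and> (y < ?f i \<longleftrightarrow> ?f ?x1 < ?f i) \<and> (p ! y < p ! ?f i \<longleftrightarrow> p ! ?f ?x1 < p ! ?f i)" if i: "i < length ?q" "i \<noteq> ?x1" for i
      proof -
        have ci: "collapse ?xN i < N" using collapse_less[of ?xN N i] x1N i q1 by simp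
        have "collapse ?xN i \<noteq> ?x1" using i(2) True unfolding collapse_def by auto
        then obtain j where j: "j < N" "j \<noteq> 0" "f (collapse ?xN i) = w j" using surj[OF ci] fx by metis
        have "?f i \<in> {y', w (N - 1), w j}" using j(3) fx[OF N0(2)] by (simp add: min_def max_def)
        moreover have "N - 1 \<noteq> 0" using N0 by simp
        ultimately have "?f i = y' \<or> (\<exists>j<N. j \<noteq> 0 \<and> ?f i = w j)" using j(1,2) N0(2) by blast
        then show ?thesis unfolding fx1 by (rule gen)
      qed
    qed
    then have "perm_le (inflate ?q ?x1 s1) p" unfolding perm_le_iff by blast
    moreover have "\<alpha> = inflate ?q ?x1 s1" unfolding \<alpha> using True by simp
    moreover have xq: "?x1 < length ?q" unfolding q1(2) by (rule less_SucI[OF x1N(1)])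
    moreover have "is_perm (inflate ?q ?x1 s1)" by (rule inflate_is_perm[OF q1(1) xq])
    moreover have "length (inflate ?q ?x1 s1) = N + 2" unfolding length_inflate[OF xq] q1(2) by simp
    ultimately show ?thesis by (simp only: HOL.simp_thms)
  next
    case False
    then have lt: "?xN < ?x1" using x1N by simp
    let ?q = "inflate q ?x1 s1"
    let ?f = "\<lambda>i. if i = ?x1 then min (f ?x1) y else if i = Suc ?x1 then max (f ?x1) y else f (collapse ?x1 i)"
    have f1: "pattern_emb ?q p ?f"
    proof (rule pattern_emb_inflate[OF p q(1,3) _ y(1)])
      show "?x1 < length q" "y \<noteq> f ?x1" "s1 \<longleftrightarrow> (f ?x1 < y \<longleftrightarrow> p ! f ?x1 < p ! y)"
        using x1N lq y(2) s1 fx N0 by simp_all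
      show "y \<noteq> f i \<and> (y < f i \<longleftrightarrow> f ?x1 < f i) \<and> (p ! y < p ! f i \<longleftrightarrow> p ! f ?x1 < p ! f i)" if i: "i < length q" "i \<noteq> ?x1" for i
      proof -
        obtain j where "j < N" "i = ix j" using surj i lq by auto
        then show ?thesis using ysides[of j] fx N0 i by auto
      qed
    qed
    have q1: "is_perm ?q" "length ?q = Suc N" using inflate_is_perm[OF q(1)] x1N lq by auto
    have fxN: "?f ?xN = w (N - 1)" using lt fx N0 unfolding collapse_def by simp
    have "pattern_emb (inflate ?q ?xN sN) p (\<lambda>i. if i = ?xN then min (?f ?xN) y' else if i = Suc ?xN then max (?f ?xN) y' else ?f (collapse ?xN i))"
    proof (rule pattern_emb_inflate[OF p q1(1) f1 _ y'(1)])
      show "?xN < length ?q" using x1N q1 by simp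
      show "y' \<noteq> ?f ?xN" "sN \<longleftrightarrow> (?f ?xN < y' \<longleftrightarrow> p ! ?f ?xN < p ! y')" unfolding fxN using y'(2) sN by simp_all
      show "y' \<noteq> ?f i \<and> (y' < ?f i \<longleftrightarrow> ?f ?xN < ?f i) \<and> (p ! y' < p ! ?f i \<longleftrightarrow> p ! ?f ?xN < p ! ?f i)" if i: "i < length ?q" "i \<noteq> ?xN" for i
      proof -
        have ci: "collapse ?x1 i < N" using collapse_less[of ?x1 N i] x1N i q1 by simp
        have "collapse ?x1 i \<noteq> ?xN" using i(2) lt unfolding collapse_def by auto
        then obtain j where j: "j < N" "j \<noteq> N - 1" "f (collapse ?x1 i) = w j" using surj[OF ci] fx by metis
        have "?f i \<in> {y, w 0, w j}" using j(3) fx[OF N0(1)] by (simp add: min_def max_def)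
        moreover have "0 \<noteq> N - 1" using N0 by simp
        ultimately have "?f i = y \<or> (\<exists>j<N. j \<noteq> N - 1 \<and> ?f i = w j)" using j(1,2) N0(1) by blast
        then show ?thesis unfolding fxN by (rule gen')
      qed
    qed
    then have "perm_le (inflate ?q ?xN sN) p" unfolding perm_le_iff by blast
    moreover have "\<alpha> = inflate ?q ?xN sN" unfolding \<alpha> using False by simp
    moreover have xq: "?xN < length ?q" unfolding q1(2) by (rule less_SucI[OF x1N(2)])
    moreover have "is_perm (inflate ?q ?xN sN)" by (rule inflate_is_perm[OF q1(1) xq])
    moreover have "length (inflate ?q ?xN sN) = N + 2" unfolding length_inflate[OF xq] q1(2) by simp
    ultimately show ?thesis by (simp only: HOL.simp_thms)
  qed
  moreover have "\<alpha> \<in> end_inflated_coils M m n c r" unfolding end_inflated_coils_def \<alpha>_def using gc by blast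
  ultimately show ?thesis by blast
qed

end

section \<open>Finitely many end-inflated coils imply well quasi-ordering\<close>

lemma perm_set_finite: "finite {p. is_perm p \<and> length p \<le> B}"
  by (rule finite_subset[OF _ finite_lists_length_le[of "{..<B}" B]]) (auto simp: is_perm_def)

context cycle_matrix
begin

lemma cyclic_numbering_neg:
  assumes "cyclic_numbering lab"
  shows "cyclic_numbering (\<lambda>a. lab (neg l a))"
proof -
  have l3: "3 \<le> l" and b: "bij_betw lab {..<l} E"
    and nr: "\<And>a b. a < l \<Longrightarrow> b < l \<Longrightarrow> near l a b \<longleftrightarrow> fst (lab a) = fst (lab b) \<or> snd (lab a) = snd (lab b)"
    using assms unfolding cyclic_numbering_def by blast+
  have l0: "0 < l" using l3 by simp
  have "bij_betw (neg l) {..<l} {..<l}"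
    by (rule bij_betwI[where g = "neg l"]) (use neg_less[OF l0] neg_neg in auto)
  then have "bij_betw (\<lambda>a. lab (neg l a)) {..<l} E" using bij_betw_trans[OF _ b, of "neg l"] unfolding comp_def by blast
  moreover have "near l a b \<longleftrightarrow> fst (lab (neg l a)) = fst (lab (neg l b)) \<or> snd (lab (neg l a)) = snd (lab (neg l b))"
    if "a < l" "b < l" for a b
    using nr[OF neg_less neg_less, OF l0 l0, of a b] near_neg[OF that] by simp
  ultimately show ?thesis unfolding cyclic_numbering_def using l3 by blast
qed

lemma wqo_if_finite:
  assumes C: "perm_class C" "C \<subseteq> Grid M m n" and fin: "finite (C \<inter> end_inflated_coils M m n c r)"
  shows "wqo_perms C"
proof (cases "E = {}")
  \<comment> \<open>The matrix without rows and columns also satisfies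
    \<open>rc_graph_is_cycle\<close>; then only the empty permutation has a gridding.\<close>
  case True
  have "p = []" if p: "p \<in> C" for p
  proof -
    obtain v h where g: "is_gridding M m n p v h" using p C(2) unfolding Grid_def by blast
    obtain cc where "cell_gridding M m n p cc" using gridding_cells[OF gm g] by blast
    then have "\<not> 0 < length p" using cell_griddingD(1)[of M m n p cc 0] True by auto
    then show ?thesis by simp
  qed
  moreover have "perm_le [] []" unfolding perm_le_def by simp
  ultimately show ?thesis unfolding wqo_perms_def by (metis lessI)
next
  case False
  obtain lab where lab: "cyclic_numbering lab" using ex_cyclic_numbering[OF False] by blast
  then have b: "bij_betw lab {..<l} E" unfolding cyclic_numbering_def by blast
  \<comment> \<open>One gridding is fixed for each permutation. This suffices because an embedding
    with respect to any two griddings is a containment.\<close>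
  define cc where "cc p = (SOME cc. cell_gridding M m n p cc)" for p
  define g where "g p x = the_inv_into {..<l} lab (cc p x)" for p x
  have perm: "is_perm p" if "p \<in> C" for p using that C(1) unfolding perm_class_def by blast
  have cc: "cell_gridding M m n p (cc p)" if p: "p \<in> C" for p
  proof -
    obtain v h where "is_gridding M m n p v h" using p C(2) unfolding Grid_def by blast
    then obtain k where "cell_gridding M m n p k" using gridding_cells[OF gm] by metis
    then show ?thesis unfolding cc_def by (rule someI[of "cell_gridding M m n p"])
  qed
  have g: "g p x < l \<and> lab (g p x) = cc p x" if "p \<in> C" "x < length p" for p x
  proof -
    have e: "cc p x \<in> lab ` {..<l}" using cell_griddingD(1)[OF cc[OF that(1)] that(2)] b unfolding bij_betw_def by blast
    have i: "inj_on lab {..<l}" using b unfolding bij_betw_def by blast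
    show ?thesis using the_inv_into_into[OF i e subset_refl] f_the_inv_into_f[OF i e] unfolding g_def by simp
  qed
  define B where "B = Max (insert 0 (length ` (C \<inter> end_inflated_coils M m n c r)))"
  have B: "length \<alpha> \<le> B" if "\<alpha> \<in> C \<inter> end_inflated_coils M m n c r" for \<alpha>
    unfolding B_def using that fin by (intro Max_ge) auto
  \<comment> \<open>A coil with \<open>K\<close> or more points yields an end-inflated coil longer
    than \<open>B\<close>; the summand \<open>l + 2\<close> is the length that
    \<open>coil_of_inflated_coil\<close> requires.\<close>
  define K where "K = B + l + 2"
  have noc: "\<not> has_inflated_coil l N ({..<length p}, g', cell_arrow c r p (cc p))"
    if p: "p \<in> C" and N: "K \<le> N" and lab': "cyclic_numbering lab'" and g': "\<And>x. x < length p \<Longrightarrow> g' x < l \<and> lab' (g' x) = cc p x"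
    for p N lab' g'
  proof
    assume "has_inflated_coil l N ({..<length p}, g', cell_arrow c r p (cc p))"
    then obtain w y y' where ic: "inflated_coil l N {..<length p} g' (cell_arrow c r p (cc p)) w y y'"
      unfolding has_inflated_coil_def by auto
    have "l + 2 \<le> N" using N K_def by simp
    from coil_of_inflated_coil[OF perm[OF p] cc[OF p] lab' g' ic this]
    obtain \<alpha> where \<alpha>: "\<alpha> \<in> end_inflated_coils M m n c r" "is_perm \<alpha>" "perm_le \<alpha> p" "length \<alpha> = N + 2" by blast
    have "\<alpha> \<in> C" using C(1) p \<alpha>(2,3) unfolding perm_class_def by blast
    then have "length \<alpha> \<le> B" using B \<alpha>(1) by blast
    then show False using \<alpha>(4) N K_def by simp
  qed
  have "wqo_on perm_le C"
  proof (rule wqo_on_map[OF wqo_no_inflated_coils[of l K], where f = "\<lambda>p. ({..<length p}, g p, cell_arrow c r p (cc p))"])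
    fix p assume p: "p \<in> C"
    have 1: "cyc l {..<length p} (g p) (cell_arrow c r p (cc p))"
      by (rule cyc_gridded[OF perm[OF p] cc[OF p] lab g[OF p]])
    have l0: "0 < l" using lab unfolding cyclic_numbering_def by linarith
    have g': "neg l (g p x) < l \<and> lab (neg l (neg l (g p x))) = cc p x" if "x < length p" for x
      using g[OF p that] neg_less[OF l0] neg_neg by simp
    have 2: "\<not> has_inflated_coil l N ({..<length p}, g p, cell_arrow c r p (cc p))" if "K \<le> N" for N
      by (rule noc[OF p that lab g[OF p]])
    have 3: "\<not> has_inflated_coil l N ({..<length p}, \<lambda>x. neg l (g p x), cell_arrow c r p (cc p))" if "K \<le> N" for N
      by (rule noc[OF p that cyclic_numbering_neg[OF lab] g'])
    show "({..<length p}, g p, cell_arrow c r p (cc p)) \<in> {(V, g, R). cyc l V g R \<and> (\<forall>n\<ge>K. \<not> has_inflated_coil l n (V, g, R) \<and>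
      \<not> has_inflated_coil l n (V, \<lambda>x. neg l (g x), R))}" using 1 2 3 by simp
  next
    fix p p' assume p: "p \<in> C" "p' \<in> C"
      and e: "emb ({..<length p}, g p, cell_arrow c r p (cc p)) ({..<length p'}, g p', cell_arrow c r p' (cc p'))"
    show "perm_le p p'"
      by (rule emb_perm_le[OF perm[OF p(1)] cc[OF p(1)] perm[OF p(2)] cc[OF p(2)] _ _ e, of lab]) (use g p in blast)+
  qed
  then show ?thesis unfolding wqo_on_def wqo_perms_def .
qed

end

section \<open>Blow-ups of permutations\<close>

text \<open>Here \<pi> sends a point of \<alpha> to the point of p it comes from, D is the set of inflated points of p,
  and the pair replacing i is increasing iff s i.\<close>

definition blowup :: "nat list \<Rightarrow> nat list \<Rightarrow> (nat \<Rightarrow> nat) \<Rightarrow> nat set \<Rightarrow> (nat \<Rightarrow> bool) \<Rightarrow> bool" where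
  "blowup \<alpha> p \<pi> D s \<longleftrightarrow>
     (\<forall>y<length \<alpha>. \<pi> y < length p) \<and>
     (\<forall>y z. y \<le> z \<and> z < length \<alpha> \<longrightarrow> \<pi> y \<le> \<pi> z) \<and>
     (\<forall>y<length \<alpha>. \<forall>z<length \<alpha>. \<pi> y \<noteq> \<pi> z \<longrightarrow> (\<alpha> ! y < \<alpha> ! z \<longleftrightarrow> p ! \<pi> y < p ! \<pi> z)) \<and>
     (\<forall>y z. y < z \<and> z < length \<alpha> \<and> \<pi> y = \<pi> z \<longrightarrow> \<pi> y \<in> D \<and> (\<alpha> ! y < \<alpha> ! z \<longleftrightarrow> s (\<pi> y))) \<and>
     (\<forall>i<length p. \<exists>y<length \<alpha>. \<pi> y = i) \<and>
     (\<forall>i\<in>D. \<exists>y z. y < z \<and> z < length \<alpha> \<and> \<pi> y = i \<and> \<pi> z = i)"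

lemma blowupD:
  assumes "blowup \<alpha> p \<pi> D s"
  shows "y < length \<alpha> \<Longrightarrow> \<pi> y < length p"
    "y \<le> z \<Longrightarrow> z < length \<alpha> \<Longrightarrow> \<pi> y \<le> \<pi> z"
    "y < length \<alpha> \<Longrightarrow> z < length \<alpha> \<Longrightarrow> \<pi> y \<noteq> \<pi> z \<Longrightarrow> \<alpha> ! y < \<alpha> ! z \<longleftrightarrow> p ! \<pi> y < p ! \<pi> z"
    "y < z \<Longrightarrow> z < length \<alpha> \<Longrightarrow> \<pi> y = \<pi> z \<Longrightarrow> \<pi> y \<in> D \<and> (\<alpha> ! y < \<alpha> ! z \<longleftrightarrow> s (\<pi> y))"
    "i < length p \<Longrightarrow> \<exists>y<length \<alpha>. \<pi> y = i"
    "i \<in> D \<Longrightarrow> \<exists>y z. y < z \<and> z < length \<alpha> \<and> \<pi> y = i \<and> \<pi> z = i"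
  using assms unfolding blowup_def by blast+

lemma blowup_id: "blowup p p (\<lambda>y. y) {} s"
  unfolding blowup_def by auto

lemma blowup_inflate:
  assumes b: "blowup q p \<pi> D s" and q: "is_perm q" and x: "x < length q"
    and fib: "\<And>y. y < length q \<Longrightarrow> \<pi> y = \<pi> x \<Longrightarrow> y = x"
  shows "blowup (inflate q x (s (\<pi> x))) p (\<lambda>y. \<pi> (collapse x y)) (insert (\<pi> x) D) s"
proof -
  note b = blowupD[OF b]
  have d: "distinct q" using q unfolding is_perm_def by blast
  let ?a = "inflate q x (s (\<pi> x))"
  have len: "length ?a = Suc (length q)" using x by simp
  have cl: "collapse x y < length q" if "y < Suc (length q)" for y using collapse_less[OF x that] .
  define ex where "ex y = (if y \<le> x then y else Suc y)" for y
  have ex: "collapse x (ex y) = y" "y < z \<Longrightarrow> ex y < ex z" "y < length q \<Longrightarrow> ex y < Suc (length q)" for y z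
    unfolding ex_def collapse_def by auto
  show ?thesis unfolding blowup_def len
  proof (intro conjI allI impI ballI)
    show "\<pi> (collapse x y) < length p" if "y < Suc (length q)" for y using b(1) cl that by blast
    show "\<pi> (collapse x y) \<le> \<pi> (collapse x z)" if "y \<le> z \<and> z < Suc (length q)" for y z
      using b(2) cl collapse_mono that by blast
    show "?a ! y < ?a ! z \<longleftrightarrow> p ! \<pi> (collapse x y) < p ! \<pi> (collapse x z)"
      if yz: "y < Suc (length q)" "z < Suc (length q)" "\<pi> (collapse x y) \<noteq> \<pi> (collapse x z)" for y z
    proof -
      have "collapse x y \<noteq> collapse x z" using yz by auto
      then show ?thesis using inflate_less[OF d x yz(1,2)] b(3)[OF cl cl] yz by blast
    qed
    fix y z assume yz: "y < z \<and> z < Suc (length q) \<and> \<pi> (collapse x y) = \<pi> (collapse x z)"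
    have "\<pi> (collapse x y) \<in> insert (\<pi> x) D \<and> (?a ! y < ?a ! z \<longleftrightarrow> s (\<pi> (collapse x y)))"
    proof (cases "collapse x y = collapse x z")
      case True
      then have e: "y = x" "z = Suc x" using collapse_eq yz by blast+
      have cx: "collapse x x = x" unfolding collapse_def by simp
      show ?thesis unfolding e cx using inflate_pair(1)[OF x] by simp
    next
      case False
      then have lt: "collapse x y < collapse x z" using collapse_mono[of y z x] yz by simp
      have z: "collapse x z < length q" using cl yz by blast
      have "\<pi> (collapse x y) \<in> D \<and> (q ! collapse x y < q ! collapse x z \<longleftrightarrow> s (\<pi> (collapse x y)))"
        using b(4)[OF lt z] yz by blast
      moreover have "?a ! y < ?a ! z \<longleftrightarrow> q ! collapse x y < q ! collapse x z"
        using inflate_less[OF d x _ _ False] yz by simp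
      ultimately show ?thesis by blast
    qed
    then show "\<pi> (collapse x y) \<in> insert (\<pi> x) D" "?a ! y < ?a ! z \<longleftrightarrow> s (\<pi> (collapse x y))" by blast+
  next
    fix i assume "i < length p"
    then obtain y where "y < length q" "\<pi> y = i" using b(5) by blast
    then show "\<exists>y<Suc (length q). \<pi> (collapse x y) = i" using ex by (intro exI[of _ "ex y"]) simp
  next
    fix i assume "i \<in> insert (\<pi> x) D"
    then consider "i = \<pi> x" | "i \<in> D" by blast
    then show "\<exists>y z. y < z \<and> z < Suc (length q) \<and> \<pi> (collapse x y) = i \<and> \<pi> (collapse x z) = i"
    proof cases
      case 1
      have "collapse x x = x" "collapse x (Suc x) = x" unfolding collapse_def by auto
      then show ?thesis using 1 x by (intro exI[of _ x] exI[of _ "Suc x"]) simp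
    next
      case 2
      then obtain y z where "y < z" "z < length q" "\<pi> y = i" "\<pi> z = i" using b(6) by blast
      then show ?thesis using ex by (intro exI[of _ "ex y"] exI[of _ "ex z"]) simp
    qed
  qed
qed

lemma cell_gridding_blowup:
  assumes b: "blowup \<alpha> p \<pi> D (\<lambda>i. M (fst (cc i)) (snd (cc i)) = 1)" and cg: "cell_gridding M m n p cc"
  shows "cell_gridding M m n \<alpha> (\<lambda>y. cc (\<pi> y))"
proof -
  note b = blowupD[OF b] and cg = cell_griddingD[OF cg]
  show ?thesis unfolding cell_gridding_def
  proof (intro conjI allI impI)
    show "cc (\<pi> x) \<in> nonzero_cells M m n" if "x < length \<alpha>" for x using cg(1) b(1) that by blast
    show "fst (cc (\<pi> x)) \<le> fst (cc (\<pi> y))" if xy: "x < y \<and> y < length \<alpha>" for x y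
      using cg(2)[of "\<pi> x" "\<pi> y"] b(1)[of y] b(2)[of x y] xy by (cases "\<pi> x = \<pi> y") auto
    show "snd (cc (\<pi> x)) \<le> snd (cc (\<pi> y))" if xy: "x < length \<alpha>" "y < length \<alpha>" "\<alpha> ! x < \<alpha> ! y" for x y
      using cg(3)[OF b(1)[OF xy(1)] b(1)[OF xy(2)]] b(3)[OF xy(1,2)] xy(3) by (cases "\<pi> x = \<pi> y") auto
    show "\<alpha> ! x < \<alpha> ! y \<longleftrightarrow> M (fst (cc (\<pi> x))) (snd (cc (\<pi> x))) = 1" if xy: "x < y \<and> y < length \<alpha> \<and> cc (\<pi> x) = cc (\<pi> y)" for x y
    proof (cases "\<pi> x = \<pi> y")
      case True
      then show ?thesis using b(4)[of x y] xy by blast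
    next
      case False
      then have "\<pi> x < \<pi> y" using b(2)[of x y] xy by simp
      then show ?thesis using cg(4)[of "\<pi> x" "\<pi> y"] b(1)[of y] b(3)[of x y] False xy by simp
    qed
  qed
qed

text \<open>Any choice of one copy for each point works; \<open>infl_le_length\<close> exploits this
  freedom at the end points.\<close>

lemma blowup_section:
  assumes b: "blowup \<alpha> p \<pi> D s" and f: "\<And>i. i < length p \<Longrightarrow> \<phi> i < length \<alpha> \<and> \<pi> (\<phi> i) = i"
  shows "pattern_emb p \<alpha> \<phi>"
proof -
  note b = blowupD[OF b]
  show ?thesis unfolding pattern_emb_def
  proof (intro conjI allI impI)
    show "\<phi> i < length \<alpha>" if "i < length p" for i using f that by blast
    show "\<phi> i < \<phi> j" if ij: "i < j \<and> j < length p" for i j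
    proof (rule ccontr)
      assume "\<not> \<phi> i < \<phi> j"
      then have "\<pi> (\<phi> j) \<le> \<pi> (\<phi> i)" using b(2)[of "\<phi> j" "\<phi> i"] f[of i] ij by simp
      then show False using f[of i] f[of j] ij by simp
    qed
    show "p ! i < p ! j \<longleftrightarrow> \<alpha> ! \<phi> i < \<alpha> ! \<phi> j" if "i < length p" "j < length p" for i j
      using b(3)[of "\<phi> i" "\<phi> j"] f[OF that(1)] f[OF that(2)] by (cases "i = j") auto
  qed
qed

text \<open>Here \<open>b\<close> factors through \<open>a\<close> by a monotone map of a finite
  chain onto itself, and such a map is the identity.\<close>

lemma mono_surj_id:
  fixes a b :: "'a \<Rightarrow> nat"
  assumes J: "finite J" and im: "a ` J = b ` J" and mono: "\<And>i j. i \<in> J \<Longrightarrow> j \<in> J \<Longrightarrow> a i < a j \<Longrightarrow> b i \<le> b j"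
    and fn: "\<And>i j. i \<in> J \<Longrightarrow> j \<in> J \<Longrightarrow> a i = a j \<Longrightarrow> b i = b j" and i: "i \<in> J"
  shows "a i = b i"
proof -
  define A where "A = a ` J"
  define h where "h x = b (SOME i. i \<in> J \<and> a i = x)" for x
  have h: "h (a i) = b i" if "i \<in> J" for i
  proof -
    have "(SOME j. j \<in> J \<and> a j = a i) \<in> J \<and> a (SOME j. j \<in> J \<and> a j = a i) = a i"
      by (rule someI[of _ i]) (use that in simp)
    then show ?thesis unfolding h_def using fn that by blast
  qed
  have finA: "finite A" using J unfolding A_def by simp
  have hA: "h ` A = A"
  proof -
    have "h ` A = b ` J" unfolding A_def image_image using h by (rule image_cong[OF refl])
    then show ?thesis using im A_def by simp
  qed
  have inj: "inj_on h A" by (rule eq_card_imp_inj_on[OF finA]) (simp add: hA)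
  have hm: "h x \<le> h y" if xy: "x \<in> A" "y \<in> A" "x < y" for x y
  proof -
    obtain i j where "i \<in> J" "x = a i" "j \<in> J" "y = a j" using xy unfolding A_def by blast
    then show ?thesis using mono h xy(3) by simp
  qed
  have "h x = x" if "x \<in> A" for x
    using that
  proof (induction x rule: less_induct)
    case (less x)
    have hx: "h x \<in> A" by (subst hA[symmetric]) (rule imageI[OF less.prems])
    show ?case
    proof (rule linorder_cases[of "h x" x])
      assume lt: "h x < x"
      then have "h (h x) = h x" using less.IH hx by blast
      then show ?thesis using inj_onD[OF inj _ hx less.prems] by simp
    next
      assume gt: "x < h x"
      have "x \<in> h ` A" unfolding hA by (rule less.prems)
      then obtain y where y: "y \<in> A" "h y = x" by blast
      show ?thesis
      proof (rule linorder_cases[of y x])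
        assume "y < x"
        then show ?thesis using less.IH y by auto
      next
        assume "x < y"
        then show ?thesis using hm[OF less.prems y(1)] y(2) gt by simp
      qed (use y in simp)
    qed simp
  qed
  then show ?thesis using h[OF i] i unfolding A_def by auto
qed

text \<open>A bounded monotone integer sequence is constant on some long interval.\<close>

lemma constant_interval:
  fixes f :: "nat \<Rightarrow> int"
  assumes mono: "\<And>i. 1 \<le> i \<Longrightarrow> i < N \<Longrightarrow> f i \<le> f (Suc i)" and bnd: "\<And>i. 1 \<le> i \<Longrightarrow> i \<le> N \<Longrightarrow> \<bar>f i\<bar> \<le> int B"
    and N: "1 + (2 * B + 1) * Q \<le> N"
  shows "\<exists>i\<ge>1. i + Q \<le> N \<and> (\<forall>j. i \<le> j \<and> j < i + Q \<longrightarrow> f (Suc j) = f j)"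
proof -
  have le: "f i \<le> f j" if "1 \<le> i" "i \<le> j" "j \<le> N" for i j
    using that(2,3)
  proof (induction j rule: dec_induct)
    case (step k)
    then show ?case using mono[of k] that(1) by simp
  qed simp
  have "\<exists>i\<ge>1. i + Q \<le> N \<and> f (i + Q) = f i"
  proof (rule ccontr)
    assume neg: "\<not> ?thesis"
    \<comment> \<open>Otherwise \<open>f\<close> would grow on each of \<open>2 * B + 1\<close>
      consecutive intervals of length \<open>Q\<close>, more than the range from \<open>-B\<close>
      to \<open>B\<close> admits.\<close>
    have "f 1 + int j \<le> f (1 + j * Q)" if "j \<le> 2 * B + 1" for j
      using that
    proof (induction j)
      case (Suc j)
      have "Suc j * Q \<le> (2 * B + 1) * Q" using Suc.prems by (intro mult_le_mono1) simp
      moreover have "Suc j * Q = j * Q + Q" by simp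
      ultimately have b: "1 + j * Q + Q \<le> N" using N by linarith
      have "f (1 + j * Q + Q) \<noteq> f (1 + j * Q)" using neg b by (metis le_add1)
      moreover have "f (1 + j * Q) \<le> f (1 + j * Q + Q)" using le b by simp
      moreover have "f (1 + Suc j * Q) = f (1 + j * Q + Q)" by (simp add: algebra_simps)
      moreover have "f 1 + int j \<le> f (1 + j * Q)" using Suc by simp
      ultimately show ?case by linarith
    qed simp
    from this[OF order_refl] have "f 1 + int (2 * B + 1) \<le> f (1 + (2 * B + 1) * Q)" .
    moreover have "\<bar>f 1\<bar> \<le> int B" by (rule bnd) (use N in linarith)+
    moreover have "\<bar>f (1 + (2 * B + 1) * Q)\<bar> \<le> int B" by (rule bnd[OF _ N]) simp
    ultimately show False by linarith
  qed
  then obtain i where i: "1 \<le> i" "i + Q \<le> N" "f (i + Q) = f i" by blast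
  have "f (Suc j) = f j" if "i \<le> j" "j < i + Q" for j
    using le[of i j] le[of j "Suc j"] le[of "Suc j" "i + Q"] that i by simp
  then show ?thesis using i by blast
qed

section \<open>Griddings of coils\<close>

text \<open>The two coordinate directions are treated uniformly: True stands for columns and positions,
  False for rows and values.\<close>

definition line :: "bool \<Rightarrow> nat \<times> nat \<Rightarrow> nat" where
  "line d e = (if d then fst e else snd e)"

definition coord :: "nat list \<Rightarrow> bool \<Rightarrow> nat \<Rightarrow> nat" where
  "coord p d x = (if d then x else p ! x)"

definition before :: "nat list \<Rightarrow> bool \<Rightarrow> int \<Rightarrow> nat \<Rightarrow> nat \<Rightarrow> bool" where
  "before p d s x y \<longleftrightarrow> (if s = 1 then coord p d x < coord p d y else coord p d y < coord p d x)"

lemma line_mono: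
  assumes "cell_gridding M m n p kk" "x < length p" "y < length p" "coord p d x < coord p d y"
  shows "line d (kk x) \<le> line d (kk y)"
  using cell_griddingD(2,3)[OF assms(1), of x y] assms(2-4) unfolding line_def coord_def by (auto split: if_splits)

lemma line_between:
  assumes cg: "cell_gridding M m n p kk" and V: "x < length p" "y < length p" "z < length p"
    and b: "before p d s x y" "before p d s y z" and eq: "line d (kk x) = line d (kk z)"
  shows "line d (kk y) = line d (kk x)"
  using line_mono[OF cg V(1,2), of d] line_mono[OF cg V(2,3), of d] line_mono[OF cg V(2,1), of d] line_mono[OF cg V(3,2), of d] b eq
  unfolding before_def by (auto split: if_splits)

lemma same_cell_coord:
  assumes p: "is_perm p" and cg: "cell_gridding M m n p kk" and V: "x < length p" "y < length p" and eq: "kk x = kk y" "x \<noteq> y"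
  shows "coord p d x < coord p d y \<longleftrightarrow>
    (if M (fst (kk x)) (snd (kk x)) = 1 then coord p (\<not> d) x < coord p (\<not> d) y else coord p (\<not> d) y < coord p (\<not> d) x)"
proof -
  have "p ! x \<noteq> p ! y" using is_perm_nth_eq[OF p V] eq(2) by blast
  then show ?thesis
    using cell_griddingD(4)[OF cg, of x y] cell_griddingD(4)[OF cg, of y x] V eq unfolding coord_def
    by (cases x y rule: linorder_cases) (auto split: if_splits)
qed

context cycle_matrix
begin

definition mate :: "bool \<Rightarrow> nat \<times> nat \<Rightarrow> nat \<times> nat" where
  "mate d e = (if d then col_mate e else row_mate e)"

definition sgn_line :: "bool \<Rightarrow> nat \<times> nat \<Rightarrow> int" where
  "sgn_line d e = (if d then c (fst e) else r (snd e))"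

lemma mate: "e \<in> E \<Longrightarrow> mate d e \<in> E" "e \<in> E \<Longrightarrow> line d (mate d e) = line d e" "e \<in> E \<Longrightarrow> mate d e \<noteq> e"
  unfolding mate_def line_def using col_mate[of e] row_mate[of e] by auto

lemma mate_eq: "e \<in> E \<Longrightarrow> e' \<in> E \<Longrightarrow> line d e' = line d e \<Longrightarrow> e' \<noteq> e \<Longrightarrow> e' = mate d e"
  unfolding mate_def line_def using col_mate_eq[of e e'] row_mate_eq[of e e'] by (auto split: if_splits)

lemma mate_mate: "e \<in> E \<Longrightarrow> mate d (mate d e) = e"
  unfolding mate_def using col_mate_col_mate row_mate_row_mate by simp

lemma line_sgn: "line d e = line d e' \<Longrightarrow> sgn_line d e = sgn_line d e'"
  unfolding line_def sgn_line_def by (auto split: if_splits)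

lemma arrow_before:
  assumes "is_perm p" "cell_gridding M m n p cc" "x < length p" "y < length p" "line d (cc x) = line d (cc y)"
  shows "cell_arrow c r p cc x y \<longleftrightarrow> before p d (sgn_line d (cc x)) x y"
  using arrow_col[OF assms(1-4)] arrow_row[OF assms(1-4)] assms(5)
  unfolding before_def line_def sgn_line_def coord_def by (auto split: if_splits)

lemma arrow_line:
  "cell_arrow c r p cc x y \<Longrightarrow> line True (cc x) = line True (cc y) \<or> line False (cc x) = line False (cc y)"
  unfolding cell_arrow_def line_def by auto

text \<open>If x and z lie in one cell and y between them in the neighbouring cell of direction d, then this is so
  in any other gridding as well: x, y, z cannot be in one monotone cell, as y is extreme in the other direction.\<close>

lemma between_mate:
  assumes p: "is_perm p" and cg: "cell_gridding M m n p cc" and kg: "cell_gridding M m n p kk"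
    and V: "x < length p" "y < length p" "z < length p"
    and cc: "cc x = cc z" "line d (cc y) = line d (cc x)" "cc y \<noteq> cc x"
    and b: "cell_arrow c r p cc x y" "cell_arrow c r p cc y z" and eq: "kk x = kk z"
  shows "kk y = mate d (kk x)"
proof -
  have b': "before p d (sgn_line d (cc x)) x y" "before p d (sgn_line d (cc x)) y z"
    using arrow_before[OF p cg V(1,2), of d] arrow_before[OF p cg V(2,3), of d] b cc(1,2) line_sgn[of d "cc y" "cc x"] by metis+
  have ln: "line d (kk y) = line d (kk x)" using line_between[OF kg V b'] eq by simp
  have "kk y \<noteq> kk x"
  proof
    assume k: "kk y = kk x"
    have "line (\<not> d) (cc y) \<noteq> line (\<not> d) (cc x)"
      using cc(2,3) unfolding line_def by (auto simp: prod_eq_iff split: if_splits)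
    then consider "line (\<not> d) (cc x) < line (\<not> d) (cc y)" | "line (\<not> d) (cc y) < line (\<not> d) (cc x)" by linarith
    then have ext: "(coord p (\<not> d) x < coord p (\<not> d) y \<and> coord p (\<not> d) z < coord p (\<not> d) y) \<or>
      (coord p (\<not> d) y < coord p (\<not> d) x \<and> coord p (\<not> d) y < coord p (\<not> d) z)"
    proof cases
      have ne: "x \<noteq> y" "z \<noteq> y" using cc by auto
      then have ne': "coord p (\<not> d) x \<noteq> coord p (\<not> d) y" "coord p (\<not> d) z \<noteq> coord p (\<not> d) y"
        using is_perm_nth_eq[OF p] V unfolding coord_def by auto
      case 1
      then show ?thesis using line_mono[OF cg V(2,1), of "\<not> d"] line_mono[OF cg V(2,3), of "\<not> d"] ne' cc(1) by fastforce
    next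
      have ne: "x \<noteq> y" "z \<noteq> y" using cc by auto
      then have ne': "coord p (\<not> d) x \<noteq> coord p (\<not> d) y" "coord p (\<not> d) z \<noteq> coord p (\<not> d) y"
        using is_perm_nth_eq[OF p] V unfolding coord_def by auto
      case 2
      then show ?thesis using line_mono[OF cg V(1,2), of "\<not> d"] line_mono[OF cg V(3,2), of "\<not> d"] ne' cc(1) by fastforce
    qed
    have ne: "x \<noteq> y" "y \<noteq> z" using cc by auto
    show False
      using same_cell_coord[OF p kg V(1,2), of d] same_cell_coord[OF p kg V(2,1), of d]
        same_cell_coord[OF p kg V(2,3), of d] same_cell_coord[OF p kg V(3,2), of d] k eq ne ext b'
      unfolding before_def by (auto split: if_splits)
  qed
  then show ?thesis using mate_eq[OF _ _ ln] cell_griddingD(1)[OF kg] V by blast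
qed

end

section \<open>Arcs along a coil, and other griddings of it\<close>

locale coil = cycle_matrix +
  fixes p :: "nat list" and cc :: "nat \<Rightarrow> nat \<times> nat" and w :: "nat \<Rightarrow> nat" and lab :: "nat \<Rightarrow> nat \<times> nat"
  assumes cell_coil: "cell_coil M m n c r p cc w lab"
begin

abbreviation "N \<equiv> length p"
abbreviation "arr \<equiv> cell_arrow c r p cc"

definition L :: "nat \<Rightarrow> nat \<times> nat" where
  "L i = lab ((i - 1) mod l + 1)"

lemma coil_perm: "is_perm p" and coil_cells: "cell_gridding M m n p cc" and l_less_N: "l < N"
  and bij_w: "bij_betw w {1..N} {0..<N}" and bij_lab: "bij_betw lab {1..l} E"
  and cc_w: "1 \<le> i \<Longrightarrow> i \<le> N \<Longrightarrow> cc (w i) = L i"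
  using cell_coil unfolding cell_coil_def Let_def L_def by auto

lemma w_less: "1 \<le> i \<Longrightarrow> i \<le> N \<Longrightarrow> w i < N"
  using bij_w unfolding bij_betw_def by auto

lemma w_inj: "1 \<le> i \<Longrightarrow> i \<le> N \<Longrightarrow> 1 \<le> j \<Longrightarrow> j \<le> N \<Longrightarrow> w i = w j \<Longrightarrow> i = j"
  using bij_w unfolding bij_betw_def inj_on_def by auto

lemma C2: "1 \<le> i \<Longrightarrow> Suc i \<le> N \<Longrightarrow> arr (w i) (w (Suc i))"
  using cell_coil unfolding cell_coil_def Let_def by (metis (no_types, lifting) diff_Suc_1 less_Suc_eq_le)

lemma C3: "1 \<le> i \<Longrightarrow> Suc (i + l) \<le> N \<Longrightarrow> arr (w (Suc (i + l))) (w i)"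
proof -
  assume i: "1 \<le> i" "Suc (i + l) \<le> N"
  have "\<forall>i. l + 1 < i \<and> i \<le> N \<longrightarrow> arr (w i) (w (i - l - 1))" using cell_coil unfolding cell_coil_def Let_def by blast
  from this[rule_format, of "Suc (i + l)"] show ?thesis using i by simp
qed

lemma C4: "arr (w (Suc l)) (w 1)"
  using cell_coil unfolding cell_coil_def Let_def by simp

lemma l3: "3 \<le> l"
proof -
  have "0 < N" using l_less_N by linarith
  then have "cc 0 \<in> E" using cell_griddingD(1)[OF coil_cells] by blast
  then obtain lab' where "cyclic_numbering lab'" using ex_cyclic_numbering by blast
  then show ?thesis unfolding cyclic_numbering_def by blast
qed

lemma L_E: "L i \<in> E"
proof -
  have "(i - 1) mod l + 1 \<in> {1..l}" using l3 by (simp add: Suc_le_eq)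
  then show ?thesis using bij_lab unfolding L_def bij_betw_def by blast
qed

lemma L_Suc_eq: "L (Suc a) = L (Suc b) \<longleftrightarrow> a mod l = b mod l"
proof
  assume h: "L (Suc a) = L (Suc b)"
  have "a mod l + 1 \<in> {1..l}" "b mod l + 1 \<in> {1..l}" using l3 by (simp_all add: Suc_le_eq)
  moreover have "lab (a mod l + 1) = lab (b mod l + 1)" using h unfolding L_def by simp
  moreover have "inj_on lab {1..l}" using bij_lab unfolding bij_betw_def by blast
  ultimately have "a mod l + 1 = b mod l + 1" by (meson inj_onD)
  then show "a mod l = b mod l" by simp
qed (simp add: L_def)

lemma L_eq: "1 \<le> i \<Longrightarrow> 1 \<le> j \<Longrightarrow> L i = L j \<longleftrightarrow> i mod l = j mod l"
  using L_Suc_eq[of "i - 1" "j - 1"] mod_add_left_eq_iff[of 1 "i - 1" l "j - 1"] by simp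

lemma L_add: "1 \<le> i \<Longrightarrow> L (i + l) = L i"
  by (subst L_eq) auto

lemma small_not_mod: "0 < k \<Longrightarrow> k < l \<Longrightarrow> (a + k) mod l \<noteq> a mod l"
proof
  assume k: "0 < k" "k < l" and h: "(a + k) mod l = a mod l"
  then have "k mod l = 0 mod l" using mod_add_left_eq_iff[of a k l 0] by simp
  then show False using k by simp
qed

lemma L_Suc_neq: "1 \<le> i \<Longrightarrow> L (Suc i) \<noteq> L i"
  using L_eq[of "Suc i" i] small_not_mod[of 1 i] l3 by simp

lemma L_SucSuc_neq: "1 \<le> i \<Longrightarrow> L (Suc (Suc i)) \<noteq> L i"
  using L_eq[of "Suc (Suc i)" i] small_not_mod[of 2 i] l3 by simp

text \<open>The direction in which the coil leaves the cell \<open>L i\<close>: within the column if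
  true, within the row otherwise.\<close>

definition D :: "nat \<Rightarrow> bool" where
  "D i \<longleftrightarrow> line True (L (Suc i)) = line True (L i)"

lemma line_D: "1 \<le> i \<Longrightarrow> line (D i) (L (Suc i)) = line (D i) (L i)"
proof -
  assume i: "1 \<le> i"
  define j where "j = Suc ((i - 1) mod l)"
  have j: "1 \<le> j" "j \<le> l" using l3 unfolding j_def by (auto simp: Suc_le_eq)
  have Lj: "L j = L i" "L (Suc j) = L (Suc i)"
  proof -
    have m: "j mod l = i mod l" unfolding j_def using i by (simp add: mod_Suc_eq)
    then show "L j = L i" using L_eq i j by blast
    have "Suc j mod l = Suc i mod l" using m by (metis mod_Suc_eq)
    then show "L (Suc j) = L (Suc i)" using L_eq[of "Suc j" "Suc i"] by simp
  qed
  have "arr (w j) (w (Suc j))" using C2 j l_less_N by simp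
  from arrow_line[OF this] have "line True (L j) = line True (L (Suc j)) \<or> line False (L j) = line False (L (Suc j))"
    using cc_w[of j] cc_w[of "Suc j"] j l_less_N by simp
  then show ?thesis unfolding Lj by (cases "D i") (auto simp: D_def)
qed

lemma L_Suc: "1 \<le> i \<Longrightarrow> L (Suc i) = mate (D i) (L i)"
  using mate_eq[OF L_E L_E line_D L_Suc_neq] by blast

text \<open>Two steps in the same direction would return to the cell they started from, which
  \<open>l \<ge> 3\<close> forbids.\<close>

lemma D_Suc: "1 \<le> i \<Longrightarrow> D (Suc i) = (\<not> D i)"
proof (rule ccontr)
  assume i: "1 \<le> i" and "D (Suc i) \<noteq> (\<not> D i)"
  then have "D (Suc i) = D i" by auto
  then have "L (Suc (Suc i)) = mate (D i) (mate (D i) (L i))" using L_Suc[of i] L_Suc[of "Suc i"] i by simp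
  then show False using mate_mate[OF L_E] L_SucSuc_neq[OF i] by simp
qed

lemma D_add: "1 \<le> i \<Longrightarrow> D (i + l) = D i"
  unfolding D_def using L_add[of i] L_add[of "Suc i"] by simp

lemma cyclic_numbering_L: "cyclic_numbering (\<lambda>a. L (Suc a))"
proof -
  have inj: "inj_on (\<lambda>a. L (Suc a)) {..<l}" by (rule inj_onI) (simp add: L_Suc_eq)
  have "(\<lambda>a. L (Suc a)) ` {..<l} = E"
    using L_E card_image[OF inj] by (intro card_subset_eq finite_E) auto
  then have b: "bij_betw (\<lambda>a. L (Suc a)) {..<l} E" using inj unfolding bij_betw_def by blast
  have share: "\<exists>d. line d (L (Suc i)) = line d (L i)" if "1 \<le> i" for i using line_D[OF that] by blast
  have "near l a b \<longleftrightarrow> (\<exists>d. line d (L (Suc a)) = line d (L (Suc b)))" if ab: "a < l" "b < l" for a b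
  proof
    assume "near l a b"
    then consider "a = b" | "Suc a mod l = b mod l" | "Suc b mod l = a mod l" using ab unfolding near_def by auto
    then show "\<exists>d. line d (L (Suc a)) = line d (L (Suc b))"
    proof cases
      case 2
      then have "L (Suc (Suc a)) = L (Suc b)" using L_Suc_eq by blast
      then show ?thesis using share[of "Suc a"] by (metis le_add1 plus_1_eq_Suc)
    next
      case 3
      then have "L (Suc (Suc b)) = L (Suc a)" using L_Suc_eq by blast
      then show ?thesis using share[of "Suc b"] by (metis le_add1 plus_1_eq_Suc)
    qed simp
  next
    assume "\<exists>d. line d (L (Suc a)) = line d (L (Suc b))"
    then obtain d where d: "line d (L (Suc b)) = line d (L (Suc a))" by metis
    show "near l a b"
    proof (cases "L (Suc b) = L (Suc a)")
      case True
      then show ?thesis using L_Suc_eq unfolding near_def by auto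
    next
      case False
      then have Lb: "L (Suc b) = mate d (L (Suc a))" using mate_eq[OF L_E L_E d] by blast
      show ?thesis
      proof (cases "D (Suc a) = d")
        case True
        then have "L (Suc b) = L (Suc (Suc a))" using L_Suc[of "Suc a"] Lb by simp
        then show ?thesis using L_Suc_eq[of b "Suc a"] unfolding near_def by simp
      next
        case False
        have a: "1 \<le> a + l" using l3 by simp
        have "D (Suc (a + l)) = D (Suc a)" using D_add[of "Suc a"] by simp
        then have "D (a + l) = d" using D_Suc[OF a] False by auto
        then have "L (Suc (a + l)) = mate d (L (a + l))" using L_Suc[OF a] by simp
        then have "L (Suc a) = mate d (L (a + l))" using L_add[of "Suc a"] by simp
        then have "L (Suc b) = L (a + l)" using Lb mate_mate[OF L_E] by simp
        then have "Suc b mod l = (a + l) mod l" using L_eq[of "Suc b" "a + l"] a by simp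
        then show ?thesis unfolding near_def by simp
      qed
    qed
  qed
  then show ?thesis unfolding cyclic_numbering_def using l3 b by (simp add: ex_bool_eq line_def)
qed

definition g :: "nat \<Rightarrow> nat" where
  "g x = the_inv_into {..<l} (\<lambda>a. L (Suc a)) (cc x)"

lemma g: "x < N \<Longrightarrow> g x < l \<and> L (Suc (g x)) = cc x"
proof -
  assume x: "x < N"
  have b: "inj_on (\<lambda>a. L (Suc a)) {..<l}" "(\<lambda>a. L (Suc a)) ` {..<l} = E"
    using cyclic_numbering_L unfolding cyclic_numbering_def bij_betw_def by blast+
  have e: "cc x \<in> (\<lambda>a. L (Suc a)) ` {..<l}" unfolding b(2) using cell_griddingD(1)[OF coil_cells x] .
  show ?thesis using the_inv_into_into[OF b(1) e subset_refl] f_the_inv_into_f[OF b(1) e] unfolding g_def by simp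
qed

sublocale cy: cyc l "{..<N}" g arr
  by (rule cyc_gridded[OF coil_perm coil_cells cyclic_numbering_L g])

lemma g_w: "1 \<le> i \<Longrightarrow> i \<le> N \<Longrightarrow> g (w i) = (i - 1) mod l"
proof -
  assume i: "1 \<le> i" "i \<le> N"
  have "L (Suc (g (w i))) = L (Suc (i - 1))" using g[OF w_less[OF i]] cc_w[OF i] i by simp
  then show ?thesis using L_Suc_eq[of "g (w i)" "i - 1"] g[OF w_less[OF i]] by simp
qed

lemma line_tr:
  assumes a: "1 \<le> a" and V: "1 \<le> i" "i \<le> N" "1 \<le> j" "j \<le> N" "1 \<le> k" "k \<le> N"
    and m: "i mod l \<in> {a mod l, Suc a mod l}" "j mod l \<in> {a mod l, Suc a mod l}" "k mod l \<in> {a mod l, Suc a mod l}"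
    and R: "arr (w i) (w j)" "arr (w j) (w k)"
  shows "arr (w i) (w k)"
proof -
  have *: "g (w i) \<in> {(a - 1) mod l, Suc ((a - 1) mod l) mod l}" if "1 \<le> i" "i \<le> N" "i mod l \<in> {a mod l, Suc a mod l}" for i
  proof -
    have "(i - 1) mod l = (a - 1) mod l \<longleftrightarrow> i mod l = a mod l" "(i - 1) mod l = a mod l \<longleftrightarrow> i mod l = Suc a mod l"
      using mod_add_left_eq_iff[of 1 "i - 1" l "a - 1"] mod_add_left_eq_iff[of 1 "i - 1" l a] that a by auto
    moreover have "Suc ((a - 1) mod l) mod l = a mod l" using a by (simp add: mod_Suc_eq)
    ultimately show ?thesis using g_w[OF that(1,2)] that(3) by auto
  qed
  show ?thesis
    by (rule cy.tr[of "w i" "w j" "w k" "(a - 1) mod l"]) (use V m R * w_less in auto)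
qed

text \<open>Transitivity through \<open>w (Suc (i + l))\<close> or, at the end of the coil, through
  \<open>w (i - 1)\<close>. For \<open>i = 1\<close> this is (C4), which supplies the one arc that
  (C2) and (C3) do not give in a coil of length \<open>l + 1\<close>.\<close>

lemma behind: "1 \<le> i \<Longrightarrow> i + l \<le> N \<Longrightarrow> arr (w (i + l)) (w i)"
proof -
  assume i: "1 \<le> i" "i + l \<le> N"
  consider "Suc (i + l) \<le> N" | "i + l = N" "2 \<le> i" | "i = 1" using i by linarith
  then show ?thesis
  proof cases
    case 1
    have m: "(i + l) mod l = i mod l" "Suc (i + l) mod l = Suc i mod l" by (simp_all add: mod_Suc)
    show ?thesis by (rule line_tr[of i "i + l" "Suc (i + l)" i]) (use i 1 m C2[of "i + l"] C3[of i] in simp_all)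
  next
    case 2
    then obtain k where k: "i = Suc k" "1 \<le> k" by (cases i) auto
    have "arr (w (Suc k + l)) (w k)" "arr (w k) (w (Suc k))" using C3[of k] C2[of k] k 2 by simp_all
    moreover have "Suc (k + l) mod l = Suc k mod l" by (simp add: mod_Suc)
    ultimately show ?thesis unfolding k(1) by (intro line_tr[of k "Suc k + l" k "Suc k"]) (use k i in simp_all)
  next
    case 3
    then show ?thesis using C4 by simp
  qed
qed

lemma back_mult: "1 \<le> i \<Longrightarrow> i + Suc k * l \<le> N \<Longrightarrow> arr (w (i + Suc k * l)) (w i)"
proof (induction k)
  case 0
  then show ?case using behind[of i] by simp
next
  case (Suc k)
  have le: "i + Suc k * l \<le> N" "i + Suc k * l + l \<le> N" using Suc.prems by simp_all
  have e: "i + Suc (Suc k) * l = i + Suc k * l + l" by simp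
  have b: "arr (w (i + Suc k * l + l)) (w (i + Suc k * l))" using behind[of "i + Suc k * l"] Suc.prems(1) le(2) by simp
  have m: "(i + Suc k * l) mod l = i mod l" "(i + Suc k * l + l) mod l = i mod l"
    using mod_mult_self1[of i "Suc k" l] by simp_all
  show ?case unfolding e
    by (rule line_tr[of i "i + Suc k * l + l" "i + Suc k * l" i]) (use Suc.prems le m b Suc.IH[OF Suc.prems(1) le(1)] in \<open>simp_all del: mult_Suc\<close>)
qed

lemma mod_eq_add_mult: "i < (j::nat) \<Longrightarrow> i mod k = j mod k \<Longrightarrow> \<exists>t. j = i + Suc t * k"
proof -
  assume h: "i < j" "i mod k = j mod k"
  then have "k dvd j - i" using mod_eq_dvd_iff_nat[of i j k] by simp
  then obtain t where t: "j - i = k * t" by (elim dvdE)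
  then have "t \<noteq> 0" using h by (cases t) auto
  then obtain t' where "t = Suc t'" using not0_implies_Suc by blast
  then show ?thesis using t h by (intro exI[of _ t']) (simp add: mult.commute)
qed

text \<open>From \<open>w j\<close> one goes back by whole turns and reaches \<open>w i\<close>
  itself or a point from which (C2) or (C3) leads to \<open>w i\<close>. If \<open>i = 1\<close> and
  \<open>j\<close> is one cell before it, there is no point \<open>w 0\<close> to pass through, and
  \<open>w l\<close> takes its place.\<close>

lemma far: "1 \<le> i \<Longrightarrow> i + 2 \<le> j \<Longrightarrow> j \<le> N \<Longrightarrow> near l i j \<Longrightarrow> arr (w j) (w i)"
proof -
  assume i: "1 \<le> i" "i + 2 \<le> j" "j \<le> N" "near l i j"
  have cell: "arr (w b) (w a)" if ab: "1 \<le> a" "a < b" "b \<le> N" "a mod l = b mod l" for a b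
  proof -
    obtain t where "b = a + Suc t * l" using mod_eq_add_mult[OF ab(2,4)] by blast
    then show ?thesis using back_mult ab by blast
  qed
  from i(4) consider "i mod l = j mod l" | "Suc i mod l = j mod l" | "Suc j mod l = i mod l" unfolding near_def by blast
  then show ?thesis
  proof cases
    case 1
    then show ?thesis using cell i by simp
  next
    case 2
    obtain t where t: "j = Suc i + Suc t * l" using mod_eq_add_mult[of "Suc i" j l] 2 i by auto
    then have le: "Suc (i + l) \<le> j" by simp
    have C: "arr (w (Suc (i + l))) (w i)" using C3 i le by simp
    show ?thesis
    proof (cases "j = Suc (i + l)")
      case False
      have m: "Suc (i + l) mod l = Suc i mod l" by (simp add: mod_Suc)
      have "arr (w j) (w (Suc (i + l)))" by (rule cell) (use le False i m 2 in auto)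
      then show ?thesis by (intro line_tr[of i j "Suc (i + l)" i]) (use C i le m 2 in simp_all)
    qed (use C in simp)
  next
    case 3
    show ?thesis
    proof (cases "2 \<le> i")
      case True
      then obtain k where k: "i = Suc k" "1 \<le> k" by (cases i) auto
      have m: "k mod l = j mod l" using 3 k mod_add_left_eq_iff[of 1 k l j] by simp
      have "arr (w j) (w k)" by (rule cell) (use k i m in auto)
      moreover have "arr (w k) (w (Suc k))" using C2[of k] k i by simp
      ultimately show ?thesis unfolding k(1) by (intro line_tr[of k j k "Suc k"]) (use k i m in simp_all)
    next
      case False
      then have i1: "i = 1" using i by simp
      have m: "l mod l = j mod l" using 3 i1 mod_add_left_eq_iff[of 1 j l 0] by simp
      have "l dvd j" using m by (simp add: dvd_eq_mod_eq_0)
      then have jl: "l \<le> j" using i by (auto dest!: dvd_imp_le)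
      have "arr (w l) (w (Suc l))" using C2 l_less_N l3 by simp
      then have 1: "arr (w l) (w 1)" by (intro line_tr[of l l "Suc l" 1]) (use C4 l_less_N l3 in \<open>simp_all add: mod_Suc\<close>)
      show ?thesis
      proof (cases "j = l")
        case False
        have "arr (w j) (w l)" by (rule cell) (use jl False m i l3 in auto)
        then show ?thesis unfolding i1 by (intro line_tr[of l j l 1]) (use 1 i i1 l_less_N l3 m in \<open>simp_all add: mod_Suc\<close>)
      qed (use 1 i1 in simp)
    qed
  qed
qed

text \<open>In the gridding of the coil, \<open>w (Suc i)\<close> lies between \<open>w i\<close>
  and \<open>w (i - l)\<close> in their common line, so \<open>between_mate\<close> determines its
  cell under \<open>kk\<close>.\<close>

lemma step_up:
  assumes kg: "cell_gridding M m n p kk" and i: "l < i" "i < N" "kk (w i) = kk (w (i - l))"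
  shows "kk (w (Suc i)) = mate (D i) (kk (w i))"
proof (rule between_mate[OF coil_perm coil_cells kg])
  have il: "1 \<le> i - l" "Suc (i - l + l) = Suc i" "1 \<le> i" using i by auto
  show "w i < N" "w (Suc i) < N" "w (i - l) < N" using w_less i by auto
  show "cc (w i) = cc (w (i - l))" using cc_w[of i] cc_w[of "i - l"] L_add[OF il(1)] i by simp
  show "line (D i) (cc (w (Suc i))) = line (D i) (cc (w i))" "cc (w (Suc i)) \<noteq> cc (w i)"
    using cc_w[of i] cc_w[of "Suc i"] line_D[OF il(3)] L_Suc_neq[OF il(3)] i by simp_all
  show "arr (w i) (w (Suc i))" using C2 i by simp
  show "arr (w (Suc i)) (w (i - l))" using C3[OF il(1)] il(2) i by simp
qed (rule i(3))

lemma step_down: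
  assumes kg: "cell_gridding M m n p kk" and i: "1 \<le> i" "Suc i + l \<le> N" "kk (w (Suc i)) = kk (w (Suc i + l))"
  shows "kk (w i) = mate (D i) (kk (w (Suc i)))"
proof -
  have "kk (w i) = mate (D i) (kk (w (Suc i + l)))"
  proof (rule between_mate[OF coil_perm coil_cells kg])
    show "w (Suc i + l) < N" "w i < N" "w (Suc i) < N" using w_less i by auto
    show "cc (w (Suc i + l)) = cc (w (Suc i))" using cc_w[of "Suc i"] cc_w[of "Suc i + l"] L_add[of "Suc i"] i by simp
    show "line (D i) (cc (w i)) = line (D i) (cc (w (Suc i + l)))" "cc (w i) \<noteq> cc (w (Suc i + l))"
      using cc_w[of i] cc_w[of "Suc i + l"] L_add[of "Suc i"] line_D[OF i(1)] L_Suc_neq[OF i(1)] i by simp_all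
    show "arr (w (Suc i + l)) (w i)" using C3 i by simp
    show "arr (w i) (w (Suc i))" using C2 i by simp
    show "kk (w (Suc i + l)) = kk (w (Suc i))" using i by simp
  qed
  then show ?thesis using i(3) by simp
qed

text \<open>Both \<open>step_up\<close> and \<open>step_down\<close> need two points one turn apart
  in a common cell; this is why the block to start from has \<open>l + 1\<close> points.\<close>

lemma gridding_extends:
  assumes kg: "cell_gridding M m n p kk" and a: "1 \<le> a" "a + l \<le> N" "\<And>i. a \<le> i \<Longrightarrow> i \<le> a + l \<Longrightarrow> kk (w i) = L i"
    and i: "1 \<le> i" "i \<le> N"
  shows "kk (w i) = L i"
proof -
  have up: "kk (w j) = L j" if "a \<le> j" "j \<le> N" for j
    using that
  proof (induction j rule: less_induct)
    case (less j)
    show ?case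
    proof (cases "j \<le> a + l")
      case False
      then obtain k where k: "j = Suc k" "a + l \<le> k" by (cases j) auto
      have "kk (w k) = L k" "kk (w (k - l)) = L (k - l)" using less.IH less.prems k l3 by auto
      moreover have "L k = L (k - l)" using L_add[of "k - l"] k a by simp
      ultimately have "kk (w (Suc k)) = mate (D k) (L k)" using step_up[OF kg, of k] k a less.prems by simp
      then show ?thesis using L_Suc[of k] k a by simp
    qed (use a less.prems in simp)
  qed
  have down: "kk (w (a - j)) = L (a - j)" if "j < a" for j
    using that
  proof (induction j rule: less_induct)
    case (less j)
    show ?case
    proof (cases j)
      case 0
      then show ?thesis using a(3)[of a] by simp
    next
      case (Suc j')
      define k where "k = a - Suc j'"
      have k: "Suc k = a - j'" "1 \<le> k" "Suc k + l \<le> N" using less.prems Suc a unfolding k_def by auto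
      have kj: "kk (w (Suc k)) = L (Suc k)" using less.IH[of j'] less.prems Suc k by simp
      have "kk (w (Suc k + l)) = L (Suc k + l)"
      proof (cases "a \<le> Suc k + l")
        case True
        then show ?thesis using up k by simp
      next
        case False
        then have "j' - l < j" "j' - l < a" "a - (j' - l) = Suc k + l" using k Suc less.prems by auto
        then show ?thesis using less.IH[of "j' - l"] by simp
      qed
      then have "kk (w k) = mate (D k) (L (Suc k))" using step_down[OF kg k(2,3)] kj L_add[of "Suc k"] by simp
      then show ?thesis using L_Suc[OF k(2)] mate_mate[OF L_E] Suc unfolding k_def by simp
    qed
  qed
  show ?thesis
  proof (cases "a \<le> i")
    case False
    then show ?thesis using down[of "a - i"] i by simp
  qed (use up i in simp)
qed

text \<open>The cells met in one turn are closed under both mates, as the directions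
  \<open>D i\<close> and \<open>D (i - 1)\<close> are the two possible ones; then
  \<open>mates_closed\<close> applies.\<close>

lemma neighbours_all:
  assumes b: "1 < b" and f_E: "\<And>i. f i \<in> E"
    and up: "\<And>i. b \<le> i \<Longrightarrow> i < b + l \<Longrightarrow> f (Suc i) = mate (D i) (f i)"
    and down: "\<And>i. b \<le> i \<Longrightarrow> i < b + l \<Longrightarrow> f (i - 1) = mate (D (i - 1)) (f i)"
    and wrap: "f (b + l) = f b" "f (b - 1 + l) = f (b - 1)"
  shows "f ` {b..<b + l} = E"
proof -
  have m: "mate d e \<in> f ` {b..<b + l}" if e: "e \<in> f ` {b..<b + l}" for d e
  proof -
    obtain i where i: "e = f i" "b \<le> i" "i < b + l" using e by auto
    have "1 \<le> i - 1" "Suc (i - 1) = i" using b i by auto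
    then have "D i = (\<not> D (i - 1))" using D_Suc[of "i - 1"] by simp
    then consider "d = D i" | "d = D (i - 1)" by auto
    then show ?thesis
    proof cases
      case 1
      then have "mate d e = f (Suc i)" using up i by simp
      moreover have "f (Suc i) \<in> f ` {b..<b + l}"
        using i wrap(1) l3 by (cases "Suc i = b + l") (auto intro!: image_eqI[of _ f b])
      ultimately show ?thesis by simp
    next
      case 2
      then have "mate d e = f (i - 1)" using down i by simp
      moreover have "f (i - 1) \<in> f ` {b..<b + l}"
      proof (cases "i = b")
        case True
        have "b - 1 + l \<in> {b..<b + l}" using b l3 by auto
        then show ?thesis using wrap(2) True by (metis imageI)
      next
        case False
        then have "i - 1 \<in> {b..<b + l}" using i by auto
        then show ?thesis by (rule imageI)
      qed
      ultimately show ?thesis by simp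
    qed
  qed
  show ?thesis
  proof (rule mates_closed)
    show "f ` {b..<b + l} \<subseteq> E" using f_E by auto
    show "f ` {b..<b + l} \<noteq> {}" using l3 by auto
    show "col_mate e \<in> f ` {b..<b + l}" if "e \<in> f ` {b..<b + l}" for e using m[OF that, of True] unfolding mate_def by simp
    show "row_mate e \<in> f ` {b..<b + l}" if "e \<in> f ` {b..<b + l}" for e using m[OF that, of False] unfolding mate_def by simp
  qed
qed

text \<open>During one turn both griddings run through all cells by the same kinds of mates, and
  both order the lines as the coordinates of the points do. So the passage from the lines of one to
  those of the other is monotone and onto, hence the identity by
  \<open>mono_surj_id\<close>.\<close>

lemma block_unique:
  assumes kg: "cell_gridding M m n p kk" and b: "l < b" "b + 2 * l \<le> N"
    and per: "\<And>i. b - l \<le> i \<Longrightarrow> i < b + l \<Longrightarrow> kk (w (i + l)) = kk (w i)"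
    and i: "b \<le> i" "i < b + l"
  shows "kk (w i) = L i"
proof -
  \<comment> \<open>Extended by \<open>L\<close> beyond the coil because
    \<open>neighbours_all\<close> asks for a cell at every index.\<close>
  define K where "K i = (if 1 \<le> i \<and> i \<le> N then kk (w i) else L i)" for i
  have K: "K i = kk (w i)" if "1 \<le> i" "i \<le> N" for i using that unfolding K_def by simp
  have K_E: "K i \<in> E" for i unfolding K_def using L_E cell_griddingD(1)[OF kg w_less] by auto
  have perK: "K (i + l) = K i" if "b - l \<le> i" "i < b + l" for i using per[OF that] K[of i] K[of "i + l"] that b by simp
  have upK: "K (Suc i) = mate (D i) (K i)" if i: "b \<le> i" "i < b + l" for i
  proof -
    have "kk (w i) = kk (w (i - l))" using per[of "i - l"] i b by simp
    then show ?thesis using step_up[OF kg, of i] K[of i] K[of "Suc i"] i b by simp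
  qed
  have downK: "K (i - 1) = mate (D (i - 1)) (K i)" if i: "b \<le> i" "i < b + l" for i
  proof -
    obtain k where k: "i = Suc k" "1 \<le> k" using i b l3 by (cases i) auto
    have "kk (w (Suc k)) = kk (w (Suc k + l))" using per[of i] i b k by simp
    then show ?thesis using step_down[OF kg, of k] K[of k] K[of i] i b k by simp
  qed
  have b1: "1 < b" using b l3 by simp
  have KE: "K ` {b..<b + l} = E"
    by (rule neighbours_all[OF b1 K_E upK downK]) (use perK[of b] perK[of "b - 1"] b l3 in auto)
  have upL: "L (Suc i) = mate (D i) (L i)" if "b \<le> i" for i using L_Suc[of i] that b1 by simp
  have downL: "L (i - 1) = mate (D (i - 1)) (L i)" if i: "b \<le> i" for i
  proof -
    obtain k where k: "i = Suc k" "1 \<le> k" using i b1 by (cases i) auto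
    then show ?thesis using L_Suc[of k] mate_mate[OF L_E] by simp
  qed
  have LE: "L ` {b..<b + l} = E"
    by (rule neighbours_all[OF b1 L_E upL downL]) (use L_add[of b] L_add[of "b - 1"] b1 in auto)
  have injL: "i = j" if "i \<in> {b..<b + l}" "j \<in> {b..<b + l}" "L i = L j" for i j
  proof -
    have m: "i mod l = j mod l" using L_eq[of i j] that b1 by simp
    show ?thesis
    proof (rule linorder_cases[of i j])
      assume "i < j"
      from mod_eq_add_mult[OF this m] have "i + l \<le> j" by auto
      then show ?thesis using that(1,2) by simp
    next
      assume "j < i"
      from mod_eq_add_mult[OF this m[symmetric]] have "j + l \<le> i" by auto
      then show ?thesis using that(1,2) by simp
    qed
  qed
  have line_eq: "line d (K i) = line d (L i)" if i: "i \<in> {b..<b + l}" for i d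
  proof (rule sym, rule mono_surj_id[where a = "\<lambda>i. line d (L i)" and b = "\<lambda>i. line d (K i)" and J = "{b..<b + l}", OF _ _ _ _ i])
    show "finite {b..<b + l}" by simp
    show "(\<lambda>i. line d (L i)) ` {b..<b + l} = (\<lambda>i. line d (K i)) ` {b..<b + l}"
      using arg_cong[OF trans[OF LE KE[symmetric]], of "image (line d)"] by (simp only: image_image)
    show "line d (K i) \<le> line d (K j)" if ij: "i \<in> {b..<b + l}" "j \<in> {b..<b + l}" "line d (L i) < line d (L j)" for i j
    proof -
      have R: "1 \<le> i" "i \<le> N" "1 \<le> j" "j \<le> N" using ij b b1 by auto
      have "\<not> coord p d (w j) < coord p d (w i)"
        using line_mono[OF coil_cells w_less[OF R(3,4)] w_less[OF R(1,2)], of d] ij(3) cc_w R by auto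
      moreover have "coord p d (w j) \<noteq> coord p d (w i)"
      proof
        assume "coord p d (w j) = coord p d (w i)"
        then have "w j = w i" using is_perm_nth_eq[OF coil_perm w_less[OF R(3,4)] w_less[OF R(1,2)]] unfolding coord_def by (auto split: if_splits)
        then have "j = i" using w_inj[OF R(3,4) R(1,2)] by simp
        then show False using ij(3) by simp
      qed
      ultimately show ?thesis using line_mono[OF kg w_less[OF R(1,2)] w_less[OF R(3,4)], of d] K R by simp
    qed
    \<comment> \<open>Cells on a common line are neighbours along the coil, and both sequences pass
      between these neighbours in the same direction.\<close>
    show "line d (K i) = line d (K j)" if ij: "i \<in> {b..<b + l}" "j \<in> {b..<b + l}" "line d (L i) = line d (L j)" for i j
    proof (cases "L j = L i")
      case True
      then show ?thesis using injL[OF ij(1,2)] by simp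
    next
      case False
      have Lj: "L j = mate d (L i)" by (rule mate_eq[OF L_E L_E ij(3)[symmetric] False])
      obtain k where k: "i = Suc k" "1 \<le> k" using ij b1 by (cases i) auto
      have "D i = (\<not> D (i - 1))" using D_Suc[OF k(2)] k by simp
      then consider "d = D i" | "d = D (i - 1)" by auto
      then have "K j = mate d (K i)"
      proof cases
        case 1
        then have Ls: "L j = L (Suc i)" using Lj upL[of i] ij by simp
        have "K j = K (Suc i)"
        proof (cases "Suc i = b + l")
          case True
          then have "j = b" using injL[of j b] ij Ls L_add[of b] b1 l3 by simp
          then show ?thesis using perK[of b] True l3 by simp
        next
          case False
          then have "j = Suc i" using injL[of j "Suc i"] ij Ls by simp
          then show ?thesis by simp
        qed
        then show ?thesis using upK[of i] ij 1 by simp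
      next
        case 2
        then have Ls: "L j = L (i - 1)" using Lj downL[of i] ij by simp
        have "K j = K (i - 1)"
        proof (cases "i = b")
          case True
          have "b - 1 + l \<in> {b..<b + l}" using b1 l3 by auto
          then have "j = b - 1 + l" using injL[of j "b - 1 + l"] ij Ls L_add[of "b - 1"] b1 True by simp
          then show ?thesis using perK[of "b - 1"] True l3 by simp
        next
          case False
          then have "i - 1 \<in> {b..<b + l}" using ij(1) by auto
          then have "j = i - 1" using injL[OF ij(2) _ Ls] by simp
          then show ?thesis by simp
        qed
        then show ?thesis using downK[of i] ij 2 by simp
      qed
      then show ?thesis using mate(2)[OF K_E] by simp
    qed
  qed
  have "K i = L i" using line_eq[of i True] line_eq[of i False] i unfolding line_def by (simp add: prod_eq_iff)
  then show ?thesis using K[of i] i b b1 by simp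
qed

lemma sgn_line_cases: "sgn_line d (L i) = 1 \<or> sgn_line d (L i) = -1"
  using cellD(5,6)[OF L_E, of i] unfolding sgn_line_def by auto

text \<open>Along w i, w (i + l), ... the rows and columns of another gridding can only change in one direction.
  Hence the bounded sum S is constant on a long interval, where the other gridding is periodic.\<close>

lemma gridding_unique:
  assumes kg: "cell_gridding M m n p kk" and N: "1 + (2 * (l * (m + n)) + 1) * (2 * l) + 2 * l \<le> N"
    and i: "1 \<le> i" "i \<le> N"
  shows "kk (w i) = L i"
proof -
  \<comment> \<open>The sign turns the change along \<open>w i\<close>, \<open>w (i + l)\<close>,
    ... into an increase for either orientation of the line.\<close>
  define ps where "ps d i = - sgn_line d (L i) * int (line d (kk (w i)))" for d i
  define f where "f i = ps True i + ps False i" for i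
  \<comment> \<open>From \<open>i\<close> to \<open>Suc i\<close> the sum over one turn changes by
    \<open>f (i + l) - f i\<close>. So \<open>S\<close> is monotone in the ordinary index, and where
    it is constant, \<open>f\<close> repeats after one turn.\<close>
  define S where "S i = (\<Sum>t<l. f (i + t))" for i
  have ps_le: "ps d i \<le> ps d (i + l)" if i: "1 \<le> i" "i + l \<le> N" for d i
  proof -
    have V: "w i < N" "w (i + l) < N" using w_less i by auto
    have cc: "cc (w i) = L i" "cc (w (i + l)) = L i" using cc_w i L_add by auto
    have "before p d (sgn_line d (L i)) (w (i + l)) (w i)"
      using arrow_before[OF coil_perm coil_cells V(2,1), of d] behind[OF i] cc by simp
    then have "if sgn_line d (L i) = 1 then line d (kk (w (i + l))) \<le> line d (kk (w i)) else line d (kk (w i)) \<le> line d (kk (w (i + l)))"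
      using line_mono[OF kg V(1,2), of d] line_mono[OF kg V(2,1), of d] unfolding before_def by (auto split: if_splits)
    then show ?thesis using sgn_line_cases[of d i] L_add[OF i(1)] unfolding ps_def by auto
  qed
  have f_le: "f i \<le> f (i + l)" if "1 \<le> i" "i + l \<le> N" for i
    unfolding f_def using ps_le[OF that, of True] ps_le[OF that, of False] by simp
  have f_eq: "kk (w (i + l)) = kk (w i)" if i: "1 \<le> i" "i + l \<le> N" "f (i + l) = f i" for i
  proof -
    have "ps d (i + l) = ps d i" for d
      using ps_le[OF i(1,2), of True] ps_le[OF i(1,2), of False] i(3) unfolding f_def by (cases d) auto
    then have "sgn_line d (L i) * int (line d (kk (w (i + l)))) = sgn_line d (L i) * int (line d (kk (w i)))" for d
      using L_add[OF i(1)] unfolding ps_def by (metis minus_mult_left neg_equal_iff_equal)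
    moreover have "sgn_line d (L i) \<noteq> 0" for d using sgn_line_cases[of d i] by auto
    ultimately have "line d (kk (w (i + l))) = line d (kk (w i))" for d by (metis mult_cancel_left of_nat_eq_iff)
    from this[of True] this[of False] show ?thesis unfolding line_def by (simp add: prod_eq_iff)
  qed
  have S_Suc: "S (Suc i) + f i = S i + f (i + l)" for i
    using sum.lessThan_Suc_shift[of "\<lambda>t. f (i + t)" l] unfolding S_def by simp
  have f_bd: "\<bar>f i\<bar> \<le> int (m + n)" if "1 \<le> i" "i \<le> N" for i
  proof -
    have "kk (w i) \<in> E" using cell_griddingD(1)[OF kg w_less[OF that]] .
    then have "line True (kk (w i)) \<le> m" "line False (kk (w i)) \<le> n"
      using cellD(1,2)[of "kk (w i)"] unfolding line_def by auto
    moreover have ps: "\<bar>ps d i\<bar> = int (line d (kk (w i)))" for d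
      using sgn_line_cases[of d i] unfolding ps_def by (auto simp: abs_mult)
    ultimately show ?thesis
      unfolding f_def using abs_triangle_ineq[of "ps True i" "ps False i"] ps[of True] ps[of False] by linarith
  qed
  have "\<exists>i\<ge>1. i + 2 * l \<le> N - 2 * l \<and> (\<forall>j. i \<le> j \<and> j < i + 2 * l \<longrightarrow> S (Suc j) = S j)"
  \<comment> \<open>The bound sums \<open>l\<close> terms of absolute value at most
    \<open>m + n\<close>. A stretch of \<open>2 * l\<close> is what \<open>block_unique\<close> asks
    for, and the last \<open>2 * l\<close> indices are set aside so that all points one turn later
    exist.\<close>
  proof (rule constant_interval[of "N - 2 * l" S "l * (m + n)" "2 * l"])
    show "S i \<le> S (Suc i)" if "1 \<le> i" "i < N - 2 * l" for i
      using S_Suc[of i] f_le[OF that(1)] that(2) by linarith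
    show "\<bar>S i\<bar> \<le> int (l * (m + n))" if i: "1 \<le> i" "i \<le> N - 2 * l" for i
    proof -
      have "\<bar>S i\<bar> \<le> (\<Sum>t<l. \<bar>f (i + t)\<bar>)" unfolding S_def by (rule sum_abs)
      also have "\<dots> \<le> (\<Sum>t<l. int (m + n))" by (rule sum_mono) (use f_bd i in auto)
      finally show ?thesis by simp
    qed
    show "1 + (2 * (l * (m + n)) + 1) * (2 * l) \<le> N - 2 * l" using N by simp
  qed
  then obtain a where a: "1 \<le> a" "a + 2 * l \<le> N - 2 * l" "\<And>j. a \<le> j \<Longrightarrow> j < a + 2 * l \<Longrightarrow> S (Suc j) = S j" by blast
  define b where "b = a + l"
  have per: "kk (w (j + l)) = kk (w j)" if j: "b - l \<le> j" "j < b + l" for j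
  proof (rule f_eq)
    show "1 \<le> j" "j + l \<le> N" using j a unfolding b_def by auto
    have "S (Suc j) = S j" using a(3)[of j] j unfolding b_def by simp
    then show "f (j + l) = f j" using S_Suc[of j] by simp
  qed
  have b: "l < b" "b + 2 * l \<le> N" using a unfolding b_def by auto
  note bu = block_unique[OF kg b per]
  have "kk (w j) = L j" if j: "b \<le> j" "j \<le> b + l" for j
  proof (cases "j = b + l")
    case True
    have "kk (w (b + l)) = kk (w b)" using per[of b] l3 by simp
    then show ?thesis using bu[of b] L_add[of b] b l3 True by simp
  next
    case False
    then show ?thesis using bu[of j] j by simp
  qed
  then show ?thesis using gridding_extends[OF kg, of b i] b i by simp
qed

text \<open>By \<open>far\<close>, an arc from a smaller to a larger index can only lead to the next
  point. This and \<open>arrow_backward\<close> translate arcs preserved by an embedding into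
  inequalities between indices.\<close>

lemma arrow_forward:
  assumes "1 \<le> a" "a \<le> N" "1 \<le> b" "b \<le> N" "arr (w a) (w b)" "Suc a mod l = b mod l"
  shows "b \<le> Suc a"
proof (rule ccontr)
  assume "\<not> ?thesis"
  then have "arr (w b) (w a)" using far[of a b] assms unfolding near_def by simp
  then show False using cy.asym[of "w a" "w b"] w_less assms by simp
qed

lemma arrow_backward:
  assumes "1 \<le> a" "a \<le> N" "1 \<le> b" "b \<le> N" "arr (w a) (w b)" "Suc b mod l = a mod l"
  shows "Suc b + l \<le> a"
proof -
  have asym: "\<not> arr (w b) (w a)" using cy.asym[of "w a" "w b"] w_less assms by simp
  have "\<not> a + 2 \<le> b" using far[of a b] asym assms unfolding near_def by auto
  moreover have "b \<noteq> a" using assms(6) small_not_mod[of 1 a] l3 by auto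
  moreover have "b \<noteq> Suc a"
  proof
    assume "b = Suc a"
    then have "(a + 2) mod l = a mod l" using assms(6) by simp
    then show False using small_not_mod[of 2 a] l3 by simp
  qed
  moreover have "a \<noteq> Suc b" using C2[of b] asym assms by auto
  ultimately have "Suc b < a" by linarith
  then obtain t where "a = Suc b + Suc t * l" using mod_eq_add_mult[of "Suc b" a l] assms(6) by blast
  then show ?thesis by simp
qed

abbreviation "infl \<equiv> end_inflate M m n p w lab"

lemma infl_blowup:
  shows "is_perm infl" and "length infl = N + 2"
    and "\<exists>\<pi>. blowup infl p \<pi> {w 1, w N} (\<lambda>i. M (fst (cc i)) (snd (cc i)) = 1)"
proof -
  let ?s = "\<lambda>i. M (fst (cc i)) (snd (cc i)) = 1"
  have N: "1 < N" using l_less_N l3 by simp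
  have L1: "lab 1 = L 1" "lab ((N - 1) mod l + 1) = L N" unfolding L_def using l3 by auto
  have x: "w 1 < N" "w N < N" "w 1 \<noteq> w N" using w_less w_inj[of 1 N] N by auto
  have s: "?s (w 1) \<longleftrightarrow> M (fst (lab 1)) (snd (lab 1)) = 1"
    "?s (w N) \<longleftrightarrow> M (fst (lab ((N - 1) mod l + 1))) (snd (lab ((N - 1) mod l + 1))) = 1"
    using cc_w[of 1] cc_w[of N] N unfolding L1 by auto
  have infl: "infl = (if w 1 < w N then inflate (inflate p (w N) (?s (w N))) (w 1) (?s (w 1))
     else inflate (inflate p (w 1) (?s (w 1))) (w N) (?s (w N)))"
    unfolding end_inflate_def Let_def s ..
  have two: "is_perm (inflate (inflate p a (?s a)) b (?s b)) \<and> length (inflate (inflate p a (?s a)) b (?s b)) = N + 2 \<and>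
    (\<exists>\<pi>. blowup (inflate (inflate p a (?s a)) b (?s b)) p \<pi> {b, a} ?s)" if ab: "a < N" "b < a" for a b
  proof -
    let ?q = "inflate p a (?s a)"
    have b1: "blowup ?q p (collapse a) {a} ?s"
      using blowup_inflate[OF blowup_id coil_perm ab(1), of ?s] by simp
    have q: "is_perm ?q" "length ?q = Suc N" using inflate_is_perm[OF coil_perm ab(1)] length_inflate[OF ab(1)] by auto
    have bq: "b < length ?q" using ab q(2) by simp
    have cb: "collapse a b = b" using ab unfolding collapse_def by simp
    have "blowup (inflate ?q b (?s (collapse a b))) p (\<lambda>y. collapse a (collapse b y)) (insert (collapse a b) {a}) ?s"
    proof (rule blowup_inflate[OF b1 q(1) bq])
      show "y = b" if "y < length ?q" "collapse a y = collapse a b" for y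
        using that ab unfolding collapse_def by (auto split: if_splits)
    qed
    then have "blowup (inflate ?q b (?s b)) p (\<lambda>y. collapse a (collapse b y)) {b, a} ?s" unfolding cb .
    moreover have "is_perm (inflate ?q b (?s b))" by (rule inflate_is_perm[OF q(1) bq])
    moreover have "length (inflate ?q b (?s b)) = N + 2" unfolding length_inflate[OF bq] q(2) by simp
    ultimately show ?thesis by blast
  qed
  have "is_perm infl \<and> length infl = N + 2 \<and> (\<exists>\<pi>. blowup infl p \<pi> {w 1, w N} ?s)"
  proof (cases "w 1 < w N")
    case True
    then show ?thesis unfolding infl using two[OF x(2) True] by simp
  next
    case False
    then have "w N < w 1" using x by simp
    from two[OF x(1) this] show ?thesis unfolding infl using False by (simp add: insert_commute)
  qed
  then show "is_perm infl" "length infl = N + 2" "\<exists>\<pi>. blowup infl p \<pi> {w 1, w N} ?s" by blast+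
qed

end

section \<open>Embeddings of end-inflated coils\<close>

lemma pattern_emb_comp:
  assumes "pattern_emb p q f" "pattern_emb q s h"
  shows "pattern_emb p s (\<lambda>x. h (f x))"
  using pattern_embD[OF assms(1)] pattern_embD[OF assms(2)] unfolding pattern_emb_def by simp

text \<open>Along \<open>l + 1\<close> consecutive steps, increments of at most one add up to at
  least \<open>l + 1\<close>, so each equals one. Every step belongs to such a stretch.\<close>

lemma unit_steps:
  fixes t :: "nat \<Rightarrow> nat"
  assumes up: "\<And>i. 1 \<le> i \<Longrightarrow> i < N \<Longrightarrow> t (Suc i) \<le> Suc (t i)"
    and jump: "\<And>i. 1 \<le> i \<Longrightarrow> Suc (i + l) \<le> N \<Longrightarrow> Suc (t i) + l \<le> t (Suc (i + l))"
    and N: "l + 2 \<le> N" and i: "1 \<le> i" "i \<le> N"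
  shows "t i = t 1 + (i - 1)"
proof -
  have ups: "t (i + k) \<le> t i + k" if "1 \<le> i" "i + k \<le> N" for i k
    using that(2)
  proof (induction k)
    case (Suc k)
    then show ?case using up[of "i + k"] that(1) by simp
  qed simp
  have blk: "t (i + j) = t i + j" if "1 \<le> i" "Suc (i + l) \<le> N" "j \<le> Suc l" for i j
  proof -
    have "t (i + j + (Suc l - j)) \<le> t (i + j) + (Suc l - j)" using ups[of "i + j" "Suc l - j"] that by simp
    moreover have "i + j + (Suc l - j) = Suc (i + l)" using that by simp
    ultimately show ?thesis using jump[OF that(1,2)] ups[of i j] that by simp
  qed
  have step: "t (Suc i) = Suc (t i)" if "1 \<le> i" "i < N" for i
  proof (cases "Suc (i + l) \<le> N")
    case True
    then show ?thesis using blk[of i 1] that by simp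
  next
    case False
    define a where "a = N - Suc l"
    have a: "1 \<le> a" "Suc (a + l) \<le> N" "a \<le> i" using N False that unfolding a_def by auto
    then have "t (a + Suc (i - a)) = t a + Suc (i - a)" "t (a + (i - a)) = t a + (i - a)"
      using blk[OF a(1,2), of "Suc (i - a)"] blk[OF a(1,2), of "i - a"] that unfolding a_def by auto
    then show ?thesis using a by simp
  qed
  have "t (Suc k) = t 1 + k" if "Suc k \<le> N" for k
    using that by (induction k) (use step in auto)
  from this[of "i - 1"] show ?thesis using i by simp
qed

context cycle_matrix
begin

text \<open>Only an end point of a coil has a twin, so an embedding maps end points to end points.\<close>

lemma infl_le_length:
  assumes A: "cell_coil M m n c r p cc w lab" and A': "cell_coil M m n c r p' cc' w' lab'"
    and lab: "\<And>i. i \<in> {1..l} \<Longrightarrow> lab i = lab' i"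
    and le: "perm_le (end_inflate M m n p w lab) (end_inflate M m n p' w' lab')"
    and big: "1 + (2 * (l * (m + n)) + 1) * (2 * l) + 2 * l \<le> length p"
  shows "length p = length p'"
proof -
  interpret A: coil M m n c r p cc w lab using A by unfold_locales
  interpret A': coil M m n c r p' cc' w' lab' using A' by unfold_locales
  define \<alpha> where "\<alpha> = end_inflate M m n p w lab"
  define \<alpha>' where "\<alpha>' = end_inflate M m n p' w' lab'"
  have LL: "A'.L i = A.L i" for i
  proof -
    have "(i - 1) mod l + 1 \<in> {1..l}" using A.l3 by (simp add: Suc_le_eq)
    then show ?thesis unfolding A.L_def A'.L_def using lab by simp
  qed
  obtain \<pi> where \<pi>: "blowup \<alpha> p \<pi> {w 1, w A.N} (\<lambda>i. M (fst (cc i)) (snd (cc i)) = 1)" using A.infl_blowup(3) unfolding \<alpha>_def by blast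
  obtain \<pi>' where \<pi>': "blowup \<alpha>' p' \<pi>' {w' 1, w' A'.N} (\<lambda>i. M (fst (cc' i)) (snd (cc' i)) = 1)" using A'.infl_blowup(3) unfolding \<alpha>'_def by blast
  note pD = blowupD[OF \<pi>] and pD' = blowupD[OF \<pi>']
  obtain f where f: "pattern_emb \<alpha> \<alpha>' f" using le unfolding perm_le_iff \<alpha>_def \<alpha>'_def by blast
  have cg': "cell_gridding M m n \<alpha>' (\<lambda>y. cc' (\<pi>' y))" by (rule cell_gridding_blowup[OF \<pi>' A'.coil_cells])
  have N2: "l + 2 \<le> A.N"
  proof -
    have "1 * (2 * l) \<le> (2 * (l * (m + n)) + 1) * (2 * l)" by (rule mult_le_mono1) simp
    then show ?thesis using big A.l3 by linarith
  qed
  define ix where "ix y = (THE t. 1 \<le> t \<and> t \<le> A'.N \<and> w' t = \<pi>' (f y))" for y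
  have ix: "1 \<le> ix y \<and> ix y \<le> A'.N \<and> w' (ix y) = \<pi>' (f y)" if y: "y < length \<alpha>" for y
  proof -
    have "\<pi>' (f y) < A'.N" using pD'(1) pattern_embD(2)[OF f] y by blast
    then have "\<pi>' (f y) \<in> w' ` {1..A'.N}" using A'.bij_w unfolding bij_betw_def by simp
    then obtain t where t: "1 \<le> t \<and> t \<le> A'.N \<and> w' t = \<pi>' (f y)" by auto
    have "s = t" if "1 \<le> s \<and> s \<le> A'.N \<and> w' s = \<pi>' (f y)" for s using A'.w_inj[of s t] that t by simp
    with t have "\<exists>!t. 1 \<le> t \<and> t \<le> A'.N \<and> w' t = \<pi>' (f y)" by blast
    then show ?thesis unfolding ix_def by (rule theI')
  qed
  \<comment> \<open>One copy of each point is chosen by \<open>\<phi>\<close>. Pulled back to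
    \<open>p\<close>, the gridding of the target is the gridding of the coil itself by
    \<open>gridding_unique\<close>. So cells are preserved, and with them the arcs between different
    cells, to which \<open>unit_steps\<close> can be applied.\<close>
  have steps: "ix (\<phi> (w i)) = ix (\<phi> (w 1)) + (i - 1)"
    if \<phi>: "\<And>i. i < A.N \<Longrightarrow> \<phi> i < length \<alpha> \<and> \<pi> (\<phi> i) = i" and i: "1 \<le> i" "i \<le> A.N" for \<phi> i
  proof -
    have e\<phi>: "pattern_emb p \<alpha>' (\<lambda>x. f (\<phi> x))" by (rule pattern_emb_comp[OF blowup_section[OF \<pi> \<phi>] f])
    note F = pattern_embD[OF e\<phi>]
    have kg: "cell_gridding M m n p (\<lambda>x. cc' (\<pi>' (f (\<phi> x))))" by (rule cell_gridding_pattern[OF e\<phi> cg'])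
    define t where "t i = ix (\<phi> (w i))" for i
    have t: "1 \<le> t i" "t i \<le> A'.N" "w' (t i) = \<pi>' (f (\<phi> (w i)))" if "1 \<le> i" "i \<le> A.N" for i
      using ix \<phi> A.w_less[OF that] unfolding t_def by blast+
    have cell: "cc' (w' (t i)) = A.L i" if "1 \<le> i" "i \<le> A.N" for i
      unfolding t(3)[OF that] by (rule A.gridding_unique[OF kg big that])
    have tm: "t i mod l = i mod l" if i: "1 \<le> i" "i \<le> A.N" for i
      using A'.cc_w[OF t(1,2)[OF i]] cell[OF i] LL A.L_eq[OF t(1)[OF i] i(1)] by simp
    have arr: "A'.arr (w' (t i)) (w' (t j))"
      if i: "1 \<le> i" "i \<le> A.N" and j: "1 \<le> j" "j \<le> A.N" and a: "A.arr (w i) (w j)" and ne: "A.L i \<noteq> A.L j" for i j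
    proof -
      note V = A.w_less[OF i] A.w_less[OF j]
      have V': "w' (t i) < A'.N" "w' (t j) < A'.N" using A'.w_less[OF t(1,2)[OF i]] A'.w_less[OF t(1,2)[OF j]] .
      obtain d where d: "line d (cc (w i)) = line d (cc (w j))" using arrow_line[OF a] by blast
      have cc: "cc (w i) = A.L i" "cc (w j) = A.L j" using A.cc_w i j by auto
      have b: "before p d (sgn_line d (A.L i)) (w i) (w j)"
        using arrow_before[OF A.coil_perm A.coil_cells V d] a cc by simp
      have mono: "coord p' d (w' (t i)) < coord p' d (w' (t j))"
        if i: "1 \<le> i" "i \<le> A.N" and j: "1 \<le> j" "j \<le> A.N" and ne: "A.L i \<noteq> A.L j" and lt: "coord p d (w i) < coord p d (w j)" for i j
      proof -
        note V = A.w_less[OF i] A.w_less[OF j]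
        have ne': "\<pi>' (f (\<phi> (w i))) \<noteq> \<pi>' (f (\<phi> (w j)))" using cell[OF i] cell[OF j] t(3)[OF i] t(3)[OF j] ne by metis
        show ?thesis
        proof (cases d)
          case True
          then have "f (\<phi> (w i)) < f (\<phi> (w j))" using F(1)[of "w i" "w j"] lt V unfolding coord_def by simp
          then have "\<pi>' (f (\<phi> (w i))) \<le> \<pi>' (f (\<phi> (w j)))" using pD'(2) F(2)[OF V(2)] by simp
          then show ?thesis using True ne' t(3)[OF i] t(3)[OF j] unfolding coord_def by simp
        next
          case False
          then have "\<alpha>' ! f (\<phi> (w i)) < \<alpha>' ! f (\<phi> (w j))" using F(3)[OF V] lt unfolding coord_def by simp
          then show ?thesis using False pD'(3)[OF F(2)[OF V(1)] F(2)[OF V(2)] ne'] t(3)[OF i] t(3)[OF j] unfolding coord_def by simp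
        qed
      qed
      have "before p' d (sgn_line d (A.L i)) (w' (t i)) (w' (t j))"
        using b mono[OF i j ne] mono[OF j i ne[symmetric]] unfolding before_def by (auto split: if_splits)
      then show ?thesis
        using arrow_before[OF A'.coil_perm A'.coil_cells V', of d] cell[OF i] cell[OF j] d cc by simp
    qed
    have "t i = t 1 + (i - 1)"
    proof (rule unit_steps[of A.N t l i])
      show "t (Suc i) \<le> Suc (t i)" if i: "1 \<le> i" "i < A.N" for i
      proof (rule A'.arrow_forward)
        show "1 \<le> t i" "t i \<le> A'.N" "1 \<le> t (Suc i)" "t (Suc i) \<le> A'.N" using t(1,2) i by auto
        show "A'.arr (w' (t i)) (w' (t (Suc i)))" using arr[of i "Suc i"] A.C2[of i] A.L_Suc_neq[OF i(1)] i by auto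
        show "Suc (t i) mod l = t (Suc i) mod l" using tm[of i] tm[of "Suc i"] i by (metis less_imp_le Suc_leI le_SucI mod_Suc_eq)
      qed
      show "Suc (t i) + l \<le> t (Suc (i + l))" if i: "1 \<le> i" "Suc (i + l) \<le> A.N" for i
      proof (rule A'.arrow_backward)
        have iN: "i \<le> A.N" using i by simp
        show "1 \<le> t i" "t i \<le> A'.N" "1 \<le> t (Suc (i + l))" "t (Suc (i + l)) \<le> A'.N" using t(1,2) i by auto
        have "A.L (Suc (i + l)) = A.L (Suc i)" using A.L_add[of "Suc i"] by simp
        then show "A'.arr (w' (t (Suc (i + l)))) (w' (t i))" using arr[of "Suc (i + l)" i] A.C3[OF i] A.L_Suc_neq[OF i(1)] i by auto
        have "Suc (t i) mod l = Suc i mod l" using tm[OF i(1) iN] by (metis mod_Suc_eq)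
        moreover have "t (Suc (i + l)) mod l = Suc i mod l" using tm[of "Suc (i + l)"] i by (simp add: mod_Suc)
        ultimately show "Suc (t i) mod l = t (Suc (i + l)) mod l" by simp
      qed
    qed (use N2 i in auto)
    then show ?thesis unfolding t_def .
  qed
  \<comment> \<open>A section through the prescribed copy \<open>y\<close>. At all other points it
    does not depend on \<open>y\<close>, so both copies of one end point are measured against the
    same copy of the other end.\<close>
  define sec where "sec y i = (if i = \<pi> y then y else (SOME y. y < length \<alpha> \<and> \<pi> y = i))" for y i
  have sec: "sec y i < length \<alpha> \<and> \<pi> (sec y i) = i" if "y < length \<alpha>" "i < A.N" for y i
  proof (cases "i = \<pi> y")
    case False
    have "\<exists>y. y < length \<alpha> \<and> \<pi> y = i" using pD(5)[OF that(2)] by blast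
    from someI_ex[OF this] show ?thesis unfolding sec_def using False by simp
  qed (use that sec_def in simp)
  have N1: "1 \<le> A.N" "1 < A.N" using N2 A.l3 by auto
  have wne: "w 1 \<noteq> w A.N" using A.w_inj[of 1 A.N] N1 by auto
  define yN where "yN = (SOME y. y < length \<alpha> \<and> \<pi> y = w A.N)"
  have first: "ix yN = ix y + (A.N - 1)" if y: "y < length \<alpha>" "\<pi> y = w 1" for y
    using steps[of "sec y" A.N] sec[OF y(1)] N1 y wne unfolding sec_def yN_def by auto
  have final: "ix y = ix (sec y (w 1)) + (A.N - 1)" if y: "y < length \<alpha>" "\<pi> y = w A.N" for y
    using steps[of "sec y" A.N] sec[OF y(1)] N1 y unfolding sec_def by auto
  \<comment> \<open>Two points with the same index are mapped to copies of one point of the target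
    coil, which must then be one of its inflated ends.\<close>
  have twin: "ix y = 1 \<or> ix y = A'.N" if yz: "y < z" "z < length \<alpha>" "ix y = ix z" for y z
  proof -
    have V: "y < length \<alpha>" using yz by simp
    have "\<pi>' (f y) = \<pi>' (f z)" using ix[OF V] ix[OF yz(2)] yz(3) by metis
    then have "\<pi>' (f y) \<in> {w' 1, w' A'.N}"
      using pD'(4)[of "f y" "f z"] pattern_embD(1,2)[OF f] yz by blast
    then have "w' (ix y) = w' 1 \<or> w' (ix y) = w' A'.N" using ix[OF V] by simp
    then show ?thesis using A'.w_inj[of "ix y" 1] A'.w_inj[of "ix y" A'.N] ix[OF V] by auto
  qed
  obtain y z where yz: "y < z" "z < length \<alpha>" "\<pi> y = w 1" "\<pi> z = w 1" using pD(6)[of "w 1"] by blast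
  have yl: "y < length \<alpha>" using yz by simp
  have e1: "ix yN = ix y + (A.N - 1)" by (rule first[OF yl yz(3)])
  have ixyN: "ix yN \<le> A'.N"
  proof -
    have "\<exists>y. y < length \<alpha> \<and> \<pi> y = w A.N" using pD(5)[of "w A.N"] A.w_less[of A.N] N1 by blast
    then have "yN < length \<alpha>" unfolding yN_def by (metis (mono_tags, lifting) someI_ex)
    then show ?thesis using ix by blast
  qed
  have "ix y = ix z" using e1 first[OF yz(2,4)] by simp
  then have "ix y = 1 \<or> ix y = A'.N" by (rule twin[OF yz(1,2)])
  \<comment> \<open>If the copies of \<open>w 1\<close> went to the last point of the target, the
    image of \<open>w N\<close> would lie beyond its end.\<close>
  then have y1: "ix y = 1" using e1 ixyN N1 by auto
  have all1: "ix x = 1" if "x < length \<alpha>" "\<pi> x = w 1" for x using first[OF that] e1 y1 by simp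
  obtain y' z' where yz': "y' < z'" "z' < length \<alpha>" "\<pi> y' = w A.N" "\<pi> z' = w A.N" using pD(6)[of "w A.N"] by blast
  have yl': "y' < length \<alpha>" using yz' by simp
  have w1: "w 1 < A.N" using A.w_less[of 1] N1 by simp
  have "ix (sec y' (w 1)) = 1" "ix (sec z' (w 1)) = 1" using all1 sec[OF yl' w1] sec[OF yz'(2) w1] by blast+
  then have e2: "ix y' = A.N" "ix z' = A.N" using final[OF yl' yz'(3)] final[OF yz'(2,4)] N1 by auto
  then have "ix y' = 1 \<or> ix y' = A'.N" by (intro twin[OF yz'(1,2)]) simp
  then show ?thesis using e2(1) N1 by auto
qed

text \<open>\<open>infl_le_length\<close> compares long coils with the same labelling of the cells.
  As there are finitely many labellings, infinitely many of the coils share one, and choosing one of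
  these for each length leaves an infinite sequence without good pairs.\<close>

lemma finite_if_wqo:
  assumes C: "perm_class C" and wqo: "wqo_perms C"
  shows "finite (C \<inter> end_inflated_coils M m n c r)"
proof (rule ccontr)
  assume inf: "infinite (C \<inter> end_inflated_coils M m n c r)"
  \<comment> \<open>The length needed for unique gridding, plus the two points added by the
    inflation.\<close>
  define B where "B = 1 + (2 * (l * (m + n)) + 1) * (2 * l) + 2 * l + 2"
  define is_infl where "is_infl \<alpha> = (\<lambda>(p, cc, w, lab). cell_coil M m n c r p cc w lab \<and> \<alpha> = end_inflate M m n p w lab)" for \<alpha>
  have perm: "is_perm \<alpha>" if "\<alpha> \<in> C" for \<alpha> using C that unfolding perm_class_def by blast
  define X where "X = (C \<inter> end_inflated_coils M m n c r) - {\<alpha>. is_perm \<alpha> \<and> length \<alpha> \<le> B}"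
  have infX: "infinite X" unfolding X_def using inf perm_set_finite[of B] by (metis Diff_infinite_finite)
  have "E \<noteq> {}"
  proof
    assume E: "E = {}"
    obtain \<alpha> where "\<alpha> \<in> X" using infX by (metis ex_in_conv finite.emptyI)
    then obtain p v h w lab where gc: "gridded_coil M m n c r p v h w lab" unfolding X_def end_inflated_coils_def by blast
    then have "is_gridding M m n p v h" "0 < length p" unfolding gridded_coil_def Let_def by auto
    then obtain cc where "cell_gridding M m n p cc" using gridding_cells[OF gm] by metis
    then show False using cell_griddingD(1)[of M m n p cc 0] \<open>0 < length p\<close> E by simp
  qed
  then have l0: "0 < l" using finite_E by (simp add: card_gt_0_iff)
  have "\<exists>q. is_infl \<alpha> q" if \<alpha>: "\<alpha> \<in> X" for \<alpha>
  proof -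
    obtain p v h w lab where gc: "gridded_coil M m n c r p v h w lab" "\<alpha> = end_inflate M m n p w lab"
      using \<alpha> unfolding X_def end_inflated_coils_def by blast
    obtain cc where "cell_coil M m n c r p cc w lab" using cell_coilI[OF gc(1) gm l0] by blast
    then have "is_infl \<alpha> (p, cc, w, lab)" using gc(2) unfolding is_infl_def by simp
    then show ?thesis by blast
  qed
  then obtain Q where Q: "\<And>\<alpha>. \<alpha> \<in> X \<Longrightarrow> is_infl \<alpha> (Q \<alpha>)" by metis
  define labs where "labs \<alpha> = map (snd (snd (snd (Q \<alpha>)))) [1..<Suc l]" for \<alpha>
  have "labs ` X \<subseteq> {xs. set xs \<subseteq> E \<and> length xs = l}"
  proof
    fix xs assume "xs \<in> labs ` X"
    then obtain \<alpha> where \<alpha>: "\<alpha> \<in> X" "xs = labs \<alpha>" by blast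
    obtain p cc w lab where q: "Q \<alpha> = (p, cc, w, lab)" by (metis prod_cases4)
    have "cell_coil M m n c r p cc w lab" using Q[OF \<alpha>(1)] unfolding q is_infl_def by simp
    then have "lab ` {1..l} = E" unfolding cell_coil_def Let_def bij_betw_def by blast
    moreover have "set [1..<Suc l] = {1..l}" by auto
    ultimately show "xs \<in> {xs. set xs \<subseteq> E \<and> length xs = l}" unfolding \<alpha>(2) labs_def q by simp
  qed
  then have "finite (labs ` X)" using finite_lists_length_eq[OF finite_E] finite_subset by blast
  then obtain a0 where a0: "infinite {a \<in> X. labs a = labs a0}" using pigeonhole_infinite[OF infX] by blast
  define Y where "Y = {a \<in> X. labs a = labs a0}"
  have infY: "infinite Y" using a0 unfolding Y_def .
  have YC: "Y \<subseteq> C" unfolding Y_def X_def by blast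
  define I where "I = length ` Y"
  have infI: "infinite I"
  proof
    assume "finite I"
    then obtain k where k: "\<And>a. a \<in> Y \<Longrightarrow> length a \<le> k" unfolding I_def by (meson finite_nat_set_iff_bounded_le imageI)
    then have "Y \<subseteq> {a. is_perm a \<and> length a \<le> k}" using perm YC by blast
    then show False using infY perm_set_finite finite_subset by blast
  qed
  define x where "x k = (SOME a. a \<in> Y \<and> length a = enumerate I k)" for k
  have x: "x k \<in> Y \<and> length (x k) = enumerate I k" for k
  proof -
    have "enumerate I k \<in> I" using enumerate_in_set[OF infI] .
    then have "\<exists>a. a \<in> Y \<and> length a = enumerate I k" unfolding I_def by auto
    then show ?thesis unfolding x_def by (rule someI_ex)
  qed
  have "\<forall>k. x k \<in> C" using x YC by blast
  then obtain i j where ij: "i < j" "perm_le (x i) (x j)" using wqo unfolding wqo_perms_def by blast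
  obtain p cc w lab where q: "Q (x i) = (p, cc, w, lab)" by (metis prod_cases4)
  obtain p' cc' w' lab' where q': "Q (x j) = (p', cc', w', lab')" by (metis prod_cases4)
  have xX: "x i \<in> X" "x j \<in> X" "labs (x i) = labs (x j)" using x[of i] x[of j] unfolding Y_def by auto
  have A: "cell_coil M m n c r p cc w lab" "x i = end_inflate M m n p w lab" using Q[OF xX(1)] unfolding q is_infl_def by auto
  have A': "cell_coil M m n c r p' cc' w' lab'" "x j = end_inflate M m n p' w' lab'" using Q[OF xX(2)] unfolding q' is_infl_def by auto
  interpret A: coil M m n c r p cc w lab using A(1) by unfold_locales
  interpret A': coil M m n c r p' cc' w' lab' using A'(1) by unfold_locales
  have len: "length (x i) = length p + 2" "length (x j) = length p' + 2" using A.infl_blowup(2) A'.infl_blowup(2) A(2) A'(2) by auto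
  have "\<not> length (x i) \<le> B" using xX(1) perm unfolding X_def by blast
  then have big: "1 + (2 * (l * (m + n)) + 1) * (2 * l) + 2 * l \<le> length p" using len(1) unfolding B_def by linarith
  have lab: "lab k = lab' k" if "k \<in> {1..l}" for k
  proof -
    have "map lab [1..<Suc l] = map lab' [1..<Suc l]" using xX(3) unfolding labs_def q q' by simp
    moreover have "k \<in> set [1..<Suc l]" using that by auto
    ultimately show ?thesis by (simp only: map_eq_conv)
  qed
  have "length p = length p'" by (rule infl_le_length[OF A(1) A'(1) lab _ big]) (use ij(2) A(2) A'(2) in auto)
  then have "enumerate I i = enumerate I j" using len x[of i] x[of j] by simp
  then show False using enumerate_mono[OF ij(1) infI] by simp
qed

end

theorem theorem6p5:
  fixes M :: "nat \<Rightarrow> nat \<Rightarrow> int" and m n :: nat and c r :: "nat \<Rightarrow> int"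
    and C :: "nat list set"
  assumes "gridding_matrix M m n"
    and "partial_mult_matrix_wrt M m n c r"
    and "rc_graph_is_cycle M m n"
    and "perm_class C"
    and "C \<subseteq> Grid M m n"
  shows "wqo_perms C \<longleftrightarrow> finite (C \<inter> end_inflated_coils M m n c r)"
proof -
  interpret cycle_matrix M m n c r by unfold_locales (fact assms)+
  show ?thesis using wqo_if_finite[OF assms(4,5)] finite_if_wqo[OF assms(4)] by blast
qed

end
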